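(* Let $\tau\in\mathbb{H}$ and assume that $G(z;\tau)$ admits a pair of nontrivial critical points $\pm a$ with $a=r+s\tau$, $(r,s)\in[0,1/2]\times[0,1]\setminus\frac12\mathbb{Z}^2$. Let $\{\mathbf{u}_\beta(z;\tau,a)\}$ be the unique even family of solutions of $$\Delta u+e^{u}=8\pi\delta_{0}+4\pi(\delta_{a}+\delta_{-a})\quad\text{on }E_\tau$$ that blows up at $\pm a$ as $\beta\to\pm\infty$, respectively. Then the monodromy data of this family is precisely $(2r,2s)$ mod $\mathbb{Z}^2$.
   Context: $\mathbb{H}$ is the upper half plane, $\Lambda_\tau=\mathbb{Z}\oplus\tau\mathbb{Z}$, $E_\tau=\mathbb{C}/\Lambda_\tau$, $\delta_q$ is the Dirac measure at $q$. Green function: $G(z;\tau)$ is defined by $-\Delta G=\delta_0-\frac1{|E_\tau|}$ on $E_\tau$, $\int_{E_\tau}G=0$. The half periods $\frac12,\frac\tau2,\frac{1+\tau}2$ are always critical points ("trivial"); any other critical point is nontrivial. Nontrivial critical points, if any, form exactly one pair $\pm a$. Developing maps and families: a solution $u$ can be written $u=\log\frac{8|f'|^2}{(1+|f|^2)^2}$ with $f$ meromorphic on $\mathbb{C}$ (a developing map), and $f$ can be chosen of type II: $f(z+1)=e^{-4\pi i s'}f(z)$, $f(z+\tau)=e^{4\pi i r'}f(z)$ with $(r',s')\in\mathbb{R}^2$. Then $u_\beta=\log\frac{8e^{2\beta}|f'|^2}{(1+e^{2\beta}|f|^2)^2}$, $\beta\in\mathbb{R}$, is a family of solutions, and the pair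 $(r',s')$ is called the monodromy data of the family. So the family has monodromy data $(2r,2s)$ when its type II developing map $f$ satisfies $f(z+1)=e^{-4\pi i(2s)}f(z)$ and $f(z+\tau)=e^{4\pi i(2r)}f(z)$. The family is even if it contains an even solution. Blow-up: the family blows up at $a$ as $\beta\to+\infty$ if $u_\beta(z)+4\pi G(z-a;\tau)$ blows up at $a$ (its supremum over every neighbourhood of $a$ tends to $+\infty$), and at $-a$ as $\beta\to-\infty$ if $u_\beta(z)+4\pi G(z+a;\tau)$ blows up at $-a$; equivalently $a$ is a zero and $-a$ a pole of $f$. Under the hypothesis on $G$, an even family of the displayed equation with this blow-up behaviour exists and is unique. *)

theory Defs
  imports "HOL-Complex_Analysis.Complex_Analysis"
begin

section \<open>Functions on a torus\<close>

definition lattice :: "complex \<Rightarrow> complex set" where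
  "lattice \<tau> = {of_int m + of_int n * \<tau> | m n :: int. True}"

text \<open>Functions on the torus are represented by periodic functions on the plane, and integrals
  over the torus by integrals over the following fundamental domain.\<close>

definition fund_domain :: "complex \<Rightarrow> complex set" where
  "fund_domain \<tau> = {of_real x + of_real y * \<tau> | x y :: real. 0 \<le> x \<and> x < 1 \<and> 0 \<le> y \<and> y < 1}"

definition torus_area :: "complex \<Rightarrow> real" where
  "torus_area \<tau> = measure lborel (fund_domain \<tau>)"

definition torus_integral :: "complex \<Rightarrow> (complex \<Rightarrow> real) \<Rightarrow> real" where
  "torus_integral \<tau> h = (LINT z:fund_domain \<tau>|lborel. h z)"

definition torus_integrable :: "complex \<Rightarrow> (complex \<Rightarrow> real) \<Rightarrow> bool" where
  "torus_integrable \<tau> h \<longleftrightarrow> set_integrable lborel (fund_domain \<tau>) h"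

definition periodic :: "complex \<Rightarrow> (complex \<Rightarrow> real) \<Rightarrow> bool" where
  "periodic \<tau> h \<longleftrightarrow> (\<forall>z. \<forall>w\<in>lattice \<tau>. h (z + w) = h z)"


section \<open>Smooth test functions\<close>

definition partial_x :: "(complex \<Rightarrow> real) \<Rightarrow> complex \<Rightarrow> real" where
  "partial_x \<phi> z = frechet_derivative \<phi> (at z) 1"

definition partial_y :: "(complex \<Rightarrow> real) \<Rightarrow> complex \<Rightarrow> real" where
  "partial_y \<phi> z = frechet_derivative \<phi> (at z) \<i>"

definition laplacian :: "(complex \<Rightarrow> real) \<Rightarrow> complex \<Rightarrow> real" where
  "laplacian \<phi> z = partial_x (partial_x \<phi>) z + partial_y (partial_y \<phi>) z"

primrec C_k :: "nat \<Rightarrow> (complex \<Rightarrow> real) \<Rightarrow> bool" where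
  "C_k 0 \<phi> \<longleftrightarrow> continuous_on UNIV \<phi>"
| "C_k (Suc k) \<phi> \<longleftrightarrow>
     (\<forall>z. \<phi> differentiable (at z)) \<and> C_k k (partial_x \<phi>) \<and> C_k k (partial_y \<phi>)"

definition test_function :: "complex \<Rightarrow> (complex \<Rightarrow> real) \<Rightarrow> bool" where
  "test_function \<tau> \<phi> \<longleftrightarrow> periodic \<tau> \<phi> \<and> (\<forall>k. C_k k \<phi>)"


section \<open>The Green function and its critical points\<close>

text \<open>The equation \<open>- \<Delta> G = \<delta>\<^sub>0 - 1/|E|\<close> is meant in the sense of distributions on the torus.
  It determines \<open>G\<close> almost everywhere; continuity off the lattice selects the
  usual representative. The values of \<open>G\<close> on the lattice, where it is infinite, are irrelevant.\<close>

definition green_function :: "complex \<Rightarrow> (complex \<Rightarrow> real) \<Rightarrow> bool" where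
  "green_function \<tau> G \<longleftrightarrow>
     periodic \<tau> G \<and> continuous_on (- lattice \<tau>) G \<and> torus_integrable \<tau> G \<and>
     (\<forall>\<phi>. test_function \<tau> \<phi> \<longrightarrow>
        - torus_integral \<tau> (\<lambda>z. G z * laplacian \<phi> z) =
          \<phi> 0 - 1 / torus_area \<tau> * torus_integral \<tau> \<phi>) \<and>
     torus_integral \<tau> G = 0"

definition critical_point :: "complex \<Rightarrow> (complex \<Rightarrow> real) \<Rightarrow> complex \<Rightarrow> bool" where
  "critical_point \<tau> G p \<longleftrightarrow> p \<notin> lattice \<tau> \<and> (G has_derivative (\<lambda>_. 0)) (at p)"

definition nontrivial_critical_point :: "complex \<Rightarrow> (complex \<Rightarrow> real) \<Rightarrow> complex \<Rightarrow> bool" where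
  "nontrivial_critical_point \<tau> G p \<longleftrightarrow>
     critical_point \<tau> G p \<and> (\<forall>w\<in>{1/2, \<tau>/2, (1 + \<tau>)/2}. p - w \<notin> lattice \<tau>)"


section \<open>The mean field equation\<close>

definition singular_set :: "complex \<Rightarrow> complex \<Rightarrow> complex set" where
  "singular_set \<tau> a = {z. z \<in> lattice \<tau> \<or> z - a \<in> lattice \<tau> \<or> z + a \<in> lattice \<tau>}"

text \<open>Solutions of \<open>\<Delta> u + e\<^sup>u = 8\<pi> \<delta>\<^sub>0 + 4\<pi> (\<delta>\<^sub>a + \<delta>\<^sub>-\<^sub>a)\<close> on the torus, again in the sense of
  distributions and with the representative that is continuous off the singular set.
  The values of \<open>u\<close> on the singular set, where \<open>u\<close> is \<open>-\<infinity>\<close>, are irrelevant.\<close>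

definition solution :: "complex \<Rightarrow> complex \<Rightarrow> (complex \<Rightarrow> real) \<Rightarrow> bool" where
  "solution \<tau> a u \<longleftrightarrow>
     periodic \<tau> u \<and> continuous_on (- singular_set \<tau> a) u \<and>
     torus_integrable \<tau> u \<and> torus_integrable \<tau> (\<lambda>z. exp (u z)) \<and>
     (\<forall>\<phi>. test_function \<tau> \<phi> \<longrightarrow>
        torus_integral \<tau> (\<lambda>z. u z * laplacian \<phi> z + exp (u z) * \<phi> z) =
          8 * pi * \<phi> 0 + 4 * pi * (\<phi> a + \<phi> (- a)))"

definition has_monodromy_data ::
    "complex \<Rightarrow> (complex \<Rightarrow> complex) \<Rightarrow> real \<Rightarrow> real \<Rightarrow> bool" where
  "has_monodromy_data \<tau> f r s \<longleftrightarrow>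
     (\<forall>z. f (z + 1) = exp (- 4 * of_real pi * \<i> * of_real s) * f z) \<and>
     (\<forall>z. f (z + \<tau>) = exp (4 * of_real pi * \<i> * of_real r) * f z)"

definition type_II :: "complex \<Rightarrow> (complex \<Rightarrow> complex) \<Rightarrow> bool" where
  "type_II \<tau> f \<longleftrightarrow> (\<exists>r s. has_monodromy_data \<tau> f r s)"

text \<open>The family of solutions \<open>u \<beta>\<close> with developing map \<open>f\<close>. The formula is required wherever it
  makes sense literally: at poles of \<open>f\<close> the value of \<open>u \<beta>\<close> is determined by continuity, and at
  zeros of the derivative the right-hand side is \<open>-\<infinity>\<close>. Nice meromorphy fixes the values of
  \<open>f\<close> (continuous away from the poles, 0 at the poles).\<close>

definition solution_family ::
    "complex \<Rightarrow> complex \<Rightarrow> (complex \<Rightarrow> complex) \<Rightarrow> (real \<Rightarrow> complex \<Rightarrow> real) \<Rightarrow> bool" where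
  "solution_family \<tau> a f u \<longleftrightarrow>
     f nicely_meromorphic_on UNIV \<and> \<not> f constant_on UNIV \<and> type_II \<tau> f \<and>
     (\<forall>\<beta>. solution \<tau> a (u \<beta>) \<and>
        (\<forall>z. \<not> is_pole f z \<and> deriv f z \<noteq> 0 \<longrightarrow>
           u \<beta> z = ln (8 * exp (2 * \<beta>) * (norm (deriv f z))\<^sup>2 /
                         (1 + exp (2 * \<beta>) * (norm (f z))\<^sup>2)\<^sup>2)))"

definition even_family :: "complex \<Rightarrow> complex \<Rightarrow> (real \<Rightarrow> complex \<Rightarrow> real) \<Rightarrow> bool" where
  "even_family \<tau> a u \<longleftrightarrow> (\<exists>\<beta>. \<forall>z. z \<notin> singular_set \<tau> a \<longrightarrow> u \<beta> (- z) = u \<beta> z)"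

text \<open>The point \<open>p\<close> itself is left out of the supremum because the functions of interest,
  such as \<open>u \<beta> z + 4\<pi> G (z - p)\<close>, extend continuously to \<open>p\<close> but are not defined there by
  their formula.\<close>

definition blows_up_at :: "(real \<Rightarrow> complex \<Rightarrow> real) \<Rightarrow> complex \<Rightarrow> real filter \<Rightarrow> bool" where
  "blows_up_at v p F \<longleftrightarrow>
     (\<forall>U. open U \<and> p \<in> U \<longrightarrow> ((\<lambda>\<beta>. SUP z\<in>U - {p}. ereal (v \<beta> z)) \<longlongrightarrow> \<infinity>) F)"

end

theory Submission
  imports Defs
begin

text \<open>
  The multipliers of a developing map \<open>f\<close> of type II are unimodular, and they are determined by the
  zeros and poles of \<open>f\<close>. Indeed, write the multipliers as \<open>exp(-4\<pi>is\<^sub>1)\<close> and \<open>exp(4\<pi>ir\<^sub>1)\<close> with real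
  \<open>r\<^sub>1, s\<^sub>1\<close>. Integrating \<open>z f'/f\<close> over a period parallelogram gives Abel's relation: modulo the lattice,
  the zeros minus the poles of \<open>f\<close>, counted with multiplicity, sum up to \<open>2r\<^sub>1 + 2s\<^sub>1\<tau>\<close>. If \<open>f\<close> has a
  double zero at \<open>a\<close>, a double pole at \<open>-a\<close> and no others modulo the lattice, that sum is
  \<open>2a - 2(-a) = 4a = 4r + 4s\<tau>\<close>. As \<open>r, s, r\<^sub>1, s\<^sub>1\<close> are real, \<open>2r\<^sub>1 - 4r\<close> and \<open>2s\<^sub>1 - 4s\<close> are integers, and
  an integer change of \<open>2r\<^sub>1\<close> and \<open>2s\<^sub>1\<close> does not change the multipliers. So the theorem is a statement
  about the divisor of \<open>f\<close>, which is found in three steps.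

  \<^item> The equation prescribes local orders (\<open>solution_local_order\<close>). Near a point where \<open>f'\<close> vanishes to
    order \<open>m\<close>, a solution is \<open>2m ln |z - p|\<close> plus a continuous function. Testing the equation with a
    bump that shrinks to \<open>p\<close> shows that \<open>4\<pi>m\<close> is the point mass at \<open>p\<close>: \<open>m\<close> is 2 at lattice points,
    1 at \<open>\<plusminus>a\<close> and 0 elsewhere. The same holds for \<open>1/f\<close> at the poles of \<open>f\<close>, because replacing \<open>f\<close> and
    \<open>\<beta>\<close> by \<open>1/f\<close> and \<open>-\<beta>\<close> leaves the solutions unchanged (\<open>developing_inverse\<close>).

  \<^item> The blow-up locates a zero at \<open>a\<close> (\<open>blow_up_imp_zero\<close>), and by symmetry a pole at \<open>-a\<close>. If \<open>f\<close> did not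
    vanish at \<open>a\<close>, then \<open>u\<^sub>\<beta>\<close> would be at most \<open>2 ln |z - a| - 2\<beta>\<close> plus a constant near \<open>a\<close>. This is
    where the Green function enters, through \<open>4\<pi>G(z) \<le> - 2 ln |z| + C\<close>
    (\<open>green_function_upper_bound\<close>), an estimate extracted from its distributional definition with
    smoothed logarithms as test functions.

  \<^item> Elliptic functions have as many zeros as poles. The elliptic function \<open>f'/f\<close> has simple poles at
    the zeros and poles of \<open>f\<close>, in particular at \<open>\<plusminus>a\<close>; by the first step its zeros lie in the lattice
    and have order at most 2. Hence \<open>\<plusminus>a\<close> are its only poles (\<open>developing_divisor\<close>).
\<close>

section \<open>Radial integrals in the plane\<close>

text \<open>Polar coordinates for radial functions: a disc of squared radius \<open>t\<close> has area \<open>\<pi> t\<close>,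
  so the squared distance to a point pushes Lebesgue measure forward to \<open>\<pi> dt\<close> on the half-line.
  Squared distances are smooth at the centre, which is why they are preferred to distances
  throughout.\<close>

lemma distr_dist_square:
  fixes p :: complex
  shows "distr lborel borel (\<lambda>z. (dist p z)\<^sup>2) = density lborel (\<lambda>t. ennreal (pi * indicator {0..} t))"
proof (rule measure_eqI_generator_eq[where E = "range atMost" and A = "\<lambda>n. {..real n}" and \<Omega> = UNIV])
  show "Int_stable (range (atMost :: real \<Rightarrow> real set))"
    by (auto simp: Int_stable_def)
  have "sets (borel :: real measure) = sigma_sets UNIV (range atMost)"
    by (subst borel_eq_atMost) simp
  then show "sets (distr lborel borel (\<lambda>z. (dist p z)\<^sup>2)) = sigma_sets UNIV (range atMost)"
    "sets (density lborel (\<lambda>t::real. ennreal (pi * indicator {0..} t))) = sigma_sets UNIV (range atMost)"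
    by simp_all
  have disc: "emeasure (distr lborel borel (\<lambda>z. (dist p z)\<^sup>2)) {..t} = ennreal (pi * max 0 t)" for t
  proof -
    have "(\<lambda>z. (dist p z)\<^sup>2) -` {..t} = (if t < 0 then {} else cball p (sqrt t))"
        using power2_le_iff_abs_le[of "sqrt t"] by (auto simp: not_less) (smt (verit) zero_le_power2)
    then show ?thesis
      by (subst emeasure_distr) (auto simp: emeasure_cball unit_ball_vol_2 mult.commute)
  qed
  show "emeasure (distr lborel borel (\<lambda>z. (dist p z)\<^sup>2)) X =
      emeasure (density lborel (\<lambda>t::real. ennreal (pi * indicator {0..} t))) X" if X_range: "X \<in> range atMost" for X
  proof -
    obtain t where X: "X = {..t}" using X_range by auto
    have "emeasure (density lborel (\<lambda>t::real. ennreal (pi * indicator {0..} t))) {..t}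
        = (\<integral>\<^sup>+x. ennreal pi * indicator {0..t} x \<partial>lborel)"
      by (subst emeasure_density) (auto intro!: nn_integral_cong simp: indicator_def)
    also have "\<dots> = ennreal (pi * max 0 t)"
      by (simp add: nn_integral_cmult ennreal_mult max_def)
    finally show ?thesis unfolding X disc by simp
  qed
  show "emeasure (distr lborel borel (\<lambda>z. (dist p z)\<^sup>2)) {..real n} \<noteq> \<infinity>" for n
    unfolding disc by simp
qed (auto intro: real_arch_simple)

lemma radial_integral:
  fixes p :: complex and F :: "real \<Rightarrow> real"
  assumes [measurable]: "F \<in> borel_measurable borel"
  shows "integrable lborel (\<lambda>z. F ((dist p z)\<^sup>2)) \<longleftrightarrow> integrable lborel (\<lambda>t. pi * indicator {0..} t * F t)"
    and "(LINT z|lborel. F ((dist p z)\<^sup>2)) = (LINT t|lborel. pi * indicator {0..} t * F t)"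
proof -
  have "integrable lborel (\<lambda>z. F ((dist p z)\<^sup>2)) \<longleftrightarrow> integrable (distr lborel borel (\<lambda>z. (dist p z)\<^sup>2)) F"
    by (subst integrable_distr_eq) auto
  then show "integrable lborel (\<lambda>z. F ((dist p z)\<^sup>2)) \<longleftrightarrow> integrable lborel (\<lambda>t. pi * indicator {0..} t * F t)"
    unfolding distr_dist_square by (subst (asm) integrable_density) auto
  have "(LINT z|lborel. F ((dist p z)\<^sup>2)) = integral\<^sup>L (distr lborel borel (\<lambda>z. (dist p z)\<^sup>2)) F"
    by (subst integral_distr) auto
  also have "\<dots> = (LINT t|lborel. pi * indicator {0..} t * F t)"
    unfolding distr_dist_square by (subst integral_density) auto
  finally show "(LINT z|lborel. F ((dist p z)\<^sup>2)) = (LINT t|lborel. pi * indicator {0..} t * F t)" .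
qed

text \<open>The integrands below may have a logarithmic singularity at the centre, so differentiability of
  the antiderivative is required in the interior only and continuity up to the ends.\<close>

lemma radial_integral_FTC:
  fixes p :: complex and F \<Phi> :: "real \<Rightarrow> real"
  assumes [measurable]: "F \<in> borel_measurable borel" and "R > 0"
    and int: "set_integrable lborel (ball p R) (\<lambda>z. F ((dist p z)\<^sup>2))"
    and cont: "continuous_on {0..R\<^sup>2} \<Phi>"
    and deriv: "\<And>t. 0 < t \<Longrightarrow> t < R\<^sup>2 \<Longrightarrow> (\<Phi> has_real_derivative F t) (at t)"
  shows "(LINT z:ball p R|lborel. F ((dist p z)\<^sup>2)) = pi * (\<Phi> (R\<^sup>2) - \<Phi> 0)"
proof -
  define H where "H t = indicator {..<R\<^sup>2} t * F t" for t
  have [measurable]: "H \<in> borel_measurable borel" unfolding H_def by measurable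
  have less_iff: "dist p z < R \<longleftrightarrow> (dist p z)\<^sup>2 < R\<^sup>2" for z
    using \<open>R > 0\<close> abs_le_square_iff[of R "dist p z"] by (simp flip: not_le)
  have ind: "indicator (ball p R) z * F ((dist p z)\<^sup>2) = H ((dist p z)\<^sup>2)" for z
    by (auto simp: H_def indicator_def less_iff)
  have "integrable lborel (\<lambda>t. pi * indicator {0..} t * H t)"
    using int by (simp add: set_integrable_def ind radial_integral(1))
  then have "integrable lborel (\<lambda>t. (1/pi) * (pi * indicator {0..} t * H t))"
    by (rule integrable_mult_right)
  moreover have eq: "(1/pi) * (pi * indicator {0..} t * H t) = indicator {0..<R\<^sup>2} t *\<^sub>R F t" for t
    by (auto simp: H_def indicator_def)
  ultimately have I: "set_integrable lborel {0..<R\<^sup>2} F" by (simp add: set_integrable_def)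
  have "(F has_integral (\<Phi> (R\<^sup>2) - \<Phi> 0)) {0..R\<^sup>2}"
    by (rule fundamental_theorem_of_calculus_interior)
       (use cont deriv in \<open>auto simp: has_real_derivative_iff_has_vector_derivative\<close>)
  then have "(F has_integral (\<Phi> (R\<^sup>2) - \<Phi> 0)) {0..<R\<^sup>2}"
    by (subst has_integral_spike_set_eq[where T = "{0..R\<^sup>2}"])
       (auto intro: negligible_subset[of "{R\<^sup>2}"])
  then have "(LINT t:{0..<R\<^sup>2}|lborel. F t) = \<Phi> (R\<^sup>2) - \<Phi> 0"
    using set_borel_integral_eq_integral[OF I] by (simp add: integral_unique)
  then have "(LINT t|lborel. (1/pi) * (pi * indicator {0..} t * H t)) = \<Phi> (R\<^sup>2) - \<Phi> 0"
    by (simp only: eq set_lebesgue_integral_def)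
  then have "(LINT t|lborel. pi * indicator {0..} t * H t) = pi * (\<Phi> (R\<^sup>2) - \<Phi> 0)"
    by (subst (asm) integral_mult_right_zero) (simp add: field_simps flip: distrib_left)
  then show ?thesis
    by (simp add: set_lebesgue_integral_def ind radial_integral(2))
qed

section \<open>Lattice coordinates and localized torus integrals\<close>

text \<open>Coordinates with respect to the real basis \<open>1, \<tau>\<close> of the plane. They turn the lattice into
  the points with integral coordinates and the fundamental domain into the half-open unit square.\<close>

definition coord_x :: "complex \<Rightarrow> complex \<Rightarrow> real" where
  "coord_x \<tau> z = Re z - Im z / Im \<tau> * Re \<tau>"

definition coord_y :: "complex \<Rightarrow> complex \<Rightarrow> real" where
  "coord_y \<tau> z = Im z / Im \<tau>"

lemma coord_add: "coord_x \<tau> (z + w) = coord_x \<tau> z + coord_x \<tau> w" "coord_y \<tau> (z + w) = coord_y \<tau> z + coord_y \<tau> w"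
  and coord_diff: "coord_x \<tau> (z - w) = coord_x \<tau> z - coord_x \<tau> w" "coord_y \<tau> (z - w) = coord_y \<tau> z - coord_y \<tau> w"
  and coord_minus: "coord_x \<tau> (- z) = - coord_x \<tau> z" "coord_y \<tau> (- z) = - coord_y \<tau> z"
  by (simp_all add: coord_x_def coord_y_def add_divide_distrib diff_divide_distrib algebra_simps)

lemma coord_combination:
  assumes "Im \<tau> > 0"
  shows "coord_x \<tau> (of_real x + of_real y * \<tau>) = x" "coord_y \<tau> (of_real x + of_real y * \<tau>) = y"
  using assms by (simp_all add: coord_x_def coord_y_def)

lemma coord_decomposition:
  assumes "Im \<tau> > 0"
  shows "z = of_real (coord_x \<tau> z) + of_real (coord_y \<tau> z) * \<tau>"
  using assms by (simp add: complex_eq_iff coord_x_def coord_y_def)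

lemma coord_measurable [measurable]:
  "coord_x \<tau> \<in> borel_measurable borel" "coord_y \<tau> \<in> borel_measurable borel"
proof -
  have [measurable]: "Re \<in> borel_measurable borel" "Im \<in> borel_measurable borel"
    by (intro borel_measurable_continuous_onI continuous_intros)+
  show "coord_x \<tau> \<in> borel_measurable borel" "coord_y \<tau> \<in> borel_measurable borel"
    unfolding coord_x_def[abs_def] coord_y_def[abs_def] by measurable
qed

lemma lattice_iff_coord:
  assumes "Im \<tau> > 0"
  shows "z \<in> lattice \<tau> \<longleftrightarrow> coord_x \<tau> z \<in> \<int> \<and> coord_y \<tau> z \<in> \<int>"
proof
  assume "z \<in> lattice \<tau>"
  then obtain m n :: int where "z = of_real (of_int m) + of_real (of_int n) * \<tau>"
    by (auto simp: lattice_def)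
  then show "coord_x \<tau> z \<in> \<int> \<and> coord_y \<tau> z \<in> \<int>"
    using coord_combination[OF assms, of "of_int m" "of_int n"] by simp
next
  assume "coord_x \<tau> z \<in> \<int> \<and> coord_y \<tau> z \<in> \<int>"
  then obtain m n :: int where "coord_x \<tau> z = of_int m" "coord_y \<tau> z = of_int n"
    by (auto elim!: Ints_cases)
  then have "z = of_int m + of_int n * \<tau>"
    using coord_decomposition[OF assms, of z] by simp
  then show "z \<in> lattice \<tau>" by (auto simp: lattice_def)
qed

lemma fund_domain_iff_coord:
  assumes "Im \<tau> > 0"
  shows "z \<in> fund_domain \<tau> \<longleftrightarrow> coord_x \<tau> z \<in> {0..<1} \<and> coord_y \<tau> z \<in> {0..<1}"
proof
  assume "z \<in> fund_domain \<tau>"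
  then show "coord_x \<tau> z \<in> {0..<1} \<and> coord_y \<tau> z \<in> {0..<1}"
    using coord_combination[OF assms] by (auto simp: fund_domain_def)
next
  assume "coord_x \<tau> z \<in> {0..<1} \<and> coord_y \<tau> z \<in> {0..<1}"
  then show "z \<in> fund_domain \<tau>"
    using coord_decomposition[OF assms, of z] unfolding fund_domain_def by auto
qed

lemma fund_domain_measurable:
  assumes "Im \<tau> > 0"
  shows "fund_domain \<tau> \<in> sets borel"
proof -
  have "fund_domain \<tau> = {z \<in> space borel. coord_x \<tau> z \<in> {0..<1} \<and> coord_y \<tau> z \<in> {0..<1}}"
    using fund_domain_iff_coord[OF assms] by auto
  also have "\<dots> \<in> sets borel" by measurable
  finally show ?thesis .
qed

lemma lattice_closed:
  assumes "Im \<tau> > 0"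
  shows "0 \<in> lattice \<tau>"
    and "v \<in> lattice \<tau> \<Longrightarrow> w \<in> lattice \<tau> \<Longrightarrow> v + w \<in> lattice \<tau>"
    and "v \<in> lattice \<tau> \<Longrightarrow> w \<in> lattice \<tau> \<Longrightarrow> v - w \<in> lattice \<tau>"
    and "v \<in> lattice \<tau> \<Longrightarrow> - v \<in> lattice \<tau>"
    and "1 \<in> lattice \<tau>" and "\<tau> \<in> lattice \<tau>"
  using assms unfolding lattice_iff_coord[OF assms]
  by (simp_all add: coord_add coord_diff coord_minus) (simp_all add: coord_x_def coord_y_def)

lemma fund_domain_translate:
  assumes "Im \<tau> > 0"
  shows "\<exists>!w. w \<in> lattice \<tau> \<and> z - w \<in> fund_domain \<tau>"
proof
  let ?w = "of_int \<lfloor>coord_x \<tau> z\<rfloor> + of_int \<lfloor>coord_y \<tau> z\<rfloor> * \<tau>"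
  have "coord_x \<tau> ?w = \<lfloor>coord_x \<tau> z\<rfloor>" "coord_y \<tau> ?w = \<lfloor>coord_y \<tau> z\<rfloor>"
    using coord_combination[OF assms, of "of_int \<lfloor>coord_x \<tau> z\<rfloor>" "of_int \<lfloor>coord_y \<tau> z\<rfloor>"] by simp_all
  then show "?w \<in> lattice \<tau> \<and> z - ?w \<in> fund_domain \<tau>"
    using assms by (auto simp: lattice_iff_coord fund_domain_iff_coord coord_diff) linarith+
  fix w assume w: "w \<in> lattice \<tau> \<and> z - w \<in> fund_domain \<tau>"
  then obtain m n where mn: "coord_x \<tau> w = of_int m" "coord_y \<tau> w = of_int n"
    using assms by (auto simp: lattice_iff_coord elim!: Ints_cases)
  have "m = \<lfloor>coord_x \<tau> z\<rfloor>" "n = \<lfloor>coord_y \<tau> z\<rfloor>"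
    using w mn assms by (auto simp: fund_domain_iff_coord coord_diff intro!: floor_unique[symmetric])
  then show "w = ?w"
    using coord_decomposition[OF assms, of w] mn by simp
qed

lemma norm_fund_domain_le:
  assumes "z \<in> fund_domain \<tau>"
  shows "norm z \<le> 1 + norm \<tau>"
proof -
  obtain x y where xy: "z = of_real x + of_real y * \<tau>" "0 \<le> x" "x < 1" "0 \<le> y" "y < 1"
    using assms by (auto simp: fund_domain_def)
  have "norm z \<le> \<bar>x\<bar> + \<bar>y\<bar> * norm \<tau>"
    unfolding xy(1) by (metis norm_triangle_ineq norm_mult norm_of_real)
  also have "\<dots> \<le> 1 + 1 * norm \<tau>"
    using xy by (intro add_mono mult_right_mono) auto
  finally show ?thesis by simp
qed

lemma norm_ge_coord:
  assumes "Im \<tau> > 0"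
  shows "\<exists>c>0. \<forall>z. \<bar>coord_x \<tau> z\<bar> \<le> c * norm z \<and> \<bar>coord_y \<tau> z\<bar> \<le> c * norm z"
proof (intro exI conjI allI)
  let ?c = "1 + 1 / Im \<tau> + \<bar>Re \<tau>\<bar> / Im \<tau>"
  show "?c > 0" using assms by (simp add: add_pos_nonneg)
  fix z
  have 1: "\<bar>Im z\<bar> / Im \<tau> \<le> norm z / Im \<tau>"
    using assms abs_Im_le_cmod[of z] by (intro divide_right_mono) auto
  have "\<bar>coord_y \<tau> z\<bar> = \<bar>Im z\<bar> / Im \<tau>" using assms by (simp add: coord_y_def)
  also have "\<dots> \<le> norm z * (1 / Im \<tau>)" using 1 by simp
  also have "\<dots> \<le> norm z * ?c" using assms by (intro mult_left_mono) auto
  finally show "\<bar>coord_y \<tau> z\<bar> \<le> ?c * norm z" by (simp add: mult.commute)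
  have "\<bar>coord_x \<tau> z\<bar> \<le> \<bar>Re z\<bar> + \<bar>Im z\<bar> / Im \<tau> * \<bar>Re \<tau>\<bar>"
    unfolding coord_x_def using assms abs_triangle_ineq4[of "Re z" "Im z / Im \<tau> * Re \<tau>"] by (simp add: abs_mult)
  also have "\<dots> \<le> norm z + norm z / Im \<tau> * \<bar>Re \<tau>\<bar>"
    using 1 abs_Re_le_cmod by (intro add_mono mult_right_mono) auto
  also have "\<dots> = norm z * (1 + \<bar>Re \<tau>\<bar> / Im \<tau>)" by (simp add: algebra_simps)
  also have "\<dots> \<le> norm z * ?c" using assms by (intro mult_left_mono) auto
  finally show "\<bar>coord_x \<tau> z\<bar> \<le> ?c * norm z" by (simp add: mult.commute)
qed

lemma lattice_separated:
  assumes "Im \<tau> > 0"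
  shows "\<exists>\<delta>>0. \<forall>w\<in>lattice \<tau>. w \<noteq> 0 \<longrightarrow> \<delta> \<le> norm w"
proof -
  obtain c where c: "c > 0" "\<And>z. \<bar>coord_x \<tau> z\<bar> \<le> c * norm z" "\<And>z. \<bar>coord_y \<tau> z\<bar> \<le> c * norm z"
    using norm_ge_coord[OF assms] by auto
  have "1 / c \<le> norm w" if w: "w \<in> lattice \<tau>" "w \<noteq> 0" for w
  proof -
    have "coord_x \<tau> w \<noteq> 0 \<or> coord_y \<tau> w \<noteq> 0"
      using coord_decomposition[OF assms, of w] w by auto
    then have "1 \<le> \<bar>coord_x \<tau> w\<bar> \<or> 1 \<le> \<bar>coord_y \<tau> w\<bar>"
      using w assms by (auto simp: lattice_iff_coord intro: Ints_nonzero_abs_ge1)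
    then have "1 \<le> c * norm w" using c(2,3)[of w] by auto
    then show ?thesis using c(1) by (simp add: field_simps)
  qed
  then show ?thesis using c(1) by (intro exI[of _ "1 / c"]) auto
qed

lemma finite_lattice_cball:
  assumes "Im \<tau> > 0"
  shows "finite (lattice \<tau> \<inter> cball 0 D)"
proof -
  obtain c where c: "c > 0" "\<And>z. \<bar>coord_x \<tau> z\<bar> \<le> c * norm z" "\<And>z. \<bar>coord_y \<tau> z\<bar> \<le> c * norm z"
    using norm_ge_coord[OF assms] by auto
  define N where "N = \<lceil>c * D\<rceil>"
  have "lattice \<tau> \<inter> cball 0 D \<subseteq> (\<lambda>(m,n). of_int m + of_int n * \<tau>) ` ({-N..N} \<times> {-N..N})"
  proof
    fix w assume w: "w \<in> lattice \<tau> \<inter> cball 0 D"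
    then obtain m n where mn: "coord_x \<tau> w = of_int m" "coord_y \<tau> w = of_int n"
      using assms by (auto simp: lattice_iff_coord elim!: Ints_cases)
    have "c * norm w \<le> c * D" using w c(1) by simp
    then have "\<bar>real_of_int m\<bar> \<le> c * D" "\<bar>real_of_int n\<bar> \<le> c * D"
      using c(2,3)[of w] mn by auto
    then have "\<bar>m\<bar> \<le> N" "\<bar>n\<bar> \<le> N" unfolding N_def by linarith+
    moreover have "w = of_int m + of_int n * \<tau>"
      using coord_decomposition[OF assms, of w] mn by simp
    ultimately show "w \<in> (\<lambda>(m,n). of_int m + of_int n * \<tau>) ` ({-N..N} \<times> {-N..N})"
      by (intro image_eqI[of _ _ "(m,n)"]) auto
  qed
  then show ?thesis by (rule finite_subset) auto
qed

lemma closed_subset_lattice: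
  assumes "Im \<tau> > 0" "S \<subseteq> lattice \<tau>"
  shows "closed S"
proof -
  obtain \<delta> where "\<delta> > 0" "\<And>w. w \<in> lattice \<tau> \<Longrightarrow> w \<noteq> 0 \<Longrightarrow> \<delta> \<le> norm w"
    using lattice_separated[OF assms(1)] by auto
  then show ?thesis
    using lattice_closed(3)[OF assms(1)] assms(2)
    by (intro discrete_imp_closed[of \<delta>]) (auto simp: dist_norm, metis eq_iff_diff_eq_0 not_less subsetD)
qed

lemmas closed_lattice = closed_subset_lattice[OF _ order.refl]

text \<open>A product of a periodic function \<open>H\<close> with a periodic function \<open>K\<close> that lives on the translates of
  one small disc can be integrated over that disc instead of the fundamental domain: both
  integrals are the sum over lattice vectors \<open>w\<close> of the integral of \<open>H k\<close> over the part of the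
  disc that \<open>w\<close> carries into the fundamental domain.\<close>

lemma torus_integral_localize:
  fixes H K k :: "complex \<Rightarrow> real"
  assumes \<tau>: "Im \<tau> > 0" and per: "periodic \<tau> H" and int: "torus_integrable \<tau> H"
    and sep: "\<And>w. w \<in> lattice \<tau> \<Longrightarrow> w \<noteq> 0 \<Longrightarrow> 2 * R \<le> norm w"
    and k_meas: "k \<in> borel_measurable borel" and bound: "\<And>z. \<bar>k z\<bar> \<le> M"
    and K: "\<And>z w. w \<in> lattice \<tau> \<Longrightarrow> z \<in> ball p R \<Longrightarrow> K (z + w) = k z"
    and K0: "\<And>z. (\<And>w. w \<in> lattice \<tau> \<Longrightarrow> z + w \<notin> ball p R) \<Longrightarrow> K z = 0"
  shows "torus_integrable \<tau> (\<lambda>z. H z * K z)"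
    and "set_integrable lborel (ball p R) (\<lambda>z. H z * k z)"
    and "torus_integral \<tau> (\<lambda>z. H z * K z) = (LINT z:ball p R|lborel. H z * k z)"
proof -
  let ?F = "fund_domain \<tau>"
  note [measurable] = fund_domain_measurable[OF \<tau>]
  define W where "W = lattice \<tau> \<inter> cball 0 (1 + norm \<tau> + norm p + R)"
  have "finite W" unfolding W_def using finite_lattice_cball[OF \<tau>] .
  define h where "h w z = indicator ?F z * (indicator (ball p R) (z + w) * (H z * k (z + w)))" for w z
  have HF: "integrable lborel (\<lambda>z. indicator ?F z * H z)"
    using int by (simp add: torus_integrable_def set_integrable_def)
  have h_int: "integrable lborel (h w)" for w
  proof (rule Bochner_Integration.integrable_bound)
    show "integrable lborel (\<lambda>z. M * (indicator ?F z * H z))"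
      using HF by (rule integrable_mult_right)
    have "(\<lambda>z. indicator ?F z * H z) \<in> borel_measurable borel"
      using borel_measurable_integrable[OF HF] by simp
    have "(\<lambda>z. indicator (ball p R) (z + w) * k (z + w)) \<in> borel_measurable borel"
    proof (rule measurable_compose[where f = "\<lambda>z. z + w" and N = borel
            and g = "\<lambda>z. indicator (ball p R) z * k z"])
      show "(\<lambda>z. z + w) \<in> borel_measurable borel"
        by (intro borel_measurable_continuous_onI continuous_intros)
      show "(\<lambda>z. indicator (ball p R) z * k z) \<in> borel_measurable borel"
        by (intro borel_measurable_times borel_measurable_indicator k_meas) simp
    qed
    with \<open>(\<lambda>z. indicator ?F z * H z) \<in> borel_measurable borel\<close>
    have "(\<lambda>z. (indicator ?F z * H z) * (indicator (ball p R) (z + w) * k (z + w))) \<in> borel_measurable borel"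
      by (rule borel_measurable_times)
    also have "(\<lambda>z. (indicator ?F z * H z) * (indicator (ball p R) (z + w) * k (z + w))) = h w"
      by (auto simp: h_def)
    also have "borel_measurable (borel :: complex measure) = borel_measurable lborel" by simp
    finally show "h w \<in> borel_measurable lborel" .
    have "norm (h w z) \<le> norm (M * (indicator ?F z * H z))" for z
    proof -
      have "norm (h w z) \<le> \<bar>indicator ?F z * H z\<bar> * \<bar>k (z + w)\<bar>"
        by (auto simp: h_def abs_mult indicator_def)
      also have "\<dots> \<le> \<bar>indicator ?F z * H z\<bar> * \<bar>M\<bar>"
        using bound[of "z + w"] by (intro mult_left_mono) auto
      finally show ?thesis by (simp add: abs_mult mult_ac)
    qed
    then show "AE z in lborel. norm (h w z) \<le> norm (M * (indicator ?F z * H z))" by simp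
  qed
  (* At most one translate of z lies in the disc, so the sum has at most one nonzero term. *)
  have sum_h: "(\<Sum>w\<in>W. h w z) = indicator ?F z * (H z * K z)" for z
  proof (cases "z \<in> ?F \<and> (\<exists>w\<in>lattice \<tau>. z + w \<in> ball p R)")
    case True
    then obtain w where w: "w \<in> lattice \<tau>" "z + w \<in> ball p R" and "z \<in> ?F" by auto
    have "norm w = norm (z + w - p + p - z)" by simp
    also have "\<dots> \<le> norm (z + w - p) + norm p + norm z"
      by (smt (verit) norm_triangle_ineq norm_triangle_ineq4)
    also have "\<dots> \<le> R + norm p + (1 + norm \<tau>)"
      using w norm_fund_domain_le[OF \<open>z \<in> ?F\<close>] by (auto simp: dist_norm norm_minus_commute)
    finally have "w \<in> W" using w by (simp add: W_def algebra_simps)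
    have "h w' z = 0" if "w' \<in> W - {w}" for w'
    proof -
      have "z + w' \<notin> ball p R"
      proof
        assume "z + w' \<in> ball p R"
        then have "dist (z + w') (z + w) < 2 * R" using w
          by (metis mem_ball dist_commute dist_triangle_less_add mult_2)
        then have "norm (w' - w) < 2 * R" by (simp add: dist_norm)
        moreover have "w' - w \<in> lattice \<tau>" "w' - w \<noteq> 0"
          using that w lattice_closed(3)[OF \<tau>] by (auto simp: W_def)
        ultimately show False using sep by fastforce
      qed
      then show ?thesis by (simp add: h_def)
    qed
    then have "(\<Sum>w'\<in>W. h w' z) = h w z"
      using \<open>finite W\<close> \<open>w \<in> W\<close> by (subst sum.remove[of _ w]) auto
    moreover have "K z = k (z + w)"
      using K[OF lattice_closed(4)[OF \<tau> w(1)] w(2)] by simp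
    ultimately show ?thesis using w \<open>z \<in> ?F\<close> by (simp add: h_def)
  next
    case False
    then have "(\<Sum>w\<in>W. h w z) = 0"
      by (intro sum.neutral) (auto simp: h_def W_def)
    moreover have "z \<notin> ?F \<or> K z = 0" using K0[of z] False by auto
    ultimately show ?thesis by auto
  qed
  have "integrable lborel (\<lambda>z. \<Sum>w\<in>W. h w z)"
    using h_int by (intro Bochner_Integration.integrable_sum)
  then show "torus_integrable \<tau> (\<lambda>z. H z * K z)"
    by (simp add: sum_h torus_integrable_def set_integrable_def)
  have shift: "integrable lborel (\<lambda>z. h w (z - w))"
      "(LINT z|lborel. h w (z - w)) = (LINT z|lborel. h w z)" for w
  proof -
    have [measurable]: "h w \<in> borel_measurable borel" using borel_measurable_integrable[OF h_int] by simp
    show "integrable lborel (\<lambda>z. h w (z - w))"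
      using h_int[of w] lborel_distr_plus[of "-w"] integrable_distr_eq[of "(+) (-w)" lborel borel "h w"] by simp
    show "(LINT z|lborel. h w (z - w)) = (LINT z|lborel. h w z)"
      using lborel_distr_plus[of "-w"] integral_distr[of "(+) (-w)" lborel borel "h w"] by simp
  qed
  (* Exactly one translate of a point of the disc lies in the fundamental domain. *)
  have sum_shift: "(\<Sum>w\<in>W. h w (z - w)) = indicator (ball p R) z * (H z * k z)" for z
  proof (cases "z \<in> ball p R")
    case True
    obtain w where w: "w \<in> lattice \<tau>" "z - w \<in> ?F" and uniq: "\<And>w'. w' \<in> lattice \<tau> \<Longrightarrow> z - w' \<in> ?F \<Longrightarrow> w' = w"
      using fund_domain_translate[OF \<tau>, of z] by auto
    have "norm w = norm ((z - p) + p - (z - w))" by simp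
    also have "\<dots> \<le> norm (z - p) + norm p + norm (z - w)"
      by (smt (verit) norm_triangle_ineq norm_triangle_ineq4)
    also have "\<dots> \<le> R + norm p + (1 + norm \<tau>)"
      using True norm_fund_domain_le[OF w(2)] by (auto simp: dist_norm norm_minus_commute)
    finally have "w \<in> W" using w by (simp add: W_def algebra_simps)
    have "h w' (z - w') = 0" if "w' \<in> W - {w}" for w'
      using that uniq[of w'] by (auto simp: h_def W_def indicator_def)
    then have "(\<Sum>w'\<in>W. h w' (z - w')) = h w (z - w)"
      using \<open>finite W\<close> \<open>w \<in> W\<close> by (subst sum.remove[of _ w]) auto
    moreover have "H (z - w) = H z"
      using per lattice_closed(4)[OF \<tau> w(1)] unfolding periodic_def by force
    ultimately show ?thesis using w True by (simp add: h_def)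
  next
    case False
    then show ?thesis by (simp add: h_def)
  qed
  have "integrable lborel (\<lambda>z. \<Sum>w\<in>W. h w (z - w))"
    using shift by (intro Bochner_Integration.integrable_sum)
  then show "set_integrable lborel (ball p R) (\<lambda>z. H z * k z)"
    by (simp add: sum_shift set_integrable_def)
  have "torus_integral \<tau> (\<lambda>z. H z * K z) = (LINT z|lborel. (\<Sum>w\<in>W. h w z))"
    by (simp add: torus_integral_def set_lebesgue_integral_def sum_h)
  also have "\<dots> = (\<Sum>w\<in>W. LINT z|lborel. h w (z - w))"
    using h_int by (subst Bochner_Integration.integral_sum) (auto simp: shift)
  also have "\<dots> = (LINT z|lborel. (\<Sum>w\<in>W. h w (z - w)))"
    using shift by (subst Bochner_Integration.integral_sum) auto
  finally show "torus_integral \<tau> (\<lambda>z. H z * K z) = (LINT z:ball p R|lborel. H z * k z)"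
    by (simp add: set_lebesgue_integral_def sum_shift)
qed

section \<open>Smooth functions and cutoffs\<close>

definition smooth :: "(complex \<Rightarrow> real) \<Rightarrow> bool" where
  "smooth \<phi> \<longleftrightarrow> (\<forall>k. C_k k \<phi>)"

lemma C_k_Suc_imp_C_k: "C_k (Suc k) \<phi> \<Longrightarrow> C_k k \<phi>"
proof (induction k arbitrary: \<phi>)
  case 0
  then show ?case
    by (auto intro!: continuous_at_imp_continuous_on differentiable_imp_continuous_within)
next
  case (Suc k)
  then have "\<forall>z. \<phi> differentiable (at z)" "C_k (Suc k) (partial_x \<phi>)" "C_k (Suc k) (partial_y \<phi>)"
    unfolding C_k.simps(2)[of "Suc k"] by blast+
  then show ?case using Suc.IH unfolding C_k.simps(2)[of k] by blast
qed

lemma partial_eqI: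
  assumes "(\<phi> has_derivative D) (at z)"
  shows "partial_x \<phi> z = D 1" "partial_y \<phi> z = D \<i>"
  using frechet_derivative_at[OF assms] by (simp_all add: partial_x_def partial_y_def)

lemma smooth_partial:
  assumes "smooth \<phi>"
  shows "smooth (partial_x \<phi>)" "smooth (partial_y \<phi>)" "(\<phi> has_derivative frechet_derivative \<phi> (at z)) (at z)"
    "continuous_on UNIV \<phi>"
proof -
  have "C_k (Suc k) \<phi>" for k using assms by (auto simp: smooth_def simp del: C_k.simps)
  then show "smooth (partial_x \<phi>)" "smooth (partial_y \<phi>)" "(\<phi> has_derivative frechet_derivative \<phi> (at z)) (at z)"
    by (auto simp: smooth_def frechet_derivative_works)
  show "continuous_on UNIV \<phi>" using assms C_k.simps(1) by (auto simp: smooth_def simp del: C_k.simps)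
qed

text \<open>Smoothness is coinductive: a set of differentiable functions that is stable under both
  partial derivatives consists of smooth functions. This avoids tracking the order of
  differentiability.\<close>

lemma smooth_coinduct:
  assumes "\<phi> \<in> X"
    and step: "\<And>\<psi>. \<psi> \<in> X \<Longrightarrow>
      \<exists>D. (\<forall>z. (\<psi> has_derivative D z) (at z)) \<and> (\<lambda>z. D z 1) \<in> X \<and> (\<lambda>z. D z \<i>) \<in> X"
  shows "smooth \<phi>"
proof -
  have "C_k k \<psi>" if "\<psi> \<in> X" for k \<psi>
    using that
  proof (induction k arbitrary: \<psi>)
    case 0
    then obtain D where "\<And>z. (\<psi> has_derivative D z) (at z)" using step by blast
    then show ?case
      by (auto intro!: continuous_at_imp_continuous_on has_derivative_continuous)
  next
    case (Suc k)
    then obtain D where D: "\<And>z. (\<psi> has_derivative D z) (at z)" "(\<lambda>z. D z 1) \<in> X" "(\<lambda>z. D z \<i>) \<in> X"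
      using step by blast
    then have "partial_x \<psi> = (\<lambda>z. D z 1)" "partial_y \<psi> = (\<lambda>z. D z \<i>)"
      using partial_eqI by blast+
    then show ?case using D Suc.IH by (auto simp: differentiable_def)
  qed
  then show ?thesis using assms(1) by (auto simp: smooth_def)
qed

lemma smooth_const: "smooth (\<lambda>_. c)"
  by (rule smooth_coinduct[of _ "range (\<lambda>c _. c)"]) (auto intro!: exI[of _ "\<lambda>_ _. 0"])

lemma smooth_bounded_linear:
  assumes "bounded_linear \<phi>" shows "smooth \<phi>"
proof (rule smooth_coinduct[where X = "insert \<phi> (range (\<lambda>c _. c))"])
  fix \<psi> assume "\<psi> \<in> insert \<phi> (range (\<lambda>c _. c))"
  then consider "\<psi> = \<phi>" | c where "\<psi> = (\<lambda>_. c)" by auto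
  then show "\<exists>D. (\<forall>z. (\<psi> has_derivative D z) (at z)) \<and> (\<lambda>z. D z 1) \<in> insert \<phi> (range (\<lambda>c _. c)) \<and>
      (\<lambda>z. D z \<i>) \<in> insert \<phi> (range (\<lambda>c _. c))"
  proof cases
    case 1
    then show ?thesis using bounded_linear_imp_has_derivative[OF assms]
      by (intro exI[of _ "\<lambda>_. \<phi>"]) auto
  next
    case 2
    then show ?thesis by (intro exI[of _ "\<lambda>_ _. 0"]) auto
  qed
qed auto

lemmas smooth_Re = smooth_bounded_linear[OF bounded_linear_Re]
  and smooth_Im = smooth_bounded_linear[OF bounded_linear_Im]

lemma C_k_add_mult:
  assumes "C_k k \<phi>" "C_k k \<psi>"
  shows "C_k k (\<lambda>z. \<phi> z + \<psi> z) \<and> C_k k (\<lambda>z. \<phi> z * \<psi> z)"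
  using assms
proof (induction k arbitrary: \<phi> \<psi>)
  case 0
  then show ?case by (auto intro: continuous_on_add continuous_on_mult)
next
  case (Suc k)
  have lower: "C_k k \<phi>" "C_k k \<psi>" using Suc.prems C_k_Suc_imp_C_k by blast+
  have upper: "C_k k (partial_x \<phi>)" "C_k k (partial_y \<phi>)" "C_k k (partial_x \<psi>)" "C_k k (partial_y \<psi>)"
    using Suc.prems by simp_all
  have D: "(\<phi> has_derivative frechet_derivative \<phi> (at z)) (at z)" "(\<psi> has_derivative frechet_derivative \<psi> (at z)) (at z)" for z
    using Suc.prems by (simp_all add: frechet_derivative_works)
  note Dadd = has_derivative_add[OF D] and Dmult = has_derivative_mult[OF D]
  have "partial_x (\<lambda>z. \<phi> z + \<psi> z) = (\<lambda>z. partial_x \<phi> z + partial_x \<psi> z)"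
    "partial_y (\<lambda>z. \<phi> z + \<psi> z) = (\<lambda>z. partial_y \<phi> z + partial_y \<psi> z)"
    "partial_x (\<lambda>z. \<phi> z * \<psi> z) = (\<lambda>z. \<phi> z * partial_x \<psi> z + partial_x \<phi> z * \<psi> z)"
    "partial_y (\<lambda>z. \<phi> z * \<psi> z) = (\<lambda>z. \<phi> z * partial_y \<psi> z + partial_y \<phi> z * \<psi> z)"
    unfolding fun_eq_iff partial_eqI[OF Dadd] partial_eqI[OF Dmult] by (simp_all add: partial_x_def partial_y_def)
  moreover have "(\<lambda>z. \<phi> z + \<psi> z) differentiable (at z)" "(\<lambda>z. \<phi> z * \<psi> z) differentiable (at z)" for z
    using Dadd Dmult unfolding differentiable_def by blast+
  ultimately show ?case using Suc.IH lower upper by simp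
qed

lemma smooth_add: "smooth \<phi> \<Longrightarrow> smooth \<psi> \<Longrightarrow> smooth (\<lambda>z. \<phi> z + \<psi> z)"
  and smooth_mult: "smooth \<phi> \<Longrightarrow> smooth \<psi> \<Longrightarrow> smooth (\<lambda>z. \<phi> z * \<psi> z)"
  by (simp_all add: smooth_def C_k_add_mult)

lemma smooth_compose:
  assumes "smooth q" and D: "\<And>n z. (D n has_field_derivative D (Suc n) (q z)) (at (q z))"
  shows "smooth (\<lambda>z. D (n::nat) (q z))"
proof -
  have deriv: "((\<lambda>z. D n (q z)) has_derivative (\<lambda>w. D (Suc n) (q z) * frechet_derivative q (at z) w)) (at z)" for n z
    using has_derivative_compose[OF smooth_partial(3)[OF assms(1)] D[unfolded has_field_derivative_def]] .
  have "C_k k (\<lambda>z. D n (q z))" for k n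
  proof (induction k arbitrary: n)
    case 0
    show ?case
      using has_derivative_continuous[OF deriv] by (simp add: continuous_at_imp_continuous_on)
  next
    case (Suc k)
    have "partial_x (\<lambda>z. D n (q z)) = (\<lambda>z. D (Suc n) (q z) * partial_x q z)"
      "partial_y (\<lambda>z. D n (q z)) = (\<lambda>z. D (Suc n) (q z) * partial_y q z)"
      unfolding fun_eq_iff partial_eqI[OF deriv] by (simp_all add: partial_x_def partial_y_def)
    moreover have "C_k k (partial_x q)" "C_k k (partial_y q)"
      using smooth_partial(1,2)[OF assms(1)] by (simp_all add: smooth_def)
    ultimately show ?case
      using Suc.IH[of "Suc n"] C_k_add_mult deriv unfolding C_k.simps differentiable_def by metis
  qed
  then show ?thesis by (simp add: smooth_def)
qed

lemma smooth_sq_dist: "smooth (\<lambda>z. (dist p z)\<^sup>2)"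
proof -
  have "(\<lambda>z. (dist p z)\<^sup>2) = (\<lambda>z. (Re z + - Re p) * (Re z + - Re p) + (Im z + - Im p) * (Im z + - Im p))"
    unfolding dist_norm cmod_power2 by (auto simp: power2_eq_square algebra_simps)
  then show ?thesis
    by (simp only: smooth_add smooth_mult smooth_Re smooth_Im smooth_const)
qed

text \<open>Smoothness is a local property; it is what makes a locally finite periodization smooth.\<close>

lemma smooth_if_locally_smooth:
  assumes "\<And>z. \<exists>U \<psi>. open U \<and> z \<in> U \<and> smooth \<psi> \<and> (\<forall>x\<in>U. \<phi> x = \<psi> x)"
  shows "smooth \<phi>"
proof (rule smooth_coinduct[where X = "{\<phi>. \<forall>z. \<exists>U \<psi>. open U \<and> z \<in> U \<and> smooth \<psi> \<and> (\<forall>x\<in>U. \<phi> x = \<psi> x)}"])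
  show "\<phi> \<in> {\<phi>. \<forall>z. \<exists>U \<psi>. open U \<and> z \<in> U \<and> smooth \<psi> \<and> (\<forall>x\<in>U. \<phi> x = \<psi> x)}"
    using assms by auto
  fix \<phi> :: "complex \<Rightarrow> real"
  assume "\<phi> \<in> {\<phi>. \<forall>z. \<exists>U \<psi>. open U \<and> z \<in> U \<and> smooth \<psi> \<and> (\<forall>x\<in>U. \<phi> x = \<psi> x)}"
  then have local: "\<exists>U \<psi>. open U \<and> z \<in> U \<and> smooth \<psi> \<and> (\<forall>x\<in>U. \<phi> x = \<psi> x)" for z by auto
  have D: "(\<phi> has_derivative frechet_derivative \<psi> (at z)) (at z)"
    if "open U" "z \<in> U" "smooth \<psi>" "\<forall>x\<in>U. \<phi> x = \<psi> x" for U z \<psi>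
    using that by (intro has_derivative_transform_within_open[OF smooth_partial(3)[OF that(3)] that(1,2)]) auto
  have 1: "(\<phi> has_derivative frechet_derivative \<phi> (at z)) (at z)" for z
    using local[of z] D frechet_derivative_works unfolding differentiable_def by blast
  have 2: "\<exists>U g. open U \<and> z \<in> U \<and> smooth g \<and> (\<forall>x\<in>U. frechet_derivative \<phi> (at x) w = g x)"
    if w: "w = 1 \<or> w = \<i>" for z w
  proof -
    obtain U \<psi> where U: "open U" "z \<in> U" "smooth \<psi>" "\<forall>x\<in>U. \<phi> x = \<psi> x" using local by blast
    have "frechet_derivative \<phi> (at x) = frechet_derivative \<psi> (at x)" if "x \<in> U" for x
      using frechet_derivative_at[OF D[OF U(1) that U(3,4)]] by simp
    moreover have "smooth (\<lambda>x. frechet_derivative \<psi> (at x) w)"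
      using w smooth_partial(1,2)[OF U(3)] by (auto simp: partial_x_def[abs_def] partial_y_def[abs_def])
    ultimately show ?thesis using U by (intro exI[of _ U] exI[of _ "\<lambda>x. frechet_derivative \<psi> (at x) w"]) auto
  qed
  show "\<exists>D. (\<forall>z. (\<phi> has_derivative D z) (at z)) \<and>
     (\<lambda>z. D z 1) \<in> {\<phi>. \<forall>z. \<exists>U \<psi>. open U \<and> z \<in> U \<and> smooth \<psi> \<and> (\<forall>x\<in>U. \<phi> x = \<psi> x)} \<and>
     (\<lambda>z. D z \<i>) \<in> {\<phi>. \<forall>z. \<exists>U \<psi>. open U \<and> z \<in> U \<and> smooth \<psi> \<and> (\<forall>x\<in>U. \<phi> x = \<psi> x)}"
    using 1 2[of 1] 2[of \<i>] by (intro exI[of _ "\<lambda>z. frechet_derivative \<phi> (at z)"]) auto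
qed

text \<open>The functions \<open>q(1/x) exp(-1/x)\<close>, extended by zero to the left, contain the classical flat
  function and are closed under differentiation, because \<open>(1/x)' = - (1/x)\<^sup>2\<close>.\<close>

definition flat_exp :: "real poly \<Rightarrow> real \<Rightarrow> real" where
  "flat_exp q x = (if x > 0 then poly q (1/x) * exp (- 1/x) else 0)"

lemma flat_exp_tendsto_0: "(flat_exp q \<longlongrightarrow> 0) (at 0)"
proof -
  have "((\<lambda>y::real. \<Sum>i\<le>degree q. coeff q i * (y ^ i / exp y)) \<longlongrightarrow> (\<Sum>i\<le>degree q. coeff q i * 0)) at_top"
    by (intro tendsto_intros tendsto_power_div_exp_0)
  then have "((\<lambda>y. poly q y * exp (- y)) \<longlongrightarrow> 0) at_top"
    by (simp add: poly_altdef sum_distrib_right exp_minus divide_inverse mult.assoc)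
  then have "((\<lambda>x. poly q (inverse x) * exp (- inverse x)) \<longlongrightarrow> 0) (at_right 0)"
    by (rule filterlim_compose[OF _ filterlim_inverse_at_top_right])
  then have "(flat_exp q \<longlongrightarrow> 0) (at_right 0)"
    by (rule Lim_transform_eventually)
       (auto simp: eventually_at_right_field flat_exp_def field_simps intro!: exI[of _ 1])
  moreover have "(flat_exp q \<longlongrightarrow> 0) (at_left 0)"
    by (rule Lim_transform_eventually[OF tendsto_const])
       (auto simp: eventually_at_left_field flat_exp_def intro!: exI[of _ "-1"])
  ultimately show ?thesis by (simp add: filterlim_split_at)
qed

lemma flat_exp_deriv:
  "(flat_exp q has_field_derivative flat_exp ([:0, 0, 1:] * (q - pderiv q)) x) (at x)"
proof -
  consider "x > 0" | "x < 0" | "x = 0" by linarith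
  then show ?thesis
  proof cases
    case 1
    have inv: "((\<lambda>x. 1/x) has_field_derivative (- 1 / x\<^sup>2)) (at x)"
      using 1 by (auto intro!: derivative_eq_intros simp: power2_eq_square)
    have "((\<lambda>x. poly q (1/x)) has_field_derivative poly (pderiv q) (1/x) * (- 1 / x\<^sup>2)) (at x)"
      by (rule DERIV_chain2[OF poly_DERIV inv])
    moreover have "((\<lambda>x. exp (- (1/x))) has_field_derivative exp (- (1/x)) * (- (- 1 / x\<^sup>2))) (at x)"
      by (rule DERIV_chain2[OF DERIV_exp DERIV_minus[OF inv]])
    ultimately have "((\<lambda>x. poly q (1/x) * exp (- (1/x))) has_field_derivative
        poly (pderiv q) (1/x) * (- 1 / x\<^sup>2) * exp (- (1/x)) + exp (- (1/x)) * (- (- 1 / x\<^sup>2)) * poly q (1/x)) (at x)"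
      by (rule DERIV_mult)
    also have "poly (pderiv q) (1/x) * (- 1 / x\<^sup>2) * exp (- (1/x)) + exp (- (1/x)) * (- (- 1 / x\<^sup>2)) * poly q (1/x)
        = flat_exp ([:0, 0, 1:] * (q - pderiv q)) x"
      using 1 by (simp add: flat_exp_def field_simps power2_eq_square)
    finally have "((\<lambda>x. poly q (1/x) * exp (- 1/x)) has_field_derivative flat_exp ([:0, 0, 1:] * (q - pderiv q)) x) (at x)"
      by simp
    then show ?thesis
      by (rule has_field_derivative_transform_within_open[of _ _ _ "{0<..}"]) (use 1 in \<open>auto simp: flat_exp_def\<close>)
  next
    case 2
    have "((\<lambda>_. 0) has_field_derivative flat_exp ([:0, 0, 1:] * (q - pderiv q)) x) (at x)"
      using 2 by (simp add: flat_exp_def)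
    then show ?thesis
      by (rule has_field_derivative_transform_within_open[of _ _ _ "{..<0}"]) (use 2 in \<open>auto simp: flat_exp_def\<close>)
  next
    case 3
    have "((\<lambda>h. (flat_exp q (0 + h) - flat_exp q 0) / h) \<longlongrightarrow> 0) (at 0)"
      using flat_exp_tendsto_0[of "[:0, 1:] * q"]
      by (rule Lim_transform_eventually) (auto simp: eventually_at_filter flat_exp_def)
    then show ?thesis using 3 by (simp add: DERIV_def) (simp add: flat_exp_def)
  qed
qed

lemma smooth_flat_exp:
  assumes "smooth q" shows "smooth (\<lambda>z. flat_exp 1 (q z))"
  using smooth_compose[OF assms, where D = "\<lambda>n. flat_exp (((\<lambda>q. [:0, 0, 1:] * (q - pderiv q)) ^^ n) 1)" and n = 0]
    flat_exp_deriv by simp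

text \<open>The cutoff is built by composing the flat function with itself rather than by dividing:
  no quotient has to be differentiated.\<close>

lemma radial_bump:
  "\<exists>\<eta> \<eta>' \<eta>'' :: real \<Rightarrow> real.
     (\<forall>t. (\<eta> has_real_derivative \<eta>' t) (at t)) \<and> (\<forall>t. (\<eta>' has_real_derivative \<eta>'' t) (at t)) \<and>
     continuous_on UNIV \<eta>'' \<and> (\<forall>t. \<eta> t \<ge> 0) \<and> (\<forall>t\<le>1. \<eta> t = 1) \<and> (\<forall>t\<ge>2. \<eta> t = 0) \<and>
     (\<forall>c p. smooth (\<lambda>z. \<eta> (c * (dist p z)\<^sup>2)))"
proof -
  define E where "E n = flat_exp (((\<lambda>q. [:0, 0, 1:] * (q - pderiv q)) ^^ n) 1)" for n :: nat
  have E: "(E n has_field_derivative E (Suc n) x) (at x)" for n x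
    using flat_exp_deriv by (simp add: E_def)
  have E_cont: "continuous_on UNIV (E n)" for n
    using E by (intro continuous_at_imp_continuous_on) (auto intro: DERIV_isCont)
  (* The inner function vanishes for t at most 1, where the outer factor equals exp 1 * exp (-1),
     and e^2 exp (- 1 / (t - 1)) has reached 1 at t = 3/2, beyond which the outer function vanishes. *)
  define \<eta> where "\<eta> t = exp 1 * E 0 (1 - exp 2 * E 0 (t - 1))" for t
  define \<eta>' where "\<eta>' t = - exp 3 * (E 1 (1 - exp 2 * E 0 (t - 1)) * E 1 (t - 1))" for t
  define \<eta>'' where "\<eta>'' t = - exp 3 * (E 1 (1 - exp 2 * E 0 (t - 1)) * E 2 (t - 1)
      - exp 2 * (E 2 (1 - exp 2 * E 0 (t - 1)) * (E 1 (t - 1))\<^sup>2))" for t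
  have E_shift: "((\<lambda>t. E n (t - 1)) has_real_derivative E (Suc n) (t - 1)) (at t)" for n t
    using DERIV_shift[of "E n" "E (Suc n) (t - 1)" t "-1"] E by simp
  have E_comp: "((\<lambda>t. E n (1 - exp 2 * E 0 (t - 1))) has_real_derivative
      E (Suc n) (1 - exp 2 * E 0 (t - 1)) * (0 - exp 2 * E 1 (t - 1))) (at t)" for n t
    using DERIV_chain2[OF E DERIV_diff[OF DERIV_const DERIV_cmult[OF E_shift]]] by simp
  have exp3: "exp 3 = exp 1 * exp (2 :: real)" by (simp flip: exp_add)
  have "(\<eta> has_real_derivative \<eta>' t) (at t)" for t
    using DERIV_cmult[OF E_comp[of 0], of "exp 1" t] unfolding \<eta>_def[abs_def] \<eta>'_def
    by (simp add: exp3 algebra_simps)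
  moreover have "(\<eta>' has_real_derivative \<eta>'' t) (at t)" for t
  proof -
    have "((\<lambda>t. - exp 3 * (E 1 (1 - exp 2 * E 0 (t - 1)) * E 1 (t - 1))) has_real_derivative
       - exp 3 * (E (Suc 1) (1 - exp 2 * E 0 (t - 1)) * (0 - exp 2 * E 1 (t - 1)) * E 1 (t - 1)
         + E (Suc 1) (t - 1) * E 1 (1 - exp 2 * E 0 (t - 1)))) (at t)"
      by (rule DERIV_cmult[OF DERIV_mult[OF E_comp E_shift]])
    then show ?thesis unfolding \<eta>'_def[abs_def] \<eta>''_def
      by (simp add: algebra_simps power2_eq_square Suc_1 flip: numeral_2_eq_2)
  qed
  moreover have "continuous_on UNIV \<eta>''"
    unfolding \<eta>''_def[abs_def]
    by (intro continuous_on_mult continuous_on_const continuous_on_diff continuous_on_power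
        continuous_on_id continuous_on_compose2[OF E_cont]) auto
  moreover have "\<eta> t \<ge> 0" for t
    by (simp add: \<eta>_def E_def flat_exp_def)
  moreover have "\<eta> t = 1" if "t \<le> 1" for t
    using that by (simp add: \<eta>_def E_def flat_exp_def exp_minus)
  moreover have "\<eta> t = 0" if "t \<ge> 2" for t
  proof -
    have "1 / (t - 1) \<le> 2" using that by (simp add: field_simps)
    then have "exp (-2) \<le> exp (- 1 / (t - 1))" by simp
    then have "exp 2 * exp (-2) \<le> exp 2 * exp (- 1 / (t - 1))" by (rule mult_left_mono) simp
    then have "1 \<le> exp 2 * exp (- 1 / (t - 1))" by (simp flip: exp_add)
    then show ?thesis using that by (simp add: \<eta>_def E_def flat_exp_def)
  qed
  moreover have "smooth (\<lambda>z. \<eta> (c * (dist p z)\<^sup>2))" for c p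
  proof -
    have "smooth (\<lambda>z. exp 1 * flat_exp 1 (1 + (- exp 2) * flat_exp 1 (c * (dist p z)\<^sup>2 + - 1)))"
      by (intro smooth_mult smooth_add smooth_const smooth_flat_exp smooth_sq_dist)
    then show ?thesis by (simp add: \<eta>_def E_def)
  qed
  ultimately show ?thesis by blast
qed

lemma smooth_ln_sq_dist:
  assumes "\<epsilon> > 0"
  shows "smooth (\<lambda>z. ln ((dist p z)\<^sup>2 + \<epsilon>))"
proof -
  define D where "D n t = (case n of 0 \<Rightarrow> ln (t + \<epsilon>) | Suc m \<Rightarrow> (- 1) ^ m * fact m * inverse ((t + \<epsilon>) ^ Suc m))" for n t
  have "(D n has_field_derivative D (Suc n) t) (at t)" if "t \<ge> 0" for n t
  proof (cases n)
    case 0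
    have "((\<lambda>t. ln (t + \<epsilon>)) has_field_derivative inverse (t + \<epsilon>)) (at t)"
      using that assms by (auto intro!: derivative_eq_intros simp: divide_inverse)
    then show ?thesis unfolding D_def 0 by simp
  next
    case (Suc m)
    have "((\<lambda>t. (t + \<epsilon>) ^ Suc m) has_field_derivative of_nat (Suc m) * (t + \<epsilon>) ^ m) (at t)"
      by (auto intro!: derivative_eq_intros simp del: power_Suc)
    from DERIV_inverse'[OF this]
    have "((\<lambda>t. inverse ((t + \<epsilon>) ^ Suc m)) has_field_derivative
        - (inverse ((t + \<epsilon>) ^ Suc m) * (of_nat (Suc m) * (t + \<epsilon>) ^ m) * inverse ((t + \<epsilon>) ^ Suc m))) (at t)"
      using that assms by auto
    moreover have "inverse ((t + \<epsilon>) ^ Suc m) * (of_nat (Suc m) * (t + \<epsilon>) ^ m) * inverse ((t + \<epsilon>) ^ Suc m)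
        = of_nat (Suc m) * inverse ((t + \<epsilon>) ^ Suc (Suc m))"
    proof -
      have "inverse (X * Y) * (c * Y) * inverse (X * Y) = c * inverse (X * (X * Y))" if "X > 0" "Y > 0" for X Y c :: real
        using that by (simp add: field_simps)
      from this[of "t + \<epsilon>" "(t + \<epsilon>) ^ m"] show ?thesis using that assms by simp
    qed
    ultimately have "((\<lambda>t. inverse ((t + \<epsilon>) ^ Suc m)) has_field_derivative
        - (of_nat (Suc m) * inverse ((t + \<epsilon>) ^ Suc (Suc m)))) (at t)"
      by (simp only:)
    from DERIV_cmult[OF this, of "(- 1) ^ m * fact m"]
    show ?thesis unfolding D_def Suc by (simp add: mult_ac)
  qed
  then show ?thesis
    using smooth_compose[OF smooth_sq_dist, where D = D and n = 0] by (simp add: D_def)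
qed

section \<open>Laplacians\<close>

text \<open>The formula \<open>\<Delta> \<psi>(|z|\<^sup>2) = 4 (t \<psi>'(t))'\<close> at \<open>t = |z|\<^sup>2\<close>: Laplacians of radial functions are exact
  derivatives in the squared radius.\<close>

lemma laplacian_radial:
  assumes \<psi>: "\<And>t. t \<ge> 0 \<Longrightarrow> (\<psi> has_real_derivative \<psi>' t) (at t)"
    and \<psi>': "\<And>t. t \<ge> 0 \<Longrightarrow> (\<psi>' has_real_derivative \<psi>'' t) (at t)"
  shows "laplacian (\<lambda>z. \<psi> ((dist p z)\<^sup>2)) z = 4 * \<psi>' ((dist p z)\<^sup>2) + 4 * (dist p z)\<^sup>2 * \<psi>'' ((dist p z)\<^sup>2)"
proof -
  define q where "q z = (Re z - Re p)\<^sup>2 + (Im z - Im p)\<^sup>2" for z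
  have q: "(dist p z)\<^sup>2 = q z" for z
    by (simp add: q_def dist_norm norm_minus_commute[of p] cmod_power2)
  have q0: "q z \<ge> 0" for z by (simp add: q_def)
  have qd: "(q has_derivative (\<lambda>w. 2 * (Re z - Re p) * Re w + 2 * (Im z - Im p) * Im w)) (at z)" for z
    unfolding q_def by (auto intro!: derivative_eq_intros bounded_linear_imp_has_derivative
        bounded_linear_Re bounded_linear_Im simp: fun_eq_iff algebra_simps)
  have chain: "((\<lambda>z. h (q z)) has_derivative (\<lambda>w. h' * (2 * (Re z - Re p) * Re w + 2 * (Im z - Im p) * Im w))) (at z)"
    if "(h has_real_derivative h') (at (q z))" for h h' z
    using has_derivative_compose[OF qd that[unfolded has_field_derivative_def]] .
  have x: "partial_x (\<lambda>z. \<psi> (q z)) = (\<lambda>z. \<psi>' (q z) * (2 * (Re z - Re p)))"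
    and y: "partial_y (\<lambda>z. \<psi> (q z)) = (\<lambda>z. \<psi>' (q z) * (2 * (Im z - Im p)))"
    using partial_eqI[OF chain[OF \<psi>[OF q0]]] by auto
  have lin: "((\<lambda>z. 2 * (Re z - Re p)) has_derivative (\<lambda>w. 2 * Re w)) (at z)"
    "((\<lambda>z. 2 * (Im z - Im p)) has_derivative (\<lambda>w. 2 * Im w)) (at z)" for z
    by (auto intro!: derivative_eq_intros bounded_linear_imp_has_derivative bounded_linear_Re bounded_linear_Im)
  have "laplacian (\<lambda>z. \<psi> (q z)) z = 4 * \<psi>' (q z) + 4 * q z * \<psi>'' (q z)"
    unfolding laplacian_def x y
    by (subst partial_eqI(1)[OF has_derivative_mult[OF chain[OF \<psi>'[OF q0]] lin(1)]],
        subst partial_eqI(2)[OF has_derivative_mult[OF chain[OF \<psi>'[OF q0]] lin(2)]])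
       (simp add: q_def power2_eq_square algebra_simps)
  then show ?thesis by (simp add: q)
qed

lemma partial_cong_open:
  assumes "open U" "z \<in> U" "\<And>x. x \<in> U \<Longrightarrow> \<phi> x = \<psi> x"
  shows "partial_x \<phi> z = partial_x \<psi> z" "partial_y \<phi> z = partial_y \<psi> z"
proof -
  have "(\<phi> has_derivative D) (at z) \<longleftrightarrow> (\<psi> has_derivative D) (at z)" for D
    using assms by (metis has_derivative_transform_within_open)
  then show "partial_x \<phi> z = partial_x \<psi> z" "partial_y \<phi> z = partial_y \<psi> z"
    by (simp_all add: partial_x_def partial_y_def frechet_derivative_def)
qed

lemma laplacian_cong_open:
  assumes "open U" "z \<in> U" "\<And>x. x \<in> U \<Longrightarrow> \<phi> x = \<psi> x"
  shows "laplacian \<phi> z = laplacian \<psi> z"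
  unfolding laplacian_def
  using partial_cong_open(1)[OF assms(1,2), of "partial_x \<phi>" "partial_x \<psi>"]
    partial_cong_open(2)[OF assms(1,2), of "partial_y \<phi>" "partial_y \<psi>"]
    partial_cong_open[OF assms(1) _ assms(3)] by simp

lemma partial_shift:
  assumes "smooth \<phi>"
  shows "partial_x (\<lambda>x. \<phi> (x + w)) = (\<lambda>x. partial_x \<phi> (x + w))" "partial_y (\<lambda>x. \<phi> (x + w)) = (\<lambda>x. partial_y \<phi> (x + w))"
    "((\<lambda>x. \<phi> (x + w)) has_derivative frechet_derivative \<phi> (at (z + w))) (at z)"
proof -
  show *: "((\<lambda>x. \<phi> (x + w)) has_derivative frechet_derivative \<phi> (at (z + w))) (at z)" for z
    by (rule has_derivative_compose[OF _ smooth_partial(3)[OF assms], of "\<lambda>x. x + w" "\<lambda>x. x", simplified])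
       (auto intro!: derivative_eq_intros)
  show "partial_x (\<lambda>x. \<phi> (x + w)) = (\<lambda>x. partial_x \<phi> (x + w))" "partial_y (\<lambda>x. \<phi> (x + w)) = (\<lambda>x. partial_y \<phi> (x + w))"
    using partial_eqI[OF *] by (auto simp: partial_x_def[of \<phi>] partial_y_def[of \<phi>])
qed

lemma smooth_shift:
  assumes "smooth \<phi>" shows "smooth (\<lambda>x. \<phi> (x + w))"
proof (rule smooth_coinduct[where X = "{(\<lambda>x. \<phi> (x + w)) | \<phi>. smooth \<phi>}"])
  fix \<psi> :: "complex \<Rightarrow> real" assume "\<psi> \<in> {(\<lambda>x. \<phi> (x + w)) | \<phi>. smooth \<phi>}"
  then obtain \<phi> where \<phi>: "\<psi> = (\<lambda>x. \<phi> (x + w))" "smooth \<phi>" by auto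
  show "\<exists>D. (\<forall>z. (\<psi> has_derivative D z) (at z)) \<and> (\<lambda>z. D z 1) \<in> {(\<lambda>x. \<phi> (x + w)) | \<phi>. smooth \<phi>} \<and>
      (\<lambda>z. D z \<i>) \<in> {(\<lambda>x. \<phi> (x + w)) | \<phi>. smooth \<phi>}"
    using partial_shift(3)[OF \<phi>(2), of w] smooth_partial(1,2)[OF \<phi>(2)] unfolding \<phi>(1)
    by (intro exI[of _ "\<lambda>z. frechet_derivative \<phi> (at (z + w))"])
       (auto simp: partial_x_def[abs_def] partial_y_def[abs_def] intro: exI[of _ "\<lambda>x. frechet_derivative \<phi> (at x) _"])
qed (use assms in auto)

lemma laplacian_shift:
  assumes "smooth \<phi>" shows "laplacian (\<lambda>x. \<phi> (x + w)) z = laplacian \<phi> (z + w)"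
  using partial_shift[OF assms] partial_shift[OF smooth_partial(1)[OF assms]]
    partial_shift[OF smooth_partial(2)[OF assms]] by (simp add: laplacian_def)

lemma continuous_laplacian:
  assumes "smooth \<phi>" shows "continuous_on UNIV (laplacian \<phi>)"
  unfolding laplacian_def[abs_def]
  by (intro continuous_intros smooth_partial(4) smooth_partial(1,2)[OF smooth_partial(1)[OF assms]]
      smooth_partial(1,2)[OF smooth_partial(2)[OF assms]])

section \<open>Periodic test functions concentrated at a point\<close>

text \<open>The translate that brings \<open>z\<close> into \<open>B\<close> is unique in the intended use, where \<open>B\<close> is a disc whose
  diameter is at most the length of the shortest
  nonzero lattice vector; the choice is then irrelevant.\<close>

definition periodize :: "complex \<Rightarrow> complex set \<Rightarrow> (complex \<Rightarrow> real) \<Rightarrow> complex \<Rightarrow> real" where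
  "periodize \<tau> B \<phi> z =
     (if \<exists>w\<in>lattice \<tau>. z + w \<in> B then \<phi> (z + (SOME w. w \<in> lattice \<tau> \<and> z + w \<in> B)) else 0)"

lemma periodize_outside:
  assumes "\<And>w. w \<in> lattice \<tau> \<Longrightarrow> z + w \<notin> B"
  shows "periodize \<tau> B \<phi> z = 0"
  using assms by (auto simp: periodize_def)

context
  fixes \<tau> p :: complex and R :: real
  assumes \<tau>: "Im \<tau> > 0" and sep: "\<And>w. w \<in> lattice \<tau> \<Longrightarrow> w \<noteq> 0 \<Longrightarrow> 2 * R \<le> norm w"
begin

lemma ball_translate_unique:
  assumes "w \<in> lattice \<tau>" "w' \<in> lattice \<tau>" "z + w \<in> ball p R" "z + w' \<in> ball p R"
  shows "w' = w"
proof (rule ccontr)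
  assume "w' \<noteq> w"
  have "dist (z + w') (z + w) < 2 * R"
    using assms(3,4) by (metis mem_ball dist_commute dist_triangle_less_add mult_2)
  then have "norm (w' - w) < 2 * R" by (simp add: dist_norm)
  then show False
    using sep[of "w' - w"] \<open>w' \<noteq> w\<close> lattice_closed(3)[OF \<tau> assms(2,1)] by auto
qed

lemma periodize_eq_in_ball:
  assumes "w \<in> lattice \<tau>" "z + w \<in> ball p R"
  shows "periodize \<tau> (ball p R) \<phi> z = \<phi> (z + w)"
proof -
  have "(SOME w. w \<in> lattice \<tau> \<and> z + w \<in> ball p R) = w"
    using ball_translate_unique assms by (intro some_equality) auto
  then show ?thesis using assms by (auto simp: periodize_def)
qed

lemma periodize_inside:
  assumes "w \<in> lattice \<tau>" "z \<in> ball p R"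
  shows "periodize \<tau> (ball p R) \<phi> (z + w) = \<phi> z"
  using periodize_eq_in_ball[OF lattice_closed(4)[OF \<tau> assms(1)], of "z + w"] assms(2) by simp

lemma periodic_periodize: "periodic \<tau> (periodize \<tau> (ball p R) \<phi>)"
  unfolding periodic_def
proof (intro allI ballI)
  fix z w assume w: "w \<in> lattice \<tau>"
  show "periodize \<tau> (ball p R) \<phi> (z + w) = periodize \<tau> (ball p R) \<phi> z"
  proof (cases "\<exists>v\<in>lattice \<tau>. z + v \<in> ball p R")
    case True
    then obtain v where v: "v \<in> lattice \<tau>" "z + v \<in> ball p R" by auto
    then show ?thesis
      using periodize_eq_in_ball[of v z] periodize_eq_in_ball[of "v - w" "z + w"] lattice_closed(3)[OF \<tau> v(1) w] by simp
  next
    case False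
    have "z + w + v \<notin> ball p R" if "v \<in> lattice \<tau>" for v
      using False lattice_closed(2)[OF \<tau> w that] by (auto simp: add.assoc)
    then show ?thesis using False by (auto simp: periodize_outside)
  qed
qed

context
  fixes \<phi> :: "complex \<Rightarrow> real" and R' :: real
  assumes smooth: "smooth \<phi>" and "R' < R" and supp: "\<And>z. dist p z \<ge> R' \<Longrightarrow> \<phi> z = 0"
begin

text \<open>Near a point of the disc's translates the periodization is a translate of \<open>\<phi>\<close>. The translates
  of the slightly smaller closed disc form a closed set, off which it vanishes.\<close>

lemma periodize_locally:
  "(\<exists>w\<in>lattice \<tau>. z + w \<in> ball p R \<and> (\<exists>U. open U \<and> z \<in> U \<and> (\<forall>x\<in>U. periodize \<tau> (ball p R) \<phi> x = \<phi> (x + w)))) \<or>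
   ((\<forall>w\<in>lattice \<tau>. z + w \<notin> ball p R) \<and> (\<exists>U. open U \<and> z \<in> U \<and> (\<forall>x\<in>U. periodize \<tau> (ball p R) \<phi> x = 0)))"
proof (cases "\<exists>w\<in>lattice \<tau>. z + w \<in> ball p R")
  case True
  then obtain w where w: "w \<in> lattice \<tau>" "z + w \<in> ball p R" by auto
  have "open ((\<lambda>x. x + w) -` ball p R)"
    by (intro open_vimage continuous_intros) auto
  then show ?thesis using w periodize_eq_in_ball by (intro disjI1 bexI[of _ w] conjI exI[of _ "(\<lambda>x. x + w) -` ball p R"]) auto
next
  case False
  define S where "S = (\<Union>x\<in>cball p R'. \<Union>y\<in>lattice \<tau>. {x - y})"
  have "closed S" unfolding S_def
    by (intro compact_closed_differences compact_cball closed_lattice[OF \<tau>])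
  have "z \<notin> S"
  proof
    assume "z \<in> S"
    then obtain x y where "x \<in> cball p R'" "y \<in> lattice \<tau>" "z = x - y" by (auto simp: S_def)
    then show False using False \<open>R' < R\<close> by (auto dest!: bspec[of _ _ y])
  qed
  have "periodize \<tau> (ball p R) \<phi> x = 0" if "x \<notin> S" for x
  proof (cases "\<exists>w\<in>lattice \<tau>. x + w \<in> ball p R")
    case True
    then obtain w where w: "w \<in> lattice \<tau>" "x + w \<in> ball p R" by auto
    have "x + w \<notin> cball p R'"
    proof
      assume "x + w \<in> cball p R'"
      then have "x \<in> S" unfolding S_def using w(1) by (intro UN_I[of "x + w"] UN_I[of w]) auto
      then show False using that by simp
    qed
    then show ?thesis using periodize_eq_in_ball[OF w] supp[of "x + w"] by simp
  next
    case False
    then show ?thesis by (auto simp: periodize_outside)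
  qed
  then show ?thesis using False \<open>closed S\<close> \<open>z \<notin> S\<close>
    by (intro disjI2 conjI exI[of _ "- S"]) auto
qed

lemma test_function_periodize: "test_function \<tau> (periodize \<tau> (ball p R) \<phi>)"
proof -
  have "smooth (periodize \<tau> (ball p R) \<phi>)"
  proof (rule smooth_if_locally_smooth)
    fix z
    consider w U where "open U" "z \<in> U" "\<forall>x\<in>U. periodize \<tau> (ball p R) \<phi> x = \<phi> (x + w)"
      | U where "open U" "z \<in> U" "\<forall>x\<in>U. periodize \<tau> (ball p R) \<phi> x = 0"
      using periodize_locally[of z] by auto
    then show "\<exists>U \<psi>. open U \<and> z \<in> U \<and> smooth \<psi> \<and> (\<forall>x\<in>U. periodize \<tau> (ball p R) \<phi> x = \<psi> x)"
    proof cases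
      case (1 w U)
      then show ?thesis using smooth_shift[OF smooth]
        by (intro exI[of _ U] exI[of _ "\<lambda>x. \<phi> (x + w)"]) auto
    next
      case (2 U)
      then show ?thesis using smooth_const by (intro exI[of _ U] exI[of _ "\<lambda>x. 0"]) auto
    qed
  qed
  then show ?thesis
    using periodic_periodize by (simp add: test_function_def smooth_def)
qed

lemma laplacian_periodize_inside:
  assumes "w \<in> lattice \<tau>" "z + w \<in> ball p R"
  shows "laplacian (periodize \<tau> (ball p R) \<phi>) z = laplacian \<phi> (z + w)"
proof -
  obtain w' U where w': "w' \<in> lattice \<tau>" "z + w' \<in> ball p R"
    and U: "open U" "z \<in> U" "\<forall>x\<in>U. periodize \<tau> (ball p R) \<phi> x = \<phi> (x + w')"
    using periodize_locally[of z] assms by blast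
  have "w' = w" using ball_translate_unique assms w' by blast
  then show ?thesis
    using laplacian_cong_open[OF U(1,2), of "periodize \<tau> (ball p R) \<phi>" "\<lambda>x. \<phi> (x + w)"] U(3)
      laplacian_shift[OF smooth] by simp
qed

lemma laplacian_0: "laplacian (\<lambda>_. 0) z = 0"
    using partial_eqI[OF has_derivative_const]
  by (simp add: laplacian_def partial_x_def[abs_def] partial_y_def[abs_def])

lemma laplacian_periodize_outside:
  assumes "\<And>w. w \<in> lattice \<tau> \<Longrightarrow> z + w \<notin> ball p R"
  shows "laplacian (periodize \<tau> (ball p R) \<phi>) z = 0"
proof -
  obtain U where U: "open U" "z \<in> U" "\<forall>x\<in>U. periodize \<tau> (ball p R) \<phi> x = 0"
    using periodize_locally[of z] assms by blast
  then show ?thesis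
    using laplacian_cong_open[OF U(1,2), of "periodize \<tau> (ball p R) \<phi>" "\<lambda>x. 0"] laplacian_0 by simp
qed

lemma bounded_supported:
  assumes "continuous_on UNIV h" "\<And>z. dist p z > R' \<Longrightarrow> h z = (0::real)"
  shows "\<exists>M. \<forall>z. \<bar>h z\<bar> \<le> M"
proof -
  have "compact (h ` cball p R')"
    using assms(1) by (intro compact_continuous_image compact_cball) (auto intro: continuous_on_subset)
  then obtain M where M: "\<And>z. z \<in> cball p R' \<Longrightarrow> \<bar>h z\<bar> \<le> M"
    by (force dest!: compact_imp_bounded simp: bounded_iff)
  have "\<bar>h z\<bar> \<le> max M 0" for z
    using M[of z] assms(2)[of z] by (cases "dist p z > R'") (auto simp: le_max_iff_disj)
  then show ?thesis by blast
qed

lemma laplacian_supported: "dist p z > R' \<Longrightarrow> laplacian \<phi> z = 0"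
  using laplacian_cong_open[of "- cball p R'" z \<phi> "\<lambda>_. 0"] supp laplacian_0 by auto

lemma torus_integral_periodize:
  assumes "periodic \<tau> H" "torus_integrable \<tau> H"
  shows "torus_integrable \<tau> (\<lambda>z. H z * periodize \<tau> (ball p R) \<phi> z)"
    and "set_integrable lborel (ball p R) (\<lambda>z. H z * \<phi> z)"
    and "torus_integral \<tau> (\<lambda>z. H z * periodize \<tau> (ball p R) \<phi> z) = (LINT z:ball p R|lborel. H z * \<phi> z)"
proof -
  obtain M where M: "\<And>z. \<bar>\<phi> z\<bar> \<le> M"
    using bounded_supported[of \<phi>] smooth_partial(4)[OF smooth] supp by force
  note loc = torus_integral_localize[OF \<tau> assms sep _ M]
  show "torus_integrable \<tau> (\<lambda>z. H z * periodize \<tau> (ball p R) \<phi> z)"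
    and "set_integrable lborel (ball p R) (\<lambda>z. H z * \<phi> z)"
    and "torus_integral \<tau> (\<lambda>z. H z * periodize \<tau> (ball p R) \<phi> z) = (LINT z:ball p R|lborel. H z * \<phi> z)"
    using loc[where K = "periodize \<tau> (ball p R) \<phi>" and p = p] periodize_inside periodize_outside
      borel_measurable_continuous_onI[OF smooth_partial(4)[OF smooth]]
    by auto
qed

text \<open>Testing a distributional identity on the torus with a periodized bump becomes an integral over
  one disc against the Laplacian of the bump itself.\<close>

lemma torus_integral_laplacian_periodize:
  assumes "periodic \<tau> H" "torus_integrable \<tau> H"
  shows "torus_integrable \<tau> (\<lambda>z. H z * laplacian (periodize \<tau> (ball p R) \<phi>) z)"
    and "set_integrable lborel (ball p R) (\<lambda>z. H z * laplacian \<phi> z)"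
    and "torus_integral \<tau> (\<lambda>z. H z * laplacian (periodize \<tau> (ball p R) \<phi>) z)
       = (LINT z:ball p R|lborel. H z * laplacian \<phi> z)"
proof -
  obtain M where M: "\<And>z. \<bar>laplacian \<phi> z\<bar> \<le> M"
    using bounded_supported[OF continuous_laplacian[OF smooth] laplacian_supported] by auto
  have inside: "laplacian (periodize \<tau> (ball p R) \<phi>) (z + w) = laplacian \<phi> z"
    if "w \<in> lattice \<tau>" "z \<in> ball p R" for w z
    using laplacian_periodize_inside[OF lattice_closed(4)[OF \<tau> that(1)], of "z + w"] that(2) by simp
  note loc = torus_integral_localize[OF \<tau> assms sep _ M,
      where K = "laplacian (periodize \<tau> (ball p R) \<phi>)" and p = p]
  show "torus_integrable \<tau> (\<lambda>z. H z * laplacian (periodize \<tau> (ball p R) \<phi>) z)"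
    and "set_integrable lborel (ball p R) (\<lambda>z. H z * laplacian \<phi> z)"
    and "torus_integral \<tau> (\<lambda>z. H z * laplacian (periodize \<tau> (ball p R) \<phi>) z)
       = (LINT z:ball p R|lborel. H z * laplacian \<phi> z)"
    using loc inside laplacian_periodize_outside
      borel_measurable_continuous_onI[OF continuous_laplacian[OF smooth]]
    by auto
qed

end

lemma integral_ball_le_torus_integral:
  assumes "periodic \<tau> H" "torus_integrable \<tau> H" "\<And>z. H z \<ge> 0"
  shows "set_integrable lborel (ball p R) H" "(LINT z:ball p R|lborel. H z) \<le> torus_integral \<tau> H"
proof -
  define K :: "complex \<Rightarrow> real" where "K z = (if \<exists>w\<in>lattice \<tau>. z + w \<in> ball p R then 1 else 0)" for z
  have K1: "K (z + w) = 1" if "w \<in> lattice \<tau>" "z \<in> ball p R" for z w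
    using that lattice_closed(4)[OF \<tau>, of w] by (auto simp: K_def intro!: bexI[of _ "- w"])
  note loc = torus_integral_localize[OF \<tau> assms(1,2) sep, where k = "\<lambda>_. 1" and K = K and p = p and M = 1]
  have K0: "K z = 0" if "\<And>w. w \<in> lattice \<tau> \<Longrightarrow> z + w \<notin> ball p R" for z
    using that by (auto simp: K_def)
  show "set_integrable lborel (ball p R) H"
    using loc(2) K1 K0 by simp
  have "(LINT z:ball p R|lborel. H z) = torus_integral \<tau> (\<lambda>z. H z * K z)"
    using loc(3) K1 K0 by simp
  also have "\<dots> \<le> torus_integral \<tau> H"
    unfolding torus_integral_def
    using loc(1) K1 K0 assms(2,3) unfolding torus_integrable_def
    by (intro set_integral_mono) (auto simp: K_def)
  finally show "(LINT z:ball p R|lborel. H z) \<le> torus_integral \<tau> H" .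
qed

end

section \<open>The logarithmic singularity of the Green function\<close>

lemma bounded_on_interval_zero_outside:
  assumes "continuous_on UNIV h" "\<And>t. t < 1 \<Longrightarrow> h t = 0" "\<And>t. t > 2 \<Longrightarrow> h t = (0 :: real)"
  shows "\<exists>B. \<forall>t::real. \<bar>h t\<bar> \<le> B"
proof -
  have "compact (h ` {1..2})"
    using assms(1) by (intro compact_continuous_image) (auto intro: continuous_on_subset)
  then obtain B where B: "\<And>t. t \<in> {1..2} \<Longrightarrow> \<bar>h t\<bar> \<le> B"
    by (force dest!: compact_imp_bounded simp: bounded_iff)
  have "\<bar>h t\<bar> \<le> max B 0" for t
  proof -
    consider "t < 1" | "t > 2" | "t \<in> {1..2}" by force
    then show ?thesis using assms(2,3) B[of t] by cases (auto simp: le_max_iff_disj)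
  qed
  then show ?thesis by blast
qed

lemma deriv_zero_on_open:
  assumes "(h has_real_derivative d) (at t)" "open S" "t \<in> S" "\<And>x. x \<in> S \<Longrightarrow> h x = c"
  shows "d = 0"
proof -
  have "(h has_real_derivative 0) (at t)"
    by (rule has_field_derivative_transform_within_open[of "\<lambda>_. c" 0 t S h])
       (use assms(2-3) in \<open>auto intro: assms(4)[symmetric]\<close>)
  then show ?thesis using DERIV_unique assms(1) by blast
qed

text \<open>The derivatives of the cutoff vanish outside the annulus between the squared radii 1 and 2
  and are therefore bounded.\<close>

lemma radial_bump_bounded:
  obtains \<eta> \<eta>' \<eta>'' :: "real \<Rightarrow> real" and B :: real where
    "\<And>t. (\<eta> has_real_derivative \<eta>' t) (at t)" "\<And>t. (\<eta>' has_real_derivative \<eta>'' t) (at t)"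
    "continuous_on UNIV \<eta>''" "\<And>t. \<eta> t \<ge> 0" "\<And>t. t \<le> 1 \<Longrightarrow> \<eta> t = 1" "\<And>t. t \<ge> 2 \<Longrightarrow> \<eta> t = 0"
    "\<And>c p. smooth (\<lambda>z. \<eta> (c * (dist p z)\<^sup>2))"
    "\<And>t. t < 1 \<or> t > 2 \<Longrightarrow> \<eta>' t = 0" "\<And>t. t < 1 \<or> t > 2 \<Longrightarrow> \<eta>'' t = 0"
    "\<And>t. t \<ge> 0 \<Longrightarrow> \<bar>\<eta> t\<bar> \<le> B" "\<And>t. \<bar>\<eta>' t\<bar> \<le> B" "\<And>t. \<bar>\<eta>'' t\<bar> \<le> B" "B \<ge> 1"
proof -
  obtain \<eta> \<eta>' \<eta>'' :: "real \<Rightarrow> real" where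
    \<eta>: "\<And>t. (\<eta> has_real_derivative \<eta>' t) (at t)" "\<And>t. (\<eta>' has_real_derivative \<eta>'' t) (at t)"
    "continuous_on UNIV \<eta>''" "\<And>t. \<eta> t \<ge> 0" "\<And>t. t \<le> 1 \<Longrightarrow> \<eta> t = 1" "\<And>t. t \<ge> 2 \<Longrightarrow> \<eta> t = 0"
    "\<And>c p. smooth (\<lambda>z. \<eta> (c * (dist p z)\<^sup>2))"
    using radial_bump by metis
  have cont: "continuous_on UNIV \<eta>" "continuous_on UNIV \<eta>'"
    using \<eta>(1,2) by (auto intro!: continuous_at_imp_continuous_on DERIV_isCont)
  have z1: "\<eta>' t = 0" if "t < 1 \<or> t > 2" for t
    using that deriv_zero_on_open[OF \<eta>(1), of "{..<1}" t 1] deriv_zero_on_open[OF \<eta>(1), of "{2<..}" t 0] \<eta>(5,6)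
    by auto
  have z2: "\<eta>'' t = 0" if "t < 1 \<or> t > 2" for t
    using that deriv_zero_on_open[OF \<eta>(2), of "{..<1}" t 0] deriv_zero_on_open[OF \<eta>(2), of "{2<..}" t 0] z1
    by auto
  obtain B1 B2 where B12: "\<And>t. \<bar>\<eta>' t\<bar> \<le> B1" "\<And>t. \<bar>\<eta>'' t\<bar> \<le> B2"
    using bounded_on_interval_zero_outside[OF cont(2)] bounded_on_interval_zero_outside[OF \<eta>(3)] z1 z2 by metis
  have "compact (\<eta> ` {0..2})"
    using cont(1) by (intro compact_continuous_image) (auto intro: continuous_on_subset)
  then obtain B0 where B0: "\<And>t. t \<in> {0..2} \<Longrightarrow> \<bar>\<eta> t\<bar> \<le> B0"
    by (force dest!: compact_imp_bounded simp: bounded_iff)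
  define B where "B = max 1 (max B0 (max B1 B2))"
  have "\<bar>\<eta> t\<bar> \<le> B" if "t \<ge> 0" for t
    using that B0[of t] \<eta>(6)[of t] by (cases "t \<le> 2") (auto simp: B_def le_max_iff_disj)
  moreover have "\<bar>\<eta>' t\<bar> \<le> B" "\<bar>\<eta>'' t\<bar> \<le> B" for t
    using B12[of t] by (auto simp: B_def le_max_iff_disj)
  moreover have "B \<ge> 1" by (simp add: B_def)
  ultimately show ?thesis using that[of \<eta> \<eta>' \<eta>'' B] \<eta> z1 z2 by blast
qed

lemma torus_integrable_const: "Im \<tau> > 0 \<Longrightarrow> torus_integrable \<tau> (\<lambda>_. c)"
proof -
  assume \<tau>: "Im \<tau> > 0"
  have "emeasure lborel (fund_domain \<tau>) < \<infinity>"
    by (rule emeasure_bounded_finite) (use norm_fund_domain_le in \<open>auto simp: bounded_iff\<close>)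
  then show ?thesis
    unfolding torus_integrable_def set_integrable_def
    using fund_domain_measurable[OF \<tau>] by simp
qed

lemma set_integrable_ball_bounded:
  fixes h :: "complex \<Rightarrow> real"
  assumes "h \<in> borel_measurable borel" "\<And>z. z \<in> ball p r \<Longrightarrow> \<bar>h z\<bar> \<le> M"
  shows "set_integrable lborel (ball p r) h"
  unfolding set_integrable_def
proof (rule Bochner_Integration.integrable_bound)
  show "integrable lborel (\<lambda>z. indicator (ball p r) z * M :: real)"
    using emeasure_lborel_ball_finite[of p r] by (simp add: less_top)
  show "(\<lambda>z. indicator (ball p r) z *\<^sub>R h z) \<in> borel_measurable lborel"
    unfolding real_scaleR_def by (intro borel_measurable_times borel_measurable_indicator) (use assms(1) in simp_all)
  show "AE z in lborel. norm (indicator (ball p r) z *\<^sub>R h z) \<le> norm (indicator (ball p r) z * M)"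
    using assms(2) by (auto simp: indicator_def intro: order.trans[OF _ abs_ge_self])
qed

lemma set_integral_ball_const:
  "r \<ge> 0 \<Longrightarrow> (LINT z:ball (p::complex) r|lborel. (b::real)) = pi * r\<^sup>2 * b"
  by (simp add: set_lebesgue_integral_def content_ball unit_ball_vol_2)

text \<open>The part of the Laplacian of \<open>\<eta>(c t) ln(t + e) / 2\<close> that involves derivatives of the cutoff. They
  vanish unless \<open>1 \<le> c t \<le> 2\<close>, where the logarithm is controlled uniformly in \<open>e\<close>.\<close>

lemma log_cutoff_bound:
  fixes \<eta>' \<eta>'' :: "real \<Rightarrow> real"
  assumes "c > 0" and \<eta>': "\<And>t. t < 1 \<or> t > 2 \<Longrightarrow> \<eta>' t = 0" "\<And>t. \<bar>\<eta>' t\<bar> \<le> B"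
    and \<eta>'': "\<And>t. t < 1 \<or> t > 2 \<Longrightarrow> \<eta>'' t = 0" "\<And>t. \<bar>\<eta>'' t\<bar> \<le> B"
    and e: "0 < e" "e \<le> 1" and t: "t \<ge> 0"
  shows "\<bar>2 * ln (t + e) * (c * \<eta>' (c * t) + c\<^sup>2 * t * \<eta>'' (c * t)) + 4 * c * t * \<eta>' (c * t) / (t + e)\<bar>
    \<le> 6 * c * B * (\<bar>ln (1 / c)\<bar> + \<bar>ln (2 / c + 1)\<bar>) + 4 * c * B"
proof (cases "c * t < 1 \<or> c * t > 2")
  case True
  have "B \<ge> 0" using \<eta>'(2)[of 0] by linarith
  then show ?thesis using True \<eta>'(1) \<eta>''(1) \<open>c > 0\<close> by simp
next
  case False
  have "B \<ge> 0" using \<eta>'(2)[of 0] by linarith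
  define K where "K = \<bar>ln (1 / c)\<bar> + \<bar>ln (2 / c + 1)\<bar>"
  have "1 / c \<le> t + e" "t + e \<le> 2 / c + 1"
  proof -
    have "0 \<le> c * e" "c * e \<le> c * 1" using e \<open>c > 0\<close> by (auto intro: mult_left_mono)
    then have "1 \<le> c * (t + e)" "c * (t + e) \<le> 2 + c"
      using False unfolding distrib_left by linarith+
    then show "1 / c \<le> t + e" "t + e \<le> 2 / c + 1"
      using \<open>c > 0\<close> by (simp_all add: field_simps)
  qed
  then have "ln (1 / c) \<le> ln (t + e)" "ln (t + e) \<le> ln (2 / c + 1)"
    using t e \<open>c > 0\<close> by (auto intro!: ln_mono)
  then have ln: "\<bar>ln (t + e)\<bar> \<le> K" unfolding K_def by linarith
  have "\<bar>c * \<eta>' (c * t) + c\<^sup>2 * t * \<eta>'' (c * t)\<bar> \<le> \<bar>c * \<eta>' (c * t)\<bar> + \<bar>c * (c * t) * \<eta>'' (c * t)\<bar>"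
    by (metis abs_triangle_ineq power2_eq_square mult.assoc)
  also have "\<dots> = c * \<bar>\<eta>' (c * t)\<bar> + c * (c * t) * \<bar>\<eta>'' (c * t)\<bar>"
    using \<open>c > 0\<close> t by (simp add: abs_mult)
  also have "\<dots> \<le> c * B + c * 2 * B"
    using False \<eta>' \<eta>'' \<open>c > 0\<close> \<open>B \<ge> 0\<close> t by (intro add_mono mult_mono) auto
  finally have "\<bar>c * \<eta>' (c * t) + c\<^sup>2 * t * \<eta>'' (c * t)\<bar> \<le> 3 * c * B" by (simp add: algebra_simps)
  then have "\<bar>ln (t + e)\<bar> * \<bar>c * \<eta>' (c * t) + c\<^sup>2 * t * \<eta>'' (c * t)\<bar> \<le> K * (3 * c * B)"
    using ln by (intro mult_mono) auto
  then have "2 * (\<bar>ln (t + e)\<bar> * \<bar>c * \<eta>' (c * t) + c\<^sup>2 * t * \<eta>'' (c * t)\<bar>) \<le> 2 * (K * (3 * c * B))"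
    by (rule mult_left_mono) simp
  also have "2 * (K * (3 * c * B)) = 6 * c * B * K" by simp
  finally have 1: "\<bar>2 * ln (t + e) * (c * \<eta>' (c * t) + c\<^sup>2 * t * \<eta>'' (c * t))\<bar> \<le> 6 * c * B * K"
    unfolding abs_mult by simp
  have "\<bar>t / (t + e)\<bar> * \<bar>\<eta>' (c * t)\<bar> \<le> 1 * B"
    using t e \<eta>'(2) by (intro mult_mono) auto
  then have "4 * c * (\<bar>t / (t + e)\<bar> * \<bar>\<eta>' (c * t)\<bar>) \<le> 4 * c * B"
    using \<open>c > 0\<close> by (intro mult_left_mono) auto
  then have 2: "\<bar>4 * c * t * \<eta>' (c * t) / (t + e)\<bar> \<le> 4 * c * B"
    using \<open>c > 0\<close> by (simp add: abs_mult)
  show ?thesis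
    unfolding K_def[symmetric] by (rule order.trans[OF abs_triangle_ineq add_mono[OF 1 2]])
qed

text \<open>The equation for \<open>G\<close> is tested with \<open>\<phi> = \<eta> ln(|z - p|\<^sup>2 + e) / 2\<close>, a smoothed and cut off
  fundamental solution centred at \<open>p\<close>. Its Laplacian is an approximate identity of mass \<open>2\<pi>\<close> plus
  a term that is bounded uniformly in \<open>p\<close> and \<open>e\<close>. The left-hand side of the equation therefore
  tends to \<open>- 2\<pi> G(p)\<close> up to a bounded error as \<open>e \<rightarrow> 0\<close>, while the point mass contributes
  \<open>\<phi>(0) \<rightarrow> ln |p|\<close>. As the aim is an upper bound, every step may be an inequality.\<close>

lemma green_function_upper_bound:
  assumes \<tau>: "Im \<tau> > 0" and G: "green_function \<tau> G"
  shows "\<exists>C \<rho>. \<rho> > 0 \<and> (\<forall>z. 0 < norm z \<and> norm z < \<rho> \<longrightarrow> 2 * pi * G z \<le> C - ln (norm z))"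
proof -
  have per: "periodic \<tau> G" and contG: "continuous_on (- lattice \<tau>) G" and int: "torus_integrable \<tau> G"
    and weak: "\<And>\<phi>. test_function \<tau> \<phi> \<Longrightarrow> - torus_integral \<tau> (\<lambda>z. G z * laplacian \<phi> z) =
          \<phi> 0 - 1 / torus_area \<tau> * torus_integral \<tau> \<phi>"
    using G by (auto simp: green_function_def)
  obtain \<delta>\<^sub>0 where "\<delta>\<^sub>0 > 0" and \<delta>\<^sub>0: "\<And>w. w \<in> lattice \<tau> \<Longrightarrow> w \<noteq> 0 \<Longrightarrow> \<delta>\<^sub>0 \<le> norm w"
    using lattice_separated[OF \<tau>] by auto
  define R where "R = \<delta>\<^sub>0 / 2"
  have "R > 0" and sep: "\<And>w. w \<in> lattice \<tau> \<Longrightarrow> w \<noteq> 0 \<Longrightarrow> 2 * R \<le> norm w"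
    using \<delta>\<^sub>0 \<open>\<delta>\<^sub>0 > 0\<close> by (auto simp: R_def)
  (* The cutoff is 1 up to distance R/2 from the centre and 0 from distance 3R/4 on. *)
  define c where "c = 4 / R\<^sup>2"
  have "c > 0" using \<open>R > 0\<close> by (simp add: c_def)
  obtain \<eta> \<eta>' \<eta>'' :: "real \<Rightarrow> real" and B :: real where
    \<eta>: "\<And>t. (\<eta> has_real_derivative \<eta>' t) (at t)" "\<And>t. (\<eta>' has_real_derivative \<eta>'' t) (at t)"
    "continuous_on UNIV \<eta>''" "\<And>t. \<eta> t \<ge> 0" "\<And>t. t \<le> 1 \<Longrightarrow> \<eta> t = 1" "\<And>t. t \<ge> 2 \<Longrightarrow> \<eta> t = 0"
    "\<And>c p. smooth (\<lambda>z. \<eta> (c * (dist p z)\<^sup>2))"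
    "\<And>t. t < 1 \<or> t > 2 \<Longrightarrow> \<eta>' t = 0" "\<And>t. t < 1 \<or> t > 2 \<Longrightarrow> \<eta>'' t = 0"
    and B: "\<And>t. t \<ge> 0 \<Longrightarrow> \<bar>\<eta> t\<bar> \<le> B" "\<And>t. \<bar>\<eta>' t\<bar> \<le> B" "\<And>t. \<bar>\<eta>'' t\<bar> \<le> B" "B \<ge> 1"
    by (rule radial_bump_bounded) (rule that; assumption)
  define N where "N = torus_integral \<tau> (\<lambda>z. \<bar>G z\<bar>)"
  have absG: "periodic \<tau> (\<lambda>z. \<bar>G z\<bar>)" "torus_integrable \<tau> (\<lambda>z. \<bar>G z\<bar>)"
    using per int by (auto simp: periodic_def torus_integrable_def intro: set_integrable_abs)
  define C1 where "C1 = 6 * c * B * (\<bar>ln (1 / c)\<bar> + \<bar>ln (2 / c + 1)\<bar>) + 4 * c * B"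
  define C2 where "C2 = 1 / torus_area \<tau> * (pi * R\<^sup>2 * (B * (ln (R\<^sup>2 + 1) / 2)))"
  have main: "2 * pi * G p \<le> 2 * pi + N * C1 + C2 - ln (norm p)" if p: "0 < norm p" "norm p < R / 2" for p
  proof -
    have "p \<notin> lattice \<tau>" using sep[of p] p \<open>R > 0\<close> by auto
    moreover have "open (- lattice \<tau>)" using closed_lattice[OF \<tau>] by auto
    ultimately have "isCont G p" using contG by (simp add: continuous_on_eq_continuous_at)
    then obtain d where "d > 0" and d: "\<And>z. dist z p < d \<Longrightarrow> dist (G z) (G p) < 1"
      unfolding continuous_at by (auto simp: Lim_at) (metis dist_self zero_less_one)
    define \<delta> where "\<delta> = min d (R / 2)"
    have \<delta>: "\<delta> > 0" "\<delta> \<le> R / 2" and G_near: "\<And>z. dist p z < \<delta> \<Longrightarrow> G p - 1 \<le> G z"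
      using \<open>d > 0\<close> \<open>R > 0\<close> d by (fastforce simp: \<delta>_def dist_real_def dist_commute)+
    have c\<delta>: "c * \<delta>\<^sup>2 \<le> 1"
    proof -
      have "\<delta>\<^sup>2 \<le> (R / 2)\<^sup>2" using \<delta> by (intro power_mono) auto
      then show ?thesis using \<open>R > 0\<close> by (simp add: c_def field_simps power2_eq_square)
    qed
    (* Up to distance \<delta> the value of G is at least G p - 1; farther out, the approximate identity
       is at most 2 e / \<delta>^4, which makes the rest of the integral negligible. *)
    have ineq: "(G p - 1) * (2 * pi * (1 - e / (\<delta>\<^sup>2 + e))) - N * (C1 + 2 * B * e / \<delta>^4) \<le> C2 - ln (norm p)"
      if e: "0 < e" "e \<le> 1" for e
    proof -
      define \<psi> where "\<psi> t = \<eta> (c * t) * (ln (t + e) / 2)" for t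
      define \<psi>' where "\<psi>' t = c * \<eta>' (c * t) * (ln (t + e) / 2) + \<eta> (c * t) / (2 * (t + e))" for t
      define \<psi>'' where "\<psi>'' t = c\<^sup>2 * \<eta>'' (c * t) * (ln (t + e) / 2) + c * \<eta>' (c * t) / (t + e)
         - \<eta> (c * t) / (2 * (t + e)\<^sup>2)" for t
      have chain: "((\<lambda>t. \<eta> (c * t)) has_real_derivative c * \<eta>' (c * t)) (at t)"
         "((\<lambda>t. \<eta>' (c * t)) has_real_derivative c * \<eta>'' (c * t)) (at t)" for t
        using DERIV_chain2[OF \<eta>(1) DERIV_cmult_Id, of c t] DERIV_chain2[OF \<eta>(2) DERIV_cmult_Id, of c t]
        by (simp_all add: mult.commute)
      have ln_deriv: "((\<lambda>t. ln (t + e) / 2) has_real_derivative 1 / (2 * (t + e))) (at t)" if "t \<ge> 0" for t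
      proof -
        have "((\<lambda>t. ln (t + e)) has_real_derivative inverse (t + e)) (at t)"
          using that e by (auto intro!: derivative_eq_intros simp: divide_inverse)
        from DERIV_cdivide[OF this, of 2] show ?thesis
          by (simp add: inverse_eq_divide mult.commute)
      qed
      have inv_deriv: "((\<lambda>t. 1 / (2 * (t + e))) has_real_derivative - 1 / (2 * (t + e)\<^sup>2)) (at t)" if "t \<ge> 0" for t
      proof -
        have "((\<lambda>t. inverse (t + e)) has_real_derivative - (inverse (t + e) * inverse (t + e))) (at t)"
          using that e by (auto intro!: derivative_eq_intros)
        from DERIV_cdivide[OF this, of 2]
        have "((\<lambda>t. inverse (t + e) / 2) has_real_derivative - (inverse (t + e) * inverse (t + e)) / 2) (at t)" .
        moreover have "(\<lambda>t. inverse (t + e) / 2) = (\<lambda>t. 1 / (2 * (t + e)))"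
          by (simp only: inverse_eq_divide divide_divide_eq_left mult.commute)
        moreover have "- (inverse (t + e) * inverse (t + e)) / 2 = - 1 / (2 * (t + e)\<^sup>2)"
          by (simp only: inverse_eq_divide divide_divide_eq_left mult.commute power2_eq_square
              times_divide_times_eq mult_1_left minus_divide_left)
        ultimately show ?thesis by metis
      qed
      have \<psi>1: "(\<psi> has_real_derivative \<psi>' t) (at t)" if "t \<ge> 0" for t
        unfolding \<psi>_def[abs_def] \<psi>'_def
        using DERIV_mult[OF chain(1) ln_deriv[OF that]] by (simp add: mult_ac)
      have \<psi>2: "(\<psi>' has_real_derivative \<psi>'' t) (at t)" if "t \<ge> 0" for t
      proof -
        have deriv: "((\<lambda>t. c * \<eta>' (c * t) * (ln (t + e) / 2) + \<eta> (c * t) * (1 / (2 * (t + e)))) has_real_derivative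
            c * (c * \<eta>'' (c * t)) * (ln (t + e) / 2) + 1 / (2 * (t + e)) * (c * \<eta>' (c * t)) +
            (c * \<eta>' (c * t) * (1 / (2 * (t + e))) + - 1 / (2 * (t + e)\<^sup>2) * \<eta> (c * t))) (at t)"
          by (intro DERIV_add DERIV_mult DERIV_cmult chain ln_deriv inv_deriv that)
        have \<psi>'_eq: "\<psi>' = (\<lambda>t. c * \<eta>' (c * t) * (ln (t + e) / 2) + \<eta> (c * t) * (1 / (2 * (t + e))))"
          by (simp add: \<psi>'_def[abs_def])
        have alg: "c * (c * h'') * (l / 2) + 1 / (2 * X) * (c * h') + (c * h' * (1 / (2 * X)) + - 1 / (2 * X\<^sup>2) * h)
          = c\<^sup>2 * h'' * (l / 2) + c * h' / X - h / (2 * X\<^sup>2)" if "X > 0" for h h' h'' l X :: real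
          using that by (simp add: field_simps power2_eq_square)
        have "t + e > 0" using that e by simp
        show ?thesis using deriv unfolding alg[OF \<open>t + e > 0\<close>] \<psi>'_eq[symmetric] \<psi>''_def .
      qed
      define \<phi> where "\<phi> z = \<psi> ((dist p z)\<^sup>2)" for z
      have smooth: "smooth \<phi>"
      proof -
        have "smooth (\<lambda>z. \<eta> (c * (dist p z)\<^sup>2) * (ln ((dist p z)\<^sup>2 + e) * (1 / 2)))"
          by (intro smooth_mult \<eta>(7) smooth_ln_sq_dist smooth_const e)
        then show ?thesis by (simp add: \<phi>_def[abs_def] \<psi>_def)
      qed
      have supp: "\<phi> z = 0" if "dist p z \<ge> 3 * R / 4" for z
      proof -
        have "(3 * R / 4)\<^sup>2 \<le> (dist p z)\<^sup>2" using that \<open>R > 0\<close> by (intro power_mono) auto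
        then have "9 / 16 * R\<^sup>2 \<le> (dist p z)\<^sup>2" by (simp add: power_divide power_mult_distrib)
        moreover have "R\<^sup>2 > 0" using \<open>R > 0\<close> by simp
        ultimately have "2 * R\<^sup>2 \<le> 4 * (dist p z)\<^sup>2" by linarith
        then have "2 \<le> c * (dist p z)\<^sup>2" using \<open>R\<^sup>2 > 0\<close> by (simp add: c_def pos_le_divide_eq)
        then show ?thesis by (simp add: \<phi>_def \<psi>_def \<eta>(6))
      qed
      have R': "3 * R / 4 < R" using \<open>R > 0\<close> by simp
      (* M is the Laplacian of ln(|z|^2 + e) / 2; Er collects the terms with derivatives of the cutoff. *)
      define Er where "Er t = 2 * ln (t + e) * (c * \<eta>' (c * t) + c\<^sup>2 * t * \<eta>'' (c * t)) + 4 * c * t * \<eta>' (c * t) / (t + e)" for t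
      define M where "M t = 2 * e / (t + e)\<^sup>2" for t
      have lap: "laplacian \<phi> z = \<eta> (c * (dist p z)\<^sup>2) * M ((dist p z)\<^sup>2) + Er ((dist p z)\<^sup>2)" for z
      proof -
        have alg: "4 * \<psi>' t + 4 * t * \<psi>'' t = \<eta> (c * t) * M t + Er t" if "t \<ge> 0" for t
        proof -
          have "t + e > 0" using that e by simp
          moreover have "4 * (h / (2 * X)) - 4 * t * (h / (2 * X\<^sup>2)) = h * (2 * (X - t) / X\<^sup>2)" if "X > 0" for h X :: real
            using that by (simp add: field_simps power2_eq_square)
          ultimately have "4 * (\<eta> (c * t) / (2 * (t + e))) - 4 * t * (\<eta> (c * t) / (2 * (t + e)\<^sup>2)) = \<eta> (c * t) * M t"
            unfolding M_def by (metis add_diff_cancel_left')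
          then show ?thesis
            unfolding \<psi>'_def \<psi>''_def Er_def by (simp add: algebra_simps)
        qed
        have "laplacian (\<lambda>z. \<psi> ((dist p z)\<^sup>2)) z =
            4 * \<psi>' ((dist p z)\<^sup>2) + 4 * (dist p z)\<^sup>2 * \<psi>'' ((dist p z)\<^sup>2)"
          by (rule laplacian_radial) (fact \<psi>1 \<psi>2)+
        then show ?thesis
          unfolding \<phi>_def[abs_def] using alg[of "(dist p z)\<^sup>2"] by simp
      qed
      have test: "test_function \<tau> (periodize \<tau> (ball p R) \<phi>)"
        using test_function_periodize[OF \<tau> sep smooth R' supp, where p = p] by simp
      have loc: "set_integrable lborel (ball p R) (\<lambda>z. G z * laplacian \<phi> z)"
        "torus_integral \<tau> (\<lambda>z. G z * laplacian (periodize \<tau> (ball p R) \<phi>) z)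
          = (LINT z:ball p R|lborel. G z * laplacian \<phi> z)"
        using torus_integral_laplacian_periodize[OF \<tau> sep smooth R' supp per int, where p = p] by simp_all
      have loc1: "set_integrable lborel (ball p R) \<phi>"
        "torus_integral \<tau> (periodize \<tau> (ball p R) \<phi>) = (LINT z:ball p R|lborel. \<phi> z)"
        using torus_integral_periodize[OF \<tau> sep smooth R' supp _ torus_integrable_const[OF \<tau>, of 1], where p = p]
        by (auto simp: periodic_def)
      have "p \<in> ball p R" "0 \<in> ball p R" using p \<open>R > 0\<close> by auto
      then have at0: "periodize \<tau> (ball p R) \<phi> 0 = \<phi> 0"
        using periodize_inside[OF \<tau> sep lattice_closed(1)[OF \<tau>], where z = 0 and p = p and \<phi> = \<phi>] by simp
      have "(norm p)\<^sup>2 \<le> (R / 2)\<^sup>2" using p by (intro power_mono) auto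
      then have "c * (norm p)\<^sup>2 \<le> 1" using \<open>R > 0\<close> by (simp add: c_def field_simps power2_eq_square)
      then have "\<phi> 0 = ln ((norm p)\<^sup>2 + e) / 2" by (simp add: \<phi>_def \<psi>_def \<eta>(5))
      moreover have "ln ((norm p)\<^sup>2) \<le> ln ((norm p)\<^sup>2 + e)" using p e by (intro ln_mono) auto
      moreover have "ln ((norm p)\<^sup>2) = 2 * ln (norm p)" using p by (simp add: ln_realpow)
      ultimately have \<phi>0: "ln (norm p) \<le> \<phi> 0" by simp
      have \<phi>_le: "\<phi> z \<le> B * (ln (R\<^sup>2 + 1) / 2)" if "z \<in> ball p R" for z
      proof -
        have "(dist p z)\<^sup>2 \<le> R\<^sup>2" using that by (intro power_mono) auto
        then have "ln ((dist p z)\<^sup>2 + e) \<le> ln (R\<^sup>2 + 1)" using e by (intro ln_mono) (auto intro: add_nonneg_pos)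
        then have "\<phi> z \<le> \<eta> (c * (dist p z)\<^sup>2) * (ln (R\<^sup>2 + 1) / 2)"
          unfolding \<phi>_def \<psi>_def by (intro mult_left_mono \<eta>(4)) auto
        also have "\<dots> \<le> B * (ln (R\<^sup>2 + 1) / 2)"
          using B(1)[of "c * (dist p z)\<^sup>2"] \<open>c > 0\<close> \<open>R > 0\<close> by (intro mult_right_mono) auto
        finally show ?thesis .
      qed
      have "torus_integral \<tau> (periodize \<tau> (ball p R) \<phi>) = (LINT z:ball p R|lborel. \<phi> z)"
        by (rule loc1(2))
      also have "\<dots> \<le> (LINT z:ball p R|lborel. B * (ln (R\<^sup>2 + 1) / 2))"
        by (intro set_integral_mono loc1(1) \<phi>_le
            set_integrable_ball_bounded[where h = "\<lambda>_. B * (ln (R\<^sup>2 + 1) / 2)", OF _ order.refl]) auto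
      also have "\<dots> = pi * R\<^sup>2 * (B * (ln (R\<^sup>2 + 1) / 2))"
        using \<open>R > 0\<close> by (intro set_integral_ball_const) simp
      finally have "1 / torus_area \<tau> * torus_integral \<tau> (periodize \<tau> (ball p R) \<phi>) \<le> C2"
        unfolding C2_def by (intro mult_left_mono) (auto simp: torus_area_def)
      with weak[OF test] at0 \<phi>0 loc(2)
      have upper: "(LINT z:ball p R|lborel. G z * laplacian \<phi> z) \<le> C2 - ln (norm p)" by simp
      have M_meas: "M \<in> borel_measurable borel" unfolding M_def by measurable
      have M_bound: "\<bar>M t\<bar> \<le> 2 / e" "M t \<ge> 0" if "t \<ge> 0" for t
      proof -
        have "e * e \<le> (t + e)\<^sup>2" using that e by (simp add: power2_eq_square mult_mono)
        then show "\<bar>M t\<bar> \<le> 2 / e" "M t \<ge> 0" using e that by (auto simp: M_def field_simps)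
      qed
      have M_int: "set_integrable lborel (ball p \<delta>) (\<lambda>z. M ((dist p z)\<^sup>2))"
        using M_bound M_meas by (intro set_integrable_ball_bounded[where M = "2 / e"]) auto
      have M_val: "(LINT z:ball p \<delta>|lborel. M ((dist p z)\<^sup>2)) = 2 * pi * (1 - e / (\<delta>\<^sup>2 + e))"
      proof -
        have "((\<lambda>t. - 2 * e / (t + e)) has_real_derivative M t) (at t)" if "t \<ge> 0" for t
          using that e unfolding M_def by (auto intro!: derivative_eq_intros simp: power2_eq_square)
        then have "(LINT z:ball p \<delta>|lborel. M ((dist p z)\<^sup>2)) = pi * (- 2 * e / (\<delta>\<^sup>2 + e) - (- 2 * e / (0 + e)))"
          using e \<delta> by (intro radial_integral_FTC[where \<Phi> = "\<lambda>t. - 2 * e / (t + e)"] M_meas M_int)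
            (auto intro!: continuous_intros)
        then show ?thesis using e by (simp add: field_simps)
      qed
      have ind: "indicator (ball p R) z * (indicator (ball p \<delta>) z * h) = indicator (ball p \<delta>) z * h" for z and h :: real
        using \<delta> \<open>R > 0\<close> by (auto simp: indicator_def)
      have I1: "set_integrable lborel (ball p R) (\<lambda>z. (G p - 1) * (indicator (ball p \<delta>) z * M ((dist p z)\<^sup>2)))"
        using M_int by (intro set_integrable_mult_right) (simp add: set_integrable_def ind)
      have absG_ball: "set_integrable lborel (ball p R) (\<lambda>z. \<bar>G z\<bar>)" "(LINT z:ball p R|lborel. \<bar>G z\<bar>) \<le> N"
        using integral_ball_le_torus_integral[OF \<tau> sep absG abs_ge_zero, where p = p] by (simp_all add: N_def)
      have I2: "set_integrable lborel (ball p R) (\<lambda>z. \<bar>G z\<bar> * (C1 + 2 * B * e / \<delta>^4))"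
        using absG_ball(1) by (intro set_integrable_mult_left)
      have "(G p - 1) * (2 * pi * (1 - e / (\<delta>\<^sup>2 + e))) - (LINT z:ball p R|lborel. \<bar>G z\<bar>) * (C1 + 2 * B * e / \<delta>^4)
         = (LINT z:ball p R|lborel. (G p - 1) * (indicator (ball p \<delta>) z * M ((dist p z)\<^sup>2)) - \<bar>G z\<bar> * (C1 + 2 * B * e / \<delta>^4))"
        unfolding set_integral_diff(2)[OF I1 I2] M_val[symmetric]
        by (simp add: set_lebesgue_integral_def ind)
      also have "\<dots> \<le> (LINT z:ball p R|lborel. G z * laplacian \<phi> z)"
      proof (intro set_integral_mono set_integral_diff(1)[OF I1 I2] loc(1))
        fix z assume "z \<in> ball p R"
        define t where "t = (dist p z)\<^sup>2"
        have "t \<ge> 0" by (simp add: t_def)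
        have "\<bar>Er t\<bar> \<le> C1"
          unfolding Er_def C1_def
          by (rule log_cutoff_bound[OF \<open>c > 0\<close> _ _ _ _ e \<open>t \<ge> 0\<close>]) (fact \<eta>(8) B(2) \<eta>(9) B(3))+
        then have "\<bar>G z * Er t\<bar> \<le> \<bar>G z\<bar> * C1"
          by (simp add: abs_mult mult_left_mono)
        then have GE: "- (\<bar>G z\<bar> * C1) \<le> G z * Er t" by linarith
        have e4: "0 \<le> 2 * B * e / \<delta>^4" using B(4) e \<delta> by simp
        show "(G p - 1) * (indicator (ball p \<delta>) z * M ((dist p z)\<^sup>2)) - \<bar>G z\<bar> * (C1 + 2 * B * e / \<delta>^4)
            \<le> G z * laplacian \<phi> z"
        proof (cases "z \<in> ball p \<delta>")
          case True
          have "c * t \<le> c * \<delta>\<^sup>2" unfolding t_def using True \<open>c > 0\<close> by (intro mult_left_mono power_mono) auto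
          then have "\<eta> (c * t) = 1" using c\<delta> by (intro \<eta>(5)) auto
          moreover have "(G p - 1) * M t \<le> G z * M t"
            using G_near True M_bound(2)[OF \<open>t \<ge> 0\<close>] by (intro mult_right_mono) auto
          moreover have "0 \<le> \<bar>G z\<bar> * (2 * B * e / \<delta>^4)" using e4 by (intro mult_nonneg_nonneg) auto
          ultimately show ?thesis using True GE unfolding lap t_def[symmetric] by (simp add: algebra_simps)
        next
          case False
          have "\<delta>\<^sup>2 \<le> t" unfolding t_def using False \<delta> by (intro power_mono) auto
          then have "(\<delta>\<^sup>2)\<^sup>2 \<le> (t + e)\<^sup>2" using e by (intro power_mono) auto
          then have "M t \<le> 2 * e / \<delta>^4"
            unfolding M_def using e \<delta> \<open>t \<ge> 0\<close>
            by (intro divide_left_mono) (auto intro!: mult_pos_pos simp flip: power_mult)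
          then have "\<bar>\<eta> (c * t)\<bar> * M t \<le> B * (2 * e / \<delta>^4)"
            using B(1,4) \<open>c > 0\<close> \<open>t \<ge> 0\<close> M_bound(2)[OF \<open>t \<ge> 0\<close>] by (intro mult_mono) auto
          then have "\<bar>G z\<bar> * (\<bar>\<eta> (c * t)\<bar> * M t) \<le> \<bar>G z\<bar> * (B * (2 * e / \<delta>^4))"
            by (intro mult_left_mono) auto
          then have "\<bar>G z * (\<eta> (c * t) * M t)\<bar> \<le> \<bar>G z\<bar> * (2 * B * e / \<delta>^4)"
            using M_bound(2)[OF \<open>t \<ge> 0\<close>] by (simp add: abs_mult mult_ac)
          then have "- (\<bar>G z\<bar> * (2 * B * e / \<delta>^4)) \<le> G z * (\<eta> (c * t) * M t)" by linarith
          then show ?thesis using False GE unfolding lap t_def[symmetric] by (simp add: algebra_simps)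
        qed
      qed
      also have "\<dots> \<le> C2 - ln (norm p)" by (rule upper)
      finally have "(G p - 1) * (2 * pi * (1 - e / (\<delta>\<^sup>2 + e)))
          - (LINT z:ball p R|lborel. \<bar>G z\<bar>) * (C1 + 2 * B * e / \<delta>^4) \<le> C2 - ln (norm p)" .
      moreover have "(LINT z:ball p R|lborel. \<bar>G z\<bar>) * (C1 + 2 * B * e / \<delta>^4) \<le> N * (C1 + 2 * B * e / \<delta>^4)"
      proof (rule mult_right_mono)
        have "C1 \<ge> 0" using \<open>c > 0\<close> B(4) by (simp add: C1_def)
        then show "0 \<le> C1 + 2 * B * e / \<delta>^4" using B(4) e \<delta> by simp
      qed (rule absG_ball(2))
      ultimately show ?thesis by linarith
    qed
    have "((\<lambda>e. (G p - 1) * (2 * pi * (1 - e / (\<delta>\<^sup>2 + e))) - N * (C1 + 2 * B * e / \<delta>^4)) \<longlongrightarrow>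
        (G p - 1) * (2 * pi * (1 - 0 / (\<delta>\<^sup>2 + 0))) - N * (C1 + 2 * B * 0 / \<delta>^4)) (at_right 0)"
      using \<delta> by (intro tendsto_intros) auto
    moreover have "eventually (\<lambda>e. (G p - 1) * (2 * pi * (1 - e / (\<delta>\<^sup>2 + e))) - N * (C1 + 2 * B * e / \<delta>^4)
        \<le> C2 - ln (norm p)) (at_right 0)"
      using ineq by (auto simp: eventually_at_right_field intro!: exI[of _ 1])
    ultimately have "(G p - 1) * (2 * pi * (1 - 0 / (\<delta>\<^sup>2 + 0))) - N * (C1 + 2 * B * 0 / \<delta>^4) \<le> C2 - ln (norm p)"
      by (rule tendsto_upperbound) simp
    then show ?thesis by (simp add: algebra_simps)
  qed
  show ?thesis
    using main \<open>R > 0\<close> by (intro exI[of _ "2 * pi + N * C1 + C2"] exI[of _ "R / 2"]) auto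
qed

section \<open>The order of a solution at a point\<close>

text \<open>The mass at \<open>p\<close> of the right-hand side of the mean field equation, divided by \<open>4\<pi>\<close>.\<close>

definition singular_weight :: "complex \<Rightarrow> complex \<Rightarrow> complex \<Rightarrow> nat" where
  "singular_weight \<tau> a p =
     (if p \<in> lattice \<tau> then 2 else if p - a \<in> lattice \<tau> \<or> p + a \<in> lattice \<tau> then 1 else 0)"

lemma separating_radius:
  assumes \<tau>: "Im \<tau> > 0"
  shows "\<exists>r>0. \<forall>w\<in>lattice \<tau>. q + w \<noteq> p \<longrightarrow> r \<le> dist p (q + w)"
proof -
  have "closed (lattice \<tau> - {p - q})" by (rule closed_subset_lattice[OF \<tau>]) auto
  then obtain r where "r > 0" and r: "\<And>w. w \<in> lattice \<tau> - {p - q} \<Longrightarrow> r \<le> dist (p - q) w"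
    using separate_point_closed[of "lattice \<tau> - {p - q}" "p - q"] by auto
  have "r \<le> dist p (q + w)" if "w \<in> lattice \<tau>" "q + w \<noteq> p" for w
    using r[of w] that by (auto simp: dist_norm algebra_simps)
  then show ?thesis using \<open>r > 0\<close> by blast
qed

text \<open>Tested with a bump of radius \<open>\<epsilon>\<close> around \<open>p\<close>, the right-hand side of the equation is exactly the
  mass at \<open>p\<close>. On the left, \<open>2m ln |z - p|\<close> contributes \<open>4\<pi> m\<close> by the fundamental theorem of
  calculus in the squared radius, the limit \<open>v\<^sub>0\<close> of the remainder \<open>v\<close> contributes nothing, and
  what is left is small: \<open>v - v\<^sub>0\<close> is small on the disc while the Laplacian of the bump is of size
  \<open>1/\<epsilon>\<^sup>2\<close> on an area of size \<open>\<epsilon>\<^sup>2\<close>, and \<open>exp u\<close> is bounded.\<close>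

lemma solution_local_order:
  fixes m :: nat
  assumes \<tau>: "Im \<tau> > 0" and u: "solution \<tau> a u"
    and a: "a \<notin> lattice \<tau>" "2 * a \<notin> lattice \<tau>"
    and v: "(v \<longlongrightarrow> v\<^sub>0) (at p)"
    and near: "eventually (\<lambda>z. u z = 2 * real m * ln (dist p z) + v z) (at p)"
  shows "m = singular_weight \<tau> a p"
proof -
  have per: "periodic \<tau> u" and int: "torus_integrable \<tau> u" and inte: "torus_integrable \<tau> (\<lambda>z. exp (u z))"
    and weak: "\<And>\<phi>. test_function \<tau> \<phi> \<Longrightarrow> torus_integral \<tau> (\<lambda>z. u z * laplacian \<phi> z + exp (u z) * \<phi> z) =
          8 * pi * \<phi> 0 + 4 * pi * (\<phi> a + \<phi> (- a))"
    using u by (auto simp: solution_def)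
  have pere: "periodic \<tau> (\<lambda>z. exp (u z))" using per by (simp add: periodic_def)
  obtain \<delta>\<^sub>0 where "\<delta>\<^sub>0 > 0" and \<delta>\<^sub>0: "\<And>w. w \<in> lattice \<tau> \<Longrightarrow> w \<noteq> 0 \<Longrightarrow> \<delta>\<^sub>0 \<le> norm w"
    using lattice_separated[OF \<tau>] by auto
  obtain r0 where "r0 > 0" and r0: "\<And>w. w \<in> lattice \<tau> \<Longrightarrow> 0 + w \<noteq> p \<Longrightarrow> r0 \<le> dist p (0 + w)"
    using separating_radius[OF \<tau>, of 0 p] by auto
  obtain ra where "ra > 0" and ra: "\<And>w. w \<in> lattice \<tau> \<Longrightarrow> a + w \<noteq> p \<Longrightarrow> ra \<le> dist p (a + w)"
    using separating_radius[OF \<tau>, of a p] by auto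
  obtain rb where "rb > 0" and rb: "\<And>w. w \<in> lattice \<tau> \<Longrightarrow> - a + w \<noteq> p \<Longrightarrow> rb \<le> dist p (- a + w)"
    using separating_radius[OF \<tau>, of "- a" p] by auto
  define R where "R = Min {\<delta>\<^sub>0 / 2, r0, ra, rb}"
  have R: "R > 0" "R \<le> \<delta>\<^sub>0 / 2" "R \<le> r0" "R \<le> ra" "R \<le> rb"
    using \<open>r0 > 0\<close> \<open>ra > 0\<close> \<open>rb > 0\<close> \<open>\<delta>\<^sub>0 > 0\<close> by (auto simp: R_def)
  have sep: "\<And>w. w \<in> lattice \<tau> \<Longrightarrow> w \<noteq> 0 \<Longrightarrow> 2 * R \<le> norm w"
    using \<delta>\<^sub>0 R by fastforce
  obtain \<eta> \<eta>' \<eta>'' :: "real \<Rightarrow> real" and B :: real where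
    \<eta>: "\<And>t. (\<eta> has_real_derivative \<eta>' t) (at t)" "\<And>t. (\<eta>' has_real_derivative \<eta>'' t) (at t)"
    "continuous_on UNIV \<eta>''" "\<And>t. \<eta> t \<ge> 0" "\<And>t. t \<le> 1 \<Longrightarrow> \<eta> t = 1" "\<And>t. t \<ge> 2 \<Longrightarrow> \<eta> t = 0"
    "\<And>c p. smooth (\<lambda>z. \<eta> (c * (dist p z)\<^sup>2))"
    "\<And>t. t < 1 \<or> t > 2 \<Longrightarrow> \<eta>' t = 0" "\<And>t. t < 1 \<or> t > 2 \<Longrightarrow> \<eta>'' t = 0"
    and B: "\<And>t. t \<ge> 0 \<Longrightarrow> \<bar>\<eta> t\<bar> \<le> B" "\<And>t. \<bar>\<eta>' t\<bar> \<le> B" "\<And>t. \<bar>\<eta>'' t\<bar> \<le> B" "B \<ge> 1"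
    by (rule radial_bump_bounded) (rule that; assumption)
  define D where "D = real m - real (singular_weight \<tau> a p)"
  have est: "4 * pi * \<bar>D\<bar> \<le> \<kappa> * (48 * pi * B + 4 * pi * B * exp (v\<^sub>0 + 1))" if "\<kappa> > 0" "\<kappa> \<le> 1" for \<kappa>
  proof -
    have "eventually (\<lambda>z. dist (v z) v\<^sub>0 < \<kappa>) (at p)" using v \<open>\<kappa> > 0\<close> by (rule tendstoD)
    with near have "eventually (\<lambda>z. u z = 2 * real m * ln (dist p z) + v z \<and> dist (v z) v\<^sub>0 < \<kappa>) (at p)"
      by eventually_elim auto
    then obtain d where "d > 0"
      and d: "\<And>z. z \<noteq> p \<Longrightarrow> dist p z < d \<Longrightarrow> u z = 2 * real m * ln (dist p z) + v z \<and> \<bar>v z - v\<^sub>0\<bar> < \<kappa>"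
      by (auto simp: eventually_at dist_real_def dist_commute)
    define \<epsilon> where "\<epsilon> = Min {R / 2, d / 2, 1 / 2, \<kappa>}"
    have \<epsilon>: "\<epsilon> > 0" "2 * \<epsilon> \<le> R" "2 * \<epsilon> \<le> d" "2 * \<epsilon> \<le> 1" "\<epsilon> \<le> \<kappa>"
      using \<open>d > 0\<close> \<open>\<kappa> > 0\<close> R(1) by (auto simp: \<epsilon>_def min_def)
    have "\<epsilon>\<^sup>2 \<le> \<kappa>"
    proof -
      have "\<epsilon> * \<epsilon> \<le> 1 * \<kappa>" using \<epsilon> by (intro mult_mono) auto
      then show ?thesis by (simp add: power2_eq_square)
    qed
    define c where "c = 1 / \<epsilon>\<^sup>2"
    have "c > 0" using \<epsilon>(1) by (simp add: c_def)
    have c\<epsilon>: "c * \<epsilon>\<^sup>2 = 1" using \<epsilon>(1) by (simp add: c_def)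
    define \<phi> where "\<phi> z = \<eta> (c * (dist p z)\<^sup>2)" for z
    have smooth: "smooth \<phi>" unfolding \<phi>_def[abs_def] by (rule \<eta>(7))
    have far: "c * (dist p z)\<^sup>2 > 2" if "dist p z \<ge> 3 * \<epsilon> / 2" for z
    proof -
      have "(3 * \<epsilon> / 2)\<^sup>2 \<le> (dist p z)\<^sup>2" using that \<epsilon>(1) by (intro power_mono) auto
      then have "c * (3 * \<epsilon> / 2)\<^sup>2 \<le> c * (dist p z)\<^sup>2" using \<open>c > 0\<close> by (intro mult_left_mono) auto
      moreover have "c * (3 * \<epsilon> / 2)\<^sup>2 = 9 / 4 * (c * \<epsilon>\<^sup>2)" by (simp add: power_divide power_mult_distrib)
      ultimately show ?thesis using c\<epsilon> by linarith
    qed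
    have supp: "\<phi> z = 0" if "dist p z \<ge> 3 * \<epsilon> / 2" for z
      using far[OF that] by (simp add: \<phi>_def \<eta>(6))
    have R': "3 * \<epsilon> / 2 < R" using \<epsilon> by simp
    define L where "L t = 4 * (c * \<eta>' (c * t)) + 4 * t * (c\<^sup>2 * \<eta>'' (c * t))" for t
    have chain: "((\<lambda>t. \<eta> (c * t)) has_real_derivative c * \<eta>' (c * t)) (at t)"
       "((\<lambda>t. c * \<eta>' (c * t)) has_real_derivative c\<^sup>2 * \<eta>'' (c * t)) (at t)" for t
      using DERIV_chain2[OF \<eta>(1) DERIV_cmult_Id, of c t]
        DERIV_cmult[OF DERIV_chain2[OF \<eta>(2) DERIV_cmult_Id, of c t], of c]
      by (simp_all add: mult_ac power2_eq_square)
    have lap: "laplacian \<phi> z = L ((dist p z)\<^sup>2)" for z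
    proof -
      have "laplacian (\<lambda>z. (\<lambda>t. \<eta> (c * t)) ((dist p z)\<^sup>2)) z =
         4 * (c * \<eta>' (c * (dist p z)\<^sup>2)) + 4 * (dist p z)\<^sup>2 * (c\<^sup>2 * \<eta>'' (c * (dist p z)\<^sup>2))"
        by (rule laplacian_radial) (rule chain)+
      then show ?thesis by (simp add: \<phi>_def[abs_def] L_def)
    qed
    have cont: "continuous_on UNIV \<eta>'" "continuous_on UNIV \<eta>"
      using \<eta>(1,2) by (auto intro!: continuous_at_imp_continuous_on DERIV_isCont)
    have L_cont: "continuous_on UNIV L"
      unfolding L_def[abs_def]
      by (intro continuous_intros continuous_on_compose2[OF cont(1)] continuous_on_compose2[OF \<eta>(3)]) auto
    have L_0: "L t = 0" if "c * t < 1 \<or> c * t > 2" for t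
      using that \<eta>(8,9) by (simp add: L_def)
    have L_bound: "\<bar>L t\<bar> \<le> 12 * B * c" if "t \<ge> 0" for t
    proof (cases "c * t < 1 \<or> c * t > 2")
      case True
      then show ?thesis using L_0[OF True] B(4) \<open>c > 0\<close> by simp
    next
      case False
      have "L t = 4 * c * (\<eta>' (c * t) + (c * t) * \<eta>'' (c * t))" by (simp add: L_def power2_eq_square algebra_simps)
      then have "\<bar>L t\<bar> = 4 * c * \<bar>\<eta>' (c * t) + (c * t) * \<eta>'' (c * t)\<bar>" using \<open>c > 0\<close> by (simp add: abs_mult)
      also have "\<bar>\<eta>' (c * t) + (c * t) * \<eta>'' (c * t)\<bar> \<le> \<bar>\<eta>' (c * t)\<bar> + \<bar>c * t\<bar> * \<bar>\<eta>'' (c * t)\<bar>"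
        by (metis abs_triangle_ineq abs_mult)
      also have "\<dots> \<le> B + 2 * B" using False B(2,3,4) by (intro add_mono mult_mono) auto
      finally show ?thesis using \<open>c > 0\<close> by (simp add: mult_left_mono mult_ac)
    qed
    have test: "test_function \<tau> (periodize \<tau> (ball p R) \<phi>)"
      using test_function_periodize[OF \<tau> sep smooth R' supp, where p = p] by simp
    have loc: "torus_integrable \<tau> (\<lambda>z. u z * laplacian (periodize \<tau> (ball p R) \<phi>) z)"
      "set_integrable lborel (ball p R) (\<lambda>z. u z * laplacian \<phi> z)"
      "torus_integral \<tau> (\<lambda>z. u z * laplacian (periodize \<tau> (ball p R) \<phi>) z)
          = (LINT z:ball p R|lborel. u z * laplacian \<phi> z)"
      using torus_integral_laplacian_periodize[OF \<tau> sep smooth R' supp per int, where p = p] by simp_all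
    have loce: "torus_integrable \<tau> (\<lambda>z. exp (u z) * periodize \<tau> (ball p R) \<phi> z)"
      "set_integrable lborel (ball p R) (\<lambda>z. exp (u z) * \<phi> z)"
      "torus_integral \<tau> (\<lambda>z. exp (u z) * periodize \<tau> (ball p R) \<phi> z)
          = (LINT z:ball p R|lborel. exp (u z) * \<phi> z)"
      using torus_integral_periodize[OF \<tau> sep smooth R' supp pere inte, where p = p] by simp_all
    have value_at: "periodize \<tau> (ball p R) \<phi> q = (if p - q \<in> lattice \<tau> then 1 else 0)"
      if q: "\<And>w. w \<in> lattice \<tau> \<Longrightarrow> q + w \<noteq> p \<Longrightarrow> R \<le> dist p (q + w)" for q
    proof (cases "p - q \<in> lattice \<tau>")
      case True
      then show ?thesis
        using periodize_eq_in_ball[OF \<tau> sep True, where z = q and p = p and \<phi> = \<phi>] R(1)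
        by (simp add: \<phi>_def \<eta>(5))
    next
      case False
      have "q + w \<notin> ball p R" if w: "w \<in> lattice \<tau>" for w
      proof -
        have "q + w \<noteq> p" using False w by auto
        then show ?thesis using q[OF w] by simp
      qed
      then show ?thesis using False periodize_outside by simp
    qed
    have \<Phi>0: "periodize \<tau> (ball p R) \<phi> 0 = (if p - 0 \<in> lattice \<tau> then 1 else 0)"
      using r0 R(3) by (intro value_at) fastforce
    have \<Phi>a: "periodize \<tau> (ball p R) \<phi> a = (if p - a \<in> lattice \<tau> then 1 else 0)"
      using ra R(4) by (intro value_at) fastforce
    have \<Phi>b: "periodize \<tau> (ball p R) \<phi> (- a) = (if p - - a \<in> lattice \<tau> then 1 else 0)"
      using rb R(5) by (intro value_at) fastforce
    have weight: "8 * pi * periodize \<tau> (ball p R) \<phi> 0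
        + 4 * pi * (periodize \<tau> (ball p R) \<phi> a + periodize \<tau> (ball p R) \<phi> (- a)) = 4 * pi * real (singular_weight \<tau> a p)"
    proof -
      have 1: "p - a \<notin> lattice \<tau> \<and> p + a \<notin> lattice \<tau>" if "p \<in> lattice \<tau>"
        using lattice_closed(3)[OF \<tau> that, of "p - a"] lattice_closed(3)[OF \<tau> _ that, of "p + a"] a(1) by auto
      have 2: "\<not> (p - a \<in> lattice \<tau> \<and> p + a \<in> lattice \<tau>)"
        using lattice_closed(3)[OF \<tau>, of "p + a" "p - a"] a(2) by auto
      show ?thesis
        using 1 2 unfolding \<Phi>0 \<Phi>a \<Phi>b singular_weight_def by auto
    qed
    (* F is the contribution of 2 m ln |z - p| + v0, written in t = |z - p|^2, and Y is the error. *)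
    define F where "F t = (real m * ln t + v\<^sub>0) * L t" for t
    have F_meas: "F \<in> borel_measurable borel"
      using borel_measurable_continuous_onI[OF L_cont] unfolding F_def by measurable
    define Y where "Y z = u z * laplacian \<phi> z - F ((dist p z)\<^sup>2)" for z
    have Y_bound: "\<bar>Y z\<bar> \<le> \<kappa> * (12 * B * c)" and Y_0: "dist p z \<ge> 2 * \<epsilon> \<Longrightarrow> Y z = 0" for z
    proof -
      define t where "t = (dist p z)\<^sup>2"
      have "t \<ge> 0" by (simp add: t_def)
      have Yt: "Y z = (u z - (real m * ln t + v\<^sub>0)) * L t"
        unfolding Y_def lap F_def t_def by (simp add: algebra_simps)
      show "dist p z \<ge> 2 * \<epsilon> \<Longrightarrow> Y z = 0"
        using far[of z] \<epsilon>(1) L_0[of t] unfolding Yt t_def by force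
      show "\<bar>Y z\<bar> \<le> \<kappa> * (12 * B * c)"
      proof (cases "c * t < 1 \<or> c * t > 2")
        case True
        have "0 \<le> \<kappa> * (12 * B * c)" using \<open>\<kappa> > 0\<close> B(4) \<open>c > 0\<close> by simp
        then show ?thesis using L_0[OF True] by (simp add: Yt)
      next
        case False
        then have "dist p z < 3 * \<epsilon> / 2" using far[of z] by (force simp: t_def)
        moreover have "z \<noteq> p" using False by (auto simp: t_def)
        ultimately have uz: "u z = 2 * real m * ln (dist p z) + v z" "\<bar>v z - v\<^sub>0\<bar> < \<kappa>"
          using d[of z] \<epsilon> by auto
        have "ln t = 2 * ln (dist p z)" using \<open>z \<noteq> p\<close> by (simp add: t_def ln_realpow)
        then have "Y z = (v z - v\<^sub>0) * L t" unfolding Yt uz by (simp add: algebra_simps)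
        then show ?thesis
          using uz(2) L_bound[OF \<open>t \<ge> 0\<close>] \<open>\<kappa> > 0\<close> by (simp add: abs_mult mult_mono)
      qed
    qed
    have F_int: "set_integrable lborel (ball p R) (\<lambda>z. F ((dist p z)\<^sup>2))"
      and Y_int: "set_integrable lborel (ball p R) Y"
    proof -
      have indicator_idem: "indicator (ball p R) z * (indicator (ball p R) z * x) = indicator (ball p R) z * x" for z and x :: real
        by (simp add: indicator_def)
      have "(\<lambda>z. indicator (ball p R) z *\<^sub>R (u z * laplacian \<phi> z)) \<in> borel_measurable borel"
        using borel_measurable_integrable[OF loc(2)[unfolded set_integrable_def]] by simp
      moreover have "(\<lambda>z. indicator (ball p R) z *\<^sub>R F ((dist p z)\<^sup>2)) \<in> borel_measurable borel"
      proof -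
        have "(\<lambda>z. F ((dist p z)\<^sup>2)) \<in> borel_measurable borel"
          by (rule measurable_compose[OF _ F_meas]) (intro borel_measurable_continuous_onI continuous_intros)
        then show ?thesis unfolding real_scaleR_def
          by (intro borel_measurable_times borel_measurable_indicator) simp_all
      qed
      ultimately have "(\<lambda>z. indicator (ball p R) z *\<^sub>R (u z * laplacian \<phi> z) - indicator (ball p R) z *\<^sub>R F ((dist p z)\<^sup>2))
          \<in> borel_measurable borel"
        by (rule borel_measurable_diff)
      then have meas: "(\<lambda>z. indicator (ball p R) z * Y z) \<in> borel_measurable borel"
        by (simp add: Y_def algebra_simps)
      have "set_integrable lborel (ball p R) (\<lambda>z. indicator (ball p R) z * Y z)"
        using Y_bound \<open>\<kappa> > 0\<close> B(4) \<open>c > 0\<close>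
        by (intro set_integrable_ball_bounded[where M = "\<kappa> * (12 * B * c)"] meas) (auto simp: indicator_def)
      then show Y_int: "set_integrable lborel (ball p R) Y"
        by (simp add: set_integrable_def indicator_idem)
      show "set_integrable lborel (ball p R) (\<lambda>z. F ((dist p z)\<^sup>2))"
        using set_integral_diff(1)[OF loc(2) Y_int] by (simp add: Y_def)
    qed
    have F_val: "(LINT z:ball p R|lborel. F ((dist p z)\<^sup>2)) = 4 * pi * real m"
    proof -
      (* An antiderivative of F. The derivative of the cutoff vanishes near 0, so \<Psi> is constant there
         and the logarithm does no harm. *)
      define \<Psi> where "\<Psi> t = (real m * ln t + v\<^sub>0) * (4 * t * (c * \<eta>' (c * t))) - 4 * real m * \<eta> (c * t)" for t
      have deriv: "(\<Psi> has_real_derivative F t) (at t)" if "t > 0" for t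
      proof -
        have "((\<lambda>t. real m * ln t + v\<^sub>0) has_real_derivative real m * inverse t) (at t)"
          using that by (auto intro!: derivative_eq_intros simp: divide_inverse)
        moreover have "((\<lambda>t. 4 * t * (c * \<eta>' (c * t))) has_real_derivative 4 * (c * \<eta>' (c * t)) + (c\<^sup>2 * \<eta>'' (c * t)) * (4 * t)) (at t)"
          by (rule DERIV_mult[OF _ chain(2)]) (auto intro!: derivative_eq_intros)
        ultimately have "((\<lambda>t. (real m * ln t + v\<^sub>0) * (4 * t * (c * \<eta>' (c * t)))) has_real_derivative
            real m * inverse t * (4 * t * (c * \<eta>' (c * t)))
            + (4 * (c * \<eta>' (c * t)) + (c\<^sup>2 * \<eta>'' (c * t)) * (4 * t)) * (real m * ln t + v\<^sub>0)) (at t)"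
          by (rule DERIV_mult)
        from DERIV_diff[OF this DERIV_cmult[OF chain(1), of "4 * real m"]]
        show ?thesis
          unfolding \<Psi>_def[abs_def] F_def L_def using that
          by (elim DERIV_cong) (simp add: field_simps)
      qed
      have cont\<Psi>: "continuous_on {0..R\<^sup>2} \<Psi>"
      proof (rule continuous_at_imp_continuous_on, rule ballI)
        fix t assume "t \<in> {0..R\<^sup>2}"
        show "isCont \<Psi> t"
        proof (cases "t > 0")
          case True
          then show ?thesis using deriv DERIV_isCont by blast
        next
          case False
          then have "t = 0" using \<open>t \<in> {0..R\<^sup>2}\<close> by auto
          have "\<Psi> x = - 4 * real m" if "x \<in> ball 0 (1 / c)" for x
          proof -
            have "x < 1 / c" using that by (simp add: dist_real_def)
            then have "c * x < 1" using \<open>c > 0\<close> by (simp add: field_simps)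
            then show ?thesis by (simp add: \<Psi>_def \<eta>(5) \<eta>(8))
          qed
          then have "eventually (\<lambda>x. \<Psi> x = - 4 * real m) (nhds 0)"
            using \<open>c > 0\<close> by (intro eventually_nhds_in_open[THEN eventually_mono, of "ball 0 (1 / c)"]) auto
          then show ?thesis unfolding \<open>t = 0\<close> by (simp add: isCont_cong)
        qed
      qed
      have "c * R\<^sup>2 > 2"
      proof -
        have "(2 * \<epsilon>)\<^sup>2 \<le> R\<^sup>2" using \<epsilon> by (intro power_mono) auto
        then have "c * (2 * \<epsilon>)\<^sup>2 \<le> c * R\<^sup>2" using \<open>c > 0\<close> by (intro mult_left_mono) auto
        moreover have "c * (2 * \<epsilon>)\<^sup>2 = 4 * (c * \<epsilon>\<^sup>2)" by (simp add: power_mult_distrib)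
        ultimately show ?thesis using c\<epsilon> by linarith
      qed
      then have "\<Psi> (R\<^sup>2) = 0" "\<Psi> 0 = - 4 * real m" by (simp_all add: \<Psi>_def \<eta>(5,6,8))
      then show ?thesis
        using radial_integral_FTC[OF F_meas R(1) F_int cont\<Psi> deriv] by simp
    qed
    have small: "\<bar>LINT z:ball p R|lborel. h z\<bar> \<le> M * (pi * (2 * \<epsilon>)\<^sup>2)"
      if h: "set_integrable lborel (ball p R) h" "\<And>z. dist p z \<ge> 2 * \<epsilon> \<Longrightarrow> h z = 0"
        "\<And>z. dist p z < 2 * \<epsilon> \<Longrightarrow> z \<noteq> p \<Longrightarrow> \<bar>h z\<bar> \<le> M" "M \<ge> 0" for h M
    proof -
      have "\<bar>LINT z:ball p R|lborel. h z\<bar> \<le> (LINT z|lborel. \<bar>indicator (ball p R) z * h z\<bar>)"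
        unfolding set_lebesgue_integral_def real_scaleR_def by (rule integral_abs_bound)
      also have "\<dots> \<le> (LINT z|lborel. indicator (ball p (2 * \<epsilon>)) z * M)"
      proof (rule integral_mono_AE)
        show "integrable lborel (\<lambda>z. \<bar>indicator (ball p R) z * h z\<bar>)"
          using h(1) by (simp add: set_integrable_def)
        show "integrable lborel (\<lambda>z. indicator (ball p (2 * \<epsilon>)) z * M)"
          using emeasure_lborel_ball_finite[of p "2 * \<epsilon>"] by (simp add: less_top)
        have "AE z in lborel. z \<noteq> p" by (rule AE_lborel_singleton)
        then show "AE z in lborel. \<bar>indicator (ball p R) z * h z\<bar> \<le> indicator (ball p (2 * \<epsilon>)) z * M"
        proof eventually_elim
          case (elim z)
          then show ?case using h(2)[of z] h(3)[of z] h(4) by (auto simp: indicator_def not_less)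
        qed
      qed
      also have "\<dots> = M * (pi * (2 * \<epsilon>)\<^sup>2)"
        using set_integral_ball_const[of "2 * \<epsilon>" p M] \<epsilon>(1) by (simp add: set_lebesgue_integral_def)
      finally show ?thesis .
    qed
    have Y_small: "\<bar>LINT z:ball p R|lborel. Y z\<bar> \<le> \<kappa> * (12 * B * c) * (pi * (2 * \<epsilon>)\<^sup>2)"
      using Y_bound Y_0 \<open>\<kappa> > 0\<close> B(4) \<open>c > 0\<close> by (intro small Y_int) auto
    have E_small: "\<bar>LINT z:ball p R|lborel. exp (u z) * \<phi> z\<bar> \<le> (exp (v\<^sub>0 + 1) * B) * (pi * (2 * \<epsilon>)\<^sup>2)"
    proof (intro small loce(2))
      fix z assume z: "dist p z < 2 * \<epsilon>" "z \<noteq> p"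
      then have uz: "u z = 2 * real m * ln (dist p z) + v z" "\<bar>v z - v\<^sub>0\<bar> < \<kappa>"
        using d[of z] \<epsilon> by auto
      have "ln (dist p z) \<le> 0" using z \<epsilon>(4) by (subst ln_le_zero_iff) auto
      then have "2 * real m * ln (dist p z) \<le> 0" by (intro mult_nonneg_nonpos) auto
      then have "u z \<le> v\<^sub>0 + 1" using uz \<open>\<kappa> \<le> 1\<close> by linarith
      then have "exp (u z) * \<bar>\<phi> z\<bar> \<le> exp (v\<^sub>0 + 1) * B"
        using B(1)[of "c * (dist p z)\<^sup>2"] \<open>c > 0\<close> unfolding \<phi>_def by (intro mult_mono) auto
      then show "\<bar>exp (u z) * \<phi> z\<bar> \<le> exp (v\<^sub>0 + 1) * B" by (simp add: abs_mult)
    next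
      fix z assume "2 * \<epsilon> \<le> dist p z"
      then show "exp (u z) * \<phi> z = 0" using supp[of z] \<epsilon>(1) by simp
    qed (use B(4) in simp)
    have "4 * pi * real (singular_weight \<tau> a p) =
        torus_integral \<tau> (\<lambda>z. u z * laplacian (periodize \<tau> (ball p R) \<phi>) z + exp (u z) * periodize \<tau> (ball p R) \<phi> z)"
      unfolding weak[OF test] weight ..
    also have "\<dots> = (LINT z:ball p R|lborel. u z * laplacian \<phi> z) + (LINT z:ball p R|lborel. exp (u z) * \<phi> z)"
      unfolding loc(3)[symmetric] loce(3)[symmetric] unfolding torus_integral_def
      by (rule set_integral_add(2)) (use loc(1) loce(1) in \<open>auto simp: torus_integrable_def\<close>)
    also have "(LINT z:ball p R|lborel. u z * laplacian \<phi> z) = (LINT z:ball p R|lborel. F ((dist p z)\<^sup>2) + Y z)"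
      by (simp add: Y_def)
    also have "\<dots> = 4 * pi * real m + (LINT z:ball p R|lborel. Y z)"
      using set_integral_add(2)[OF F_int Y_int] F_val by simp
    finally have "4 * pi * D = - (LINT z:ball p R|lborel. Y z) - (LINT z:ball p R|lborel. exp (u z) * \<phi> z)"
      by (simp add: D_def algebra_simps)
    then have "\<bar>4 * pi * D\<bar> \<le> \<bar>LINT z:ball p R|lborel. Y z\<bar> + \<bar>LINT z:ball p R|lborel. exp (u z) * \<phi> z\<bar>"
      by linarith
    also have "\<dots> \<le> \<kappa> * (12 * B * c) * (pi * (2 * \<epsilon>)\<^sup>2) + (exp (v\<^sub>0 + 1) * B) * (pi * (2 * \<epsilon>)\<^sup>2)"
      by (intro add_mono Y_small E_small)
    also have "\<kappa> * (12 * B * c) * (pi * (2 * \<epsilon>)\<^sup>2) = \<kappa> * (48 * pi * B) * (c * \<epsilon>\<^sup>2)"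
      by (simp add: power_mult_distrib)
    also have "\<dots> = \<kappa> * (48 * pi * B)" by (simp only: c\<epsilon> mult_1_right)
    also have "(exp (v\<^sub>0 + 1) * B) * (pi * (2 * \<epsilon>)\<^sup>2) = (4 * pi * B * exp (v\<^sub>0 + 1)) * \<epsilon>\<^sup>2"
      by (simp add: power_mult_distrib)
    also have "\<dots> \<le> (4 * pi * B * exp (v\<^sub>0 + 1)) * \<kappa>"
      using \<open>\<epsilon>\<^sup>2 \<le> \<kappa>\<close> B(4) by (intro mult_left_mono) auto
    finally show ?thesis by (simp add: abs_mult algebra_simps)
  qed
  define K where "K = 48 * pi * B + 4 * pi * B * exp (v\<^sub>0 + 1)"
  have "((\<lambda>\<kappa>. \<kappa> * K) \<longlongrightarrow> 0 * K) (at_right 0)" by (intro tendsto_intros)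
  moreover have "eventually (\<lambda>\<kappa>. 4 * pi * \<bar>D\<bar> \<le> \<kappa> * K) (at_right 0)"
    using est unfolding K_def by (auto simp: eventually_at_right_field intro!: exI[of _ 1])
  ultimately have "4 * pi * \<bar>D\<bar> \<le> 0 * K" by (rule tendsto_lowerbound) simp
  then have "D = 0" using pi_gt_zero by (auto simp: mult_le_0_iff not_le[symmetric])
  then show ?thesis by (simp add: D_def)
qed

section \<open>The argument principle on a period parallelogram\<close>

definition parallelogram_path :: "complex \<Rightarrow> complex \<Rightarrow> real \<Rightarrow> complex" where
  "parallelogram_path z0 \<tau> =
     linepath z0 (z0 + 1) +++ linepath (z0 + 1) (z0 + 1 + \<tau>) +++
     linepath (z0 + 1 + \<tau>) (z0 + \<tau>) +++ linepath (z0 + \<tau>) z0"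

lemma coord_scaleR: "coord_x \<tau> (t *\<^sub>R z) = t * coord_x \<tau> z" "coord_y \<tau> (t *\<^sub>R z) = t * coord_y \<tau> z"
  by (simp_all add: coord_x_def coord_y_def algebra_simps)

lemma coord_1_\<tau>:
  assumes "Im \<tau> > 0"
  shows "coord_x \<tau> 1 = 1" "coord_y \<tau> 1 = 0" "coord_x \<tau> \<tau> = 0" "coord_y \<tau> \<tau> = 1"
  using assms by (simp_all add: coord_x_def coord_y_def)

lemma coord_convex:
  assumes "Im \<tau> > 0"
  shows "convex {z. coord_x \<tau> z \<in> {a..b} \<and> coord_y \<tau> z \<in> {c..d}}"
proof (rule convexI)
  fix x y and u v :: real
  assume "x \<in> {z. coord_x \<tau> z \<in> {a..b} \<and> coord_y \<tau> z \<in> {c..d}}" "y \<in> {z. coord_x \<tau> z \<in> {a..b} \<and> coord_y \<tau> z \<in> {c..d}}"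
    and uv: "0 \<le> u" "0 \<le> v" "u + v = 1"
  then have *: "{coord_x \<tau> x, coord_x \<tau> y} \<subseteq> {a..b}" "{coord_y \<tau> x, coord_y \<tau> y} \<subseteq> {c..d}" by auto
  have "u *\<^sub>R coord_x \<tau> x + v *\<^sub>R coord_x \<tau> y \<in> {a..b}" "u *\<^sub>R coord_y \<tau> x + v *\<^sub>R coord_y \<tau> y \<in> {c..d}"
    using * uv by (intro convexD[OF convex_real_interval(5)]; simp)+
  then show "u *\<^sub>R x + v *\<^sub>R y \<in> {z. coord_x \<tau> z \<in> {a..b} \<and> coord_y \<tau> z \<in> {c..d}}"
    by (simp add: coord_add coord_scaleR)
qed

context
  fixes \<tau> z0 :: complex
  assumes \<tau>: "Im \<tau> > 0"
begin

lemma valid_parallelogram: "valid_path (parallelogram_path z0 \<tau>)"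
  "pathstart (parallelogram_path z0 \<tau>) = z0" "pathfinish (parallelogram_path z0 \<tau>) = z0"
  unfolding parallelogram_path_def by (auto intro!: valid_path_join)

lemma path_image_parallelogram: "path_image (parallelogram_path z0 \<tau>) =
   closed_segment z0 (z0 + 1) \<union> closed_segment (z0 + 1) (z0 + 1 + \<tau>) \<union>
   closed_segment (z0 + 1 + \<tau>) (z0 + \<tau>) \<union> closed_segment (z0 + \<tau>) z0"
  unfolding parallelogram_path_def by (simp add: path_image_join Un_assoc)

lemma edge_coord:
  assumes "z \<in> path_image (parallelogram_path z0 \<tau>)"
  shows "coord_x \<tau> (z - z0) \<in> {0, 1} \<or> coord_y \<tau> (z - z0) \<in> {0, 1}"
    and "coord_x \<tau> (z - z0) \<in> {0..1} \<and> coord_y \<tau> (z - z0) \<in> {0..1}"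
proof -
  note simps = coord_add coord_diff coord_scaleR coord_1_\<tau>[OF \<tau>]
  have seg: "z \<in> closed_segment a b \<Longrightarrow> \<exists>u. 0 \<le> u \<and> u \<le> 1 \<and> z - z0 = (a - z0) + u *\<^sub>R (b - a)" for a b :: complex
    by (auto simp: in_segment algebra_simps)
  from assms consider "z \<in> closed_segment z0 (z0 + 1)" | "z \<in> closed_segment (z0 + 1) (z0 + 1 + \<tau>)"
     | "z \<in> closed_segment (z0 + 1 + \<tau>) (z0 + \<tau>)" | "z \<in> closed_segment (z0 + \<tau>) z0"
    unfolding path_image_parallelogram by blast
  then have "(coord_x \<tau> (z - z0) \<in> {0, 1} \<or> coord_y \<tau> (z - z0) \<in> {0, 1}) \<and>
     (coord_x \<tau> (z - z0) \<in> {0..1} \<and> coord_y \<tau> (z - z0) \<in> {0..1})"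
  proof cases
    case 1
    from seg[OF this] obtain u where u: "0 \<le> u" "u \<le> 1" "z - z0 = (z0 - z0) + u *\<^sub>R ((z0 + 1) - z0)" by auto
    show ?thesis unfolding u(3) using u(1,2) by (auto simp: simps)
  next
    case 2
    from seg[OF this] obtain u where u: "0 \<le> u" "u \<le> 1" "z - z0 = ((z0 + 1) - z0) + u *\<^sub>R ((z0 + 1 + \<tau>) - (z0 + 1))" by auto
    show ?thesis unfolding u(3) using u(1,2) by (auto simp: simps)
  next
    case 3
    from seg[OF this] obtain u where u: "0 \<le> u" "u \<le> 1" "z - z0 = ((z0 + 1 + \<tau>) - z0) + u *\<^sub>R ((z0 + \<tau>) - (z0 + 1 + \<tau>))" by auto
    show ?thesis unfolding u(3) using u(1,2) by (auto simp: simps)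
  next
    case 4
    from seg[OF this] obtain u where u: "0 \<le> u" "u \<le> 1" "z - z0 = ((z0 + \<tau>) - z0) + u *\<^sub>R (z0 - (z0 + \<tau>))" by auto
    show ?thesis unfolding u(3) using u(1,2) by (auto simp: simps)
  qed
  then show "coord_x \<tau> (z - z0) \<in> {0, 1} \<or> coord_y \<tau> (z - z0) \<in> {0, 1}"
    and "coord_x \<tau> (z - z0) \<in> {0..1} \<and> coord_y \<tau> (z - z0) \<in> {0..1}" by blast+
qed

lemma winding_number_parallelogram_outside:
  assumes "\<not> (coord_x \<tau> (z - z0) \<in> {0..1} \<and> coord_y \<tau> (z - z0) \<in> {0..1})"
  shows "winding_number (parallelogram_path z0 \<tau>) z = 0"
proof (rule winding_number_zero_outside)
  let ?S = "{z. coord_x \<tau> z \<in> {coord_x \<tau> z0..coord_x \<tau> z0 + 1} \<and> coord_y \<tau> z \<in> {coord_y \<tau> z0..coord_y \<tau> z0 + 1}}"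
  show "convex ?S" by (rule coord_convex[OF \<tau>])
  show "z \<notin> ?S" using assms by (auto simp: coord_diff)
  show "path_image (parallelogram_path z0 \<tau>) \<subseteq> ?S" using edge_coord(2) by (force simp: coord_diff)
qed (use valid_parallelogram in \<open>auto intro: valid_path_imp_path\<close>)

text \<open>Each edge sees an interior point on its left, so the four contributions are positive; each is
  less than \<open>1/2\<close>. The only integer between 0 and 2 is 1.\<close>

lemma winding_number_parallelogram_inside:
  assumes "coord_x \<tau> (z - z0) \<in> {0<..<1}" "coord_y \<tau> (z - z0) \<in> {0<..<1}"
  shows "winding_number (parallelogram_path z0 \<tau>) z = 1"
proof -
  define x y where "x = coord_x \<tau> (z - z0)" and "y = coord_y \<tau> (z - z0)"
  have xy: "0 < x" "x < 1" "0 < y" "y < 1" using assms by (auto simp: x_def y_def)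
  have z: "z = z0 + of_real x + of_real y * \<tau>"
    using coord_decomposition[OF \<tau>, of "z - z0"] by (simp add: x_def y_def algebra_simps)
  have not_edge: "z \<notin> path_image (parallelogram_path z0 \<tau>)"
    using edge_coord(1)[of z] assms by auto
  have pos: "0 < Re (winding_number (linepath z0 (z0 + 1)) z)"
     "0 < Re (winding_number (linepath (z0 + 1) (z0 + 1 + \<tau>)) z)"
     "0 < Re (winding_number (linepath (z0 + 1 + \<tau>) (z0 + \<tau>)) z)"
     "0 < Re (winding_number (linepath (z0 + \<tau>) z0) z)"
    using xy \<tau> by (auto intro!: winding_number_linepath_pos_lt simp: z algebra_simps)
  have not_seg: "z \<notin> closed_segment z0 (z0 + 1)" "z \<notin> closed_segment (z0 + 1) (z0 + 1 + \<tau>)"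
     "z \<notin> closed_segment (z0 + 1 + \<tau>) (z0 + \<tau>)" "z \<notin> closed_segment (z0 + \<tau>) z0"
    using not_edge unfolding path_image_parallelogram by auto
  have "winding_number (parallelogram_path z0 \<tau>) z = winding_number (linepath z0 (z0 + 1)) z
      + winding_number (linepath (z0 + 1) (z0 + 1 + \<tau>)) z + winding_number (linepath (z0 + 1 + \<tau>) (z0 + \<tau>)) z
      + winding_number (linepath (z0 + \<tau>) z0) z"
    unfolding parallelogram_path_def using not_seg by (simp add: winding_number_join path_image_join)
  then have "0 < Re (winding_number (parallelogram_path z0 \<tau>) z)" "Re (winding_number (parallelogram_path z0 \<tau>) z) < 2"
    using pos not_seg[THEN winding_number_lt_half_linepath] by auto
  then show ?thesis
    using valid_parallelogram not_edge by (intro winding_number_eq_1) (auto intro: valid_path_imp_path)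
qed

end

text \<open>The integral of \<open>f'/f\<close> along a segment is a logarithm of the quotient of the values of \<open>f\<close> at the
  end points; no global logarithm of \<open>f\<close> is involved.\<close>

lemma exp_contour_integral_logderiv:
  assumes "open S" "f holomorphic_on S" "closed_segment a b \<subseteq> S" "\<And>z. z \<in> S \<Longrightarrow> f z \<noteq> 0"
  shows "f b = exp (contour_integral (linepath a b) (\<lambda>z. deriv f z / f z)) * f a"
proof -
  let ?\<gamma> = "f \<circ> linepath a b"
  have "valid_path ?\<gamma>"
    using assms by (intro valid_path_compose_holomorphic[of _ f S]) auto
  then have pc: "?\<gamma> piecewise_C1_differentiable_on {0..1}" by (simp add: valid_path_def)
  have in_S: "linepath a b x \<in> S" if "x \<in> {0..1}" for x
    using that assms(3) by (metis image_eqI linepath_image_01 subsetD)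
  have "0 \<notin> ?\<gamma> ` {0..1}" using in_S assms(4) by (metis comp_apply imageE)
  from winding_number_exp_integral(2)[OF pc _ this]
  have "exp (- integral {0..1} (\<lambda>x. vector_derivative ?\<gamma> (at x) / ?\<gamma> x)) * f b = f a"
    by (simp add: linepath_0' linepath_1')
  moreover have "integral {0..1} (\<lambda>x. vector_derivative ?\<gamma> (at x) / ?\<gamma> x)
      = integral {0..1} (\<lambda>x. deriv f (linepath a b x) / f (linepath a b x) * vector_derivative (linepath a b) (at x))"
  proof (rule integral_cong)
    fix x :: real assume x: "x \<in> {0..1}"
    have "vector_derivative ?\<gamma> (at x) = vector_derivative (linepath a b) (at x) * deriv f (linepath a b x)"
      using holomorphic_on_imp_differentiable_at[OF assms(2,1) in_S[OF x]]
      by (intro vector_derivative_chain_at_general) auto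
    then show "vector_derivative ?\<gamma> (at x) / ?\<gamma> x =
        deriv f (linepath a b x) / f (linepath a b x) * vector_derivative (linepath a b) (at x)" by simp
  qed
  ultimately have "exp (- contour_integral (linepath a b) (\<lambda>z. deriv f z / f z)) * f b = f a"
    by (simp add: contour_integral_integral)
  then show ?thesis by (auto simp: exp_minus field_simps)
qed

context
  fixes F :: "complex \<Rightarrow> complex"
  assumes nice: "F nicely_meromorphic_on UNIV" and nonconst: "\<not> F constant_on UNIV"
begin

lemma nice_meromorphic: "F meromorphic_on A"
  using nice meromorphic_on_subset unfolding nicely_meromorphic_on_def by blast

lemma nice_avoids: "\<forall>\<^sub>\<approx>x\<in>UNIV. F x \<noteq> c"
  using nicely_meromorphic_imp_constant_or_avoid[OF nice, of c] nonconst by (auto simp: constant_on_def)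

lemma nice_eventually_neq: "eventually (\<lambda>x. F x \<noteq> c) (at z)"
  using nice_avoids by (simp add: eventually_cosparse_open_eq)

lemma nice_zeros_sparse: "{z. F z = 0} sparse_in UNIV"
  using nice_avoids[of 0] by (simp add: eventually_cosparse)

lemma nice_zeros_countable: "countable {z. F z = 0}"
  using sparse_imp_countable[OF _ nice_zeros_sparse] by simp

lemma nice_zeros_finite: "compact K \<Longrightarrow> finite (K \<inter> {z. F z = 0})"
  using sparse_in_compact_finite[OF sparse_in_subset[OF nice_zeros_sparse]] by blast

lemma nice_pole_zero: "is_pole F z \<Longrightarrow> F z = 0"
  using is_pole_zero_at_nicely_mero[OF nice] by simp

lemma nice_analytic: "\<not> is_pole F z \<Longrightarrow> F analytic_on {z}"
  using nicely_meromorphic_on_imp_analytic_at[OF nice] by simp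

lemma nice_nonzero_open: "open {z. F z \<noteq> 0}" and nice_nonzero_holomorphic: "F holomorphic_on {z. F z \<noteq> 0}"
proof -
  have ana: "F analytic_on {z. F z \<noteq> 0}"
    using nice_analytic nice_pole_zero by (subst analytic_on_analytic_at) auto
  then show "F holomorphic_on {z. F z \<noteq> 0}" by (rule analytic_imp_holomorphic)
  show "open {z. F z \<noteq> 0}"
  proof (subst open_subopen, safe)
    fix z assume "F z \<noteq> 0"
    then have "F analytic_on {z}" using nice_analytic nice_pole_zero by auto
    then have "F \<midarrow>z\<rightarrow> F z" using analytic_at_imp_isCont isContD by blast
    then have "eventually (\<lambda>x. F x \<noteq> 0) (at z)"
      using \<open>F z \<noteq> 0\<close> by (rule tendsto_imp_eventually_ne)
    then have "eventually (\<lambda>x. F x \<noteq> 0) (nhds z)"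
      using \<open>F z \<noteq> 0\<close> by (simp add: eventually_nhds_conv_at)
    then show "\<exists>T. open T \<and> z \<in> T \<and> T \<subseteq> {z. F z \<noteq> 0}"
      by (auto simp: eventually_nhds)
  qed
qed

end

text \<open>Zeros and poles are countably many, so almost every parallelogram avoids all of them on
  the lines through its edges and all their translates.\<close>

lemma generic_base_point:
  assumes \<tau>: "Im \<tau> > 0" and "countable S"
  shows "\<exists>z0. \<forall>z\<in>S. coord_x \<tau> (z - z0) \<notin> \<int> \<and> coord_y \<tau> (z - z0) \<notin> \<int>"
proof -
  have "countable ((\<lambda>(z, k). coord_x \<tau> z - of_int k) ` (S \<times> (UNIV :: int set)))"
    "countable ((\<lambda>(z, k). coord_y \<tau> z - of_int k) ` (S \<times> (UNIV :: int set)))"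
    using assms(2) by auto
  then obtain x y where x: "x \<notin> (\<lambda>(z, k). coord_x \<tau> z - of_int k) ` (S \<times> (UNIV :: int set))"
     and y: "y \<notin> (\<lambda>(z, k). coord_y \<tau> z - of_int k) ` (S \<times> (UNIV :: int set))"
    by (metis UNIV_eq_I uncountable_UNIV_real)
  have "coord_x \<tau> (z - (of_real x + of_real y * \<tau>)) \<notin> \<int> \<and> coord_y \<tau> (z - (of_real x + of_real y * \<tau>)) \<notin> \<int>"
    if "z \<in> S" for z
  proof -
    have "coord_x \<tau> z - x \<notin> \<int>"
    proof
      assume "coord_x \<tau> z - x \<in> \<int>"
      then obtain k where "coord_x \<tau> z - x = of_int k" by (auto elim: Ints_cases)
      then have "x = coord_x \<tau> z - of_int k" by simp
      then show False using x that by (auto intro!: image_eqI[of _ _ "(z, k)"])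
    qed
    moreover have "coord_y \<tau> z - y \<notin> \<int>"
    proof
      assume "coord_y \<tau> z - y \<in> \<int>"
      then obtain k where "coord_y \<tau> z - y = of_int k" by (auto elim: Ints_cases)
      then have "y = coord_y \<tau> z - of_int k" by simp
      then show False using y that by (auto intro!: image_eqI[of _ _ "(z, k)"])
    qed
    ultimately show ?thesis by (simp add: coord_diff coord_combination[OF \<tau>])
  qed
  then show ?thesis by blast
qed

definition open_cell :: "complex \<Rightarrow> complex \<Rightarrow> complex set" where
  "open_cell \<tau> z0 = {z. coord_x \<tau> (z - z0) \<in> {0<..<1} \<and> coord_y \<tau> (z - z0) \<in> {0<..<1}}"

lemma deriv_multiplicative_period:
  assumes "\<And>z. F (z + w) = c * F z" "F analytic_on {z}"
  shows "deriv F (z + w) = c * deriv F z"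
proof -
  have "(F has_field_derivative deriv F z) (at z)"
    using assms(2) analytic_on_imp_differentiable_at DERIV_deriv_iff_field_differentiable by blast
  then have "((\<lambda>x. F (x + w)) has_field_derivative c * deriv F z) (at z)"
    unfolding assms(1) by (rule DERIV_cmult)
  then show ?thesis by (simp add: DERIV_shift DERIV_imp_deriv)
qed

text \<open>For a function with constant multipliers the logarithmic derivative is elliptic, and the
  integrals over opposite edges of the parallelogram nearly cancel. With weight \<open>1\<close> they cancel
  completely: there are as many zeros as poles. With weight \<open>z\<close> what remains are the logarithms \<open>I\<close>
  and \<open>J\<close> of the multipliers, which is Abel's relation. Both cases are needed, hence the weight
  \<open>c + d z\<close>. A nicely meromorphic function vanishes at its poles, so the sum runs over zeros and
  poles alike.\<close>

lemma argument_principle_parallelogram: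
  assumes \<tau>: "Im \<tau> > 0"
    and nice: "F nicely_meromorphic_on UNIV" and nonconst: "\<not> F constant_on UNIV"
    and per1: "\<And>z. F (z + 1) = \<alpha> * F z" and per\<tau>: "\<And>z. F (z + \<tau>) = \<beta> * F z"
    and z0: "\<And>z. F z = 0 \<Longrightarrow> coord_x \<tau> (z - z0) \<notin> \<int> \<and> coord_y \<tau> (z - z0) \<notin> \<int>"
  obtains I J where "finite ({p. F p = 0} \<inter> open_cell \<tau> z0)" "exp I = \<alpha>" "exp J = \<beta>"
    "\<And>c d. d * J - d * \<tau> * I = 2 * pi * \<i> * (\<Sum>p\<in>{p. F p = 0} \<inter> open_cell \<tau> z0. (c + d * p) * zorder F p)"
proof -
  let ?P = "parallelogram_path z0 \<tau>"
  let ?Z = "{p. F p = 0} \<inter> open_cell \<tau> z0"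
  define U where "U = {z. F z \<noteq> 0}"
  have U: "open U" "F holomorphic_on U"
    using nice_nonzero_open[OF nice nonconst] nice_nonzero_holomorphic[OF nice nonconst] by (auto simp: U_def)
  define g where "g z = deriv F z / F z" for z
  have g_hol: "g holomorphic_on U"
    unfolding g_def[abs_def] using U by (intro holomorphic_intros holomorphic_deriv) (auto simp: U_def)
  have g_per: "g (z + 1) = g z" "g (z + \<tau>) = g z" if "z \<in> U" "z + 1 \<in> U" "z + \<tau> \<in> U" for z
  proof -
    have "F analytic_on {z}"
      using that nice_analytic[OF nice nonconst] nice_pole_zero[OF nice nonconst] by (auto simp: U_def)
    then show "g (z + 1) = g z" "g (z + \<tau>) = g z"
      using that deriv_multiplicative_period[of F 1 \<alpha> z, OF per1] deriv_multiplicative_period[of F \<tau> \<beta> z, OF per\<tau>]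
      by (auto simp: g_def per1 per\<tau> U_def)
  qed
  have \<alpha>\<beta>: "\<alpha> \<noteq> 0" "\<beta> \<noteq> 0"
  proof -
    obtain z where "F z \<noteq> 0" using nonconst by (auto simp: constant_on_def)
    then show "\<alpha> \<noteq> 0" "\<beta> \<noteq> 0" using per1[of "z - 1"] per\<tau>[of "z - \<tau>"] by auto
  qed
  have U_shift: "z + 1 \<in> U \<longleftrightarrow> z \<in> U" "z + \<tau> \<in> U \<longleftrightarrow> z \<in> U" for z
    using \<alpha>\<beta> by (auto simp: U_def per1 per\<tau>)
  have "path_image ?P \<subseteq> U"
    using edge_coord(1)[OF \<tau>] z0 by (fastforce simp: U_def)
  then have seg: "closed_segment z0 (z0 + 1) \<subseteq> U" "closed_segment (z0 + 1) (z0 + 1 + \<tau>) \<subseteq> U"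
     "closed_segment (z0 + 1 + \<tau>) (z0 + \<tau>) \<subseteq> U" "closed_segment (z0 + \<tau>) z0 \<subseteq> U"
    using path_image_parallelogram[OF \<tau>, of z0] by auto
  have segL: "closed_segment z0 (z0 + \<tau>) \<subseteq> U"
    by (subst closed_segment_commute) (rule seg(4))
  define I where "I = contour_integral (linepath z0 (z0 + 1)) g"
  define J where "J = contour_integral (linepath z0 (z0 + \<tau>)) g"
  have "F z0 \<noteq> 0" using seg(1) by (auto simp: U_def)
  have "exp I = \<alpha>"
    using exp_contour_integral_logderiv[OF U seg(1)] \<open>F z0 \<noteq> 0\<close> per1[of z0]
    by (simp add: I_def g_def[abs_def] U_def)
  moreover have "exp J = \<beta>"
    using exp_contour_integral_logderiv[OF U segL] \<open>F z0 \<noteq> 0\<close> per\<tau>[of z0]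
    by (simp add: J_def g_def[abs_def] U_def)
  moreover have fin: "finite ?Z"
  proof -
    have "open_cell \<tau> z0 \<subseteq> cball z0 (1 + norm \<tau>)"
    proof
      fix z assume "z \<in> open_cell \<tau> z0"
      then have "z - z0 \<in> fund_domain \<tau>" by (simp add: open_cell_def fund_domain_iff_coord[OF \<tau>])
      then show "z \<in> cball z0 (1 + norm \<tau>)" using norm_fund_domain_le by (force simp: dist_norm norm_minus_commute)
    qed
    then have "?Z \<subseteq> cball z0 (1 + norm \<tau>) \<inter> {z. F z = 0}" by auto
    then show ?thesis using nice_zeros_finite[OF nice nonconst compact_cball] finite_subset by blast
  qed
  moreover have "d * J - d * \<tau> * I = 2 * pi * \<i> * (\<Sum>p\<in>?Z. (c + d * p) * zorder F p)" for c d
  proof -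
    define h where "h z = c + d * z" for z
    let ?k = "\<lambda>z. deriv F z * h z / F z"
    have k: "?k = (\<lambda>z. g z * h z)" by (auto simp: g_def)
    have kz: "deriv F z * h z / F z = g z * h z" for z by (simp add: g_def)
    have gh_int: "(\<lambda>z. g z * h' z) contour_integrable_on linepath a b"
      if "closed_segment a b \<subseteq> U" "h' holomorphic_on UNIV" for a b h'
      using that g_hol
      by (intro contour_integrable_continuous_linepath continuous_on_mult holomorphic_on_imp_continuous_on)
         (auto intro: holomorphic_on_subset)
    have h_hol: "h holomorphic_on A" "(\<lambda>z. h (z + w)) holomorphic_on A" for A w
      by (auto simp: h_def[abs_def] intro!: holomorphic_intros)
    have rev: "contour_integral (linepath a b) ?k = - contour_integral (linepath b a) ?k" if "closed_segment a b \<subseteq> U" for a b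
      unfolding k using that g_hol h_hol
      by (intro contour_integral_reverse_linepath continuous_on_mult holomorphic_on_imp_continuous_on)
         (auto intro: holomorphic_on_subset)
    have trans: "contour_integral (linepath (a + w) (b + w)) f = contour_integral (linepath a b) (\<lambda>z. f (z + w))"
      for a b w and f :: "complex \<Rightarrow> complex"
    proof -
      have "(+) w \<circ> linepath a b = linepath (a + w) (b + w)"
        by (auto simp: linepath_def algebra_simps fun_eq_iff)
      then show ?thesis using contour_integral_translate[of w "linepath a b" f] by simp
    qed
    have top: "contour_integral (linepath (z0 + 1 + \<tau>) (z0 + \<tau>)) ?k
        = - contour_integral (linepath z0 (z0 + 1)) (\<lambda>z. g z * h (z + \<tau>))"
    proof -
      have "contour_integral (linepath (z0 + 1 + \<tau>) (z0 + \<tau>)) ?k = - contour_integral (linepath (z0 + \<tau>) (z0 + 1 + \<tau>)) ?k"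
        by (rule rev[OF seg(3)])
      also have "contour_integral (linepath (z0 + \<tau>) (z0 + 1 + \<tau>)) ?k
          = contour_integral (linepath z0 (z0 + 1)) (\<lambda>z. ?k (z + \<tau>))" by (rule trans)
      also have "\<dots> = contour_integral (linepath z0 (z0 + 1)) (\<lambda>z. g z * h (z + \<tau>))"
        unfolding kz using seg(1) g_per U_shift by (intro contour_integral_eq) auto
      finally show ?thesis .
    qed
    have right: "contour_integral (linepath (z0 + 1) (z0 + 1 + \<tau>)) ?k
        = contour_integral (linepath z0 (z0 + \<tau>)) (\<lambda>z. g z * h (z + 1))"
    proof -
      have "contour_integral (linepath (z0 + 1) (z0 + 1 + \<tau>)) ?k
          = contour_integral (linepath z0 (z0 + \<tau>)) (\<lambda>z. ?k (z + 1))"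
        using trans[of z0 1 "z0 + \<tau>" ?k] by (simp add: add_ac)
      also have "\<dots> = contour_integral (linepath z0 (z0 + \<tau>)) (\<lambda>z. g z * h (z + 1))"
        unfolding kz using segL g_per U_shift by (intro contour_integral_eq) auto
      finally show ?thesis .
    qed
    have left: "contour_integral (linepath (z0 + \<tau>) z0) ?k = - contour_integral (linepath z0 (z0 + \<tau>)) ?k"
      by (rule rev[OF seg(4)])
    have k_int: "?k contour_integrable_on linepath a b" if "closed_segment a b \<subseteq> U" for a b
      unfolding k using gh_int[OF that h_hol(1)] .
    have "contour_integral ?P ?k = contour_integral (linepath z0 (z0 + 1)) ?k
       + (contour_integral (linepath (z0 + 1) (z0 + 1 + \<tau>)) ?k
       + (contour_integral (linepath (z0 + 1 + \<tau>) (z0 + \<tau>)) ?k + contour_integral (linepath (z0 + \<tau>) z0) ?k))"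
      unfolding parallelogram_path_def
      using k_int[OF seg(1)] k_int[OF seg(2)] k_int[OF seg(3)] k_int[OF seg(4)]
      by (simp add: contour_integrable_join valid_path_join)
    also have "\<dots> = (contour_integral (linepath z0 (z0 + 1)) ?k - contour_integral (linepath z0 (z0 + 1)) (\<lambda>z. g z * h (z + \<tau>)))
       + (contour_integral (linepath z0 (z0 + \<tau>)) (\<lambda>z. g z * h (z + 1)) - contour_integral (linepath z0 (z0 + \<tau>)) ?k)"
      unfolding top right left by simp
    also have "contour_integral (linepath z0 (z0 + 1)) ?k - contour_integral (linepath z0 (z0 + 1)) (\<lambda>z. g z * h (z + \<tau>))
       = contour_integral (linepath z0 (z0 + 1)) (\<lambda>z. ?k z - g z * h (z + \<tau>))"
      by (rule contour_integral_diff[symmetric]) (use k_int[OF seg(1)] gh_int[OF seg(1) h_hol(2)] in auto)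
    also have "(\<lambda>z. ?k z - g z * h (z + \<tau>)) = (\<lambda>z. (- d * \<tau>) * g z)"
      unfolding kz by (auto simp: h_def algebra_simps)
    also have "contour_integral (linepath z0 (z0 + 1)) (\<lambda>z. (- d * \<tau>) * g z) = (- d * \<tau>) * I"
      unfolding I_def using gh_int[OF seg(1), of "\<lambda>_. 1"] by (intro contour_integral_lmul) simp
    also have "contour_integral (linepath z0 (z0 + \<tau>)) (\<lambda>z. g z * h (z + 1)) - contour_integral (linepath z0 (z0 + \<tau>)) ?k
       = contour_integral (linepath z0 (z0 + \<tau>)) (\<lambda>z. g z * h (z + 1) - ?k z)"
      by (rule contour_integral_diff[symmetric]) (use k_int[OF segL] gh_int[OF segL h_hol(2)] in auto)
    also have "(\<lambda>z. g z * h (z + 1) - ?k z) = (\<lambda>z. d * g z)"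
      unfolding kz by (auto simp: h_def algebra_simps)
    also have "contour_integral (linepath z0 (z0 + \<tau>)) (\<lambda>z. d * g z) = d * J"
      unfolding J_def using gh_int[OF segL, of "\<lambda>_. 1"] by (intro contour_integral_lmul) simp
    finally have lhs: "contour_integral ?P ?k = d * J - d * \<tau> * I" by (simp add: algebra_simps)
    define S where "S = ball z0 (2 + norm \<tau>)"
    define pz where "pz = {w \<in> S. F w = 0 \<or> w \<in> {p. is_pole F p}}"
    have closed_cell: "z \<in> S" if "coord_x \<tau> (z - z0) \<in> {0..1} \<and> coord_y \<tau> (z - z0) \<in> {0..1}" for z
    proof -
      have "z - z0 = of_real (coord_x \<tau> (z - z0)) + of_real (coord_y \<tau> (z - z0)) * \<tau>"
        by (rule coord_decomposition[OF \<tau>])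
      then have "norm (z - z0) \<le> norm (of_real (coord_x \<tau> (z - z0)) :: complex) + norm (of_real (coord_y \<tau> (z - z0)) * \<tau>)"
        by (metis norm_triangle_ineq)
      also have "\<dots> \<le> 1 + 1 * norm \<tau>"
        using that unfolding norm_mult by (intro add_mono mult_right_mono) auto
      finally show ?thesis by (simp add: S_def dist_norm norm_minus_commute)
    qed
    have pz_eq: "pz = {w \<in> S. F w = 0}" using nice_pole_zero[OF nice nonconst] by (auto simp: pz_def)
    have "contour_integral ?P ?k = 2 * pi * \<i> * (\<Sum>p\<in>pz. winding_number ?P p * h p * zorder F p)"
      unfolding pz_def
    proof (rule argument_principle)
      show "F holomorphic_on S - {p. is_pole F p}"
        using nice_analytic[OF nice nonconst]
        by (intro analytic_imp_holomorphic, subst analytic_on_analytic_at) auto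
      show "h holomorphic_on S" by (rule h_hol)
      show "path_image ?P \<subseteq> S - {w \<in> S. F w = 0 \<or> w \<in> {p. is_pole F p}}"
        using \<open>path_image ?P \<subseteq> U\<close> edge_coord(2)[OF \<tau>] closed_cell nice_pole_zero[OF nice nonconst] by (auto simp: U_def)
      show "\<forall>z. z \<notin> S \<longrightarrow> winding_number ?P z = 0"
        using winding_number_parallelogram_outside[OF \<tau>] closed_cell by blast
      have "pz \<subseteq> cball z0 (2 + norm \<tau>) \<inter> {z. F z = 0}" by (auto simp: pz_eq S_def)
      then show "finite {w \<in> S. F w = 0 \<or> w \<in> {p. is_pole F p}}"
        unfolding pz_def[symmetric] using nice_zeros_finite[OF nice nonconst compact_cball] finite_subset by blast
    qed (use valid_parallelogram[OF \<tau>, of z0] in \<open>auto simp: S_def\<close>)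
    also have "(\<Sum>p\<in>pz. winding_number ?P p * h p * zorder F p) = (\<Sum>p\<in>?Z. h p * zorder F p)"
    proof (rule sum.mono_neutral_cong_right)
      have "pz \<subseteq> cball z0 (2 + norm \<tau>) \<inter> {z. F z = 0}" by (auto simp: pz_eq S_def)
      then show "finite pz" using nice_zeros_finite[OF nice nonconst compact_cball] finite_subset by blast
      show "?Z \<subseteq> pz" using closed_cell by (force simp: pz_eq open_cell_def)
      show "\<forall>p\<in>pz - ?Z. winding_number ?P p * h p * zorder F p = 0"
      proof
        fix p assume p: "p \<in> pz - ?Z"
        then have ni: "coord_x \<tau> (p - z0) \<notin> \<int>" "coord_y \<tau> (p - z0) \<notin> \<int>" using z0 by (auto simp: pz_eq)
        have "coord_x \<tau> (p - z0) \<noteq> 0" "coord_x \<tau> (p - z0) \<noteq> 1" "coord_y \<tau> (p - z0) \<noteq> 0" "coord_y \<tau> (p - z0) \<noteq> 1"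
          using ni by (metis Ints_0 Ints_1)+
        then have "\<not> (coord_x \<tau> (p - z0) \<in> {0..1} \<and> coord_y \<tau> (p - z0) \<in> {0..1})"
          using p by (auto simp: pz_eq open_cell_def)
        then show "winding_number ?P p * h p * zorder F p = 0"
          using winding_number_parallelogram_outside[OF \<tau>] by simp
      qed
      show "\<And>p. p \<in> ?Z \<Longrightarrow> winding_number ?P p * h p * zorder F p = h p * zorder F p"
        using winding_number_parallelogram_inside[OF \<tau>] by (auto simp: open_cell_def)
    qed
    finally show ?thesis using lhs by (simp add: h_def)
  qed
  ultimately show ?thesis using that by blast
qed

section \<open>Zeros and poles of developing maps\<close>

text \<open>Requiring the formula only where \<open>f\<close> does not vanish, hence away from its zeros and its poles,
  makes the notion symmetric under \<open>f \<mapsto> 1/f\<close>, \<open>\<beta> \<mapsto> -\<beta>\<close>. Statements about poles then reduce to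
  statements about zeros.\<close>

definition developing :: "(complex \<Rightarrow> complex) \<Rightarrow> (real \<Rightarrow> complex \<Rightarrow> real) \<Rightarrow> bool" where
  "developing f u \<longleftrightarrow> f nicely_meromorphic_on UNIV \<and> \<not> f constant_on UNIV \<and>
     (\<forall>\<beta> z. f z \<noteq> 0 \<and> deriv f z \<noteq> 0 \<longrightarrow>
        u \<beta> z = ln (8 * exp (2 * \<beta>) * (norm (deriv f z))\<^sup>2 / (1 + exp (2 * \<beta>) * (norm (f z))\<^sup>2)\<^sup>2))"

lemma solution_family_developing:
  assumes "solution_family \<tau> a f u"
  shows "developing f u"
  using assms nice_pole_zero[of f] unfolding solution_family_def developing_def by blast

text \<open>The density \<open>8 e\<^sup>2\<^sup>\<beta> |f'|\<^sup>2 / (1 + e\<^sup>2\<^sup>\<beta> |f|\<^sup>2)\<^sup>2\<close> is unchanged when \<open>f\<close> and \<open>\<beta>\<close> are replaced by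
  \<open>1/f\<close> and \<open>-\<beta>\<close>.\<close>

lemma developing_inverse:
  assumes "developing f u"
  shows "developing (\<lambda>z. inverse (f z)) (\<lambda>\<beta>. u (- \<beta>))"
  unfolding developing_def
proof (intro conjI allI impI)
  have nice: "f nicely_meromorphic_on UNIV" and nonconst: "\<not> f constant_on UNIV"
    using assms by (auto simp: developing_def)
  show "(\<lambda>z. inverse (f z)) nicely_meromorphic_on UNIV"
    by (rule nicely_meromorphic_on_inverse[OF nice])
  show "\<not> (\<lambda>z. inverse (f z)) constant_on UNIV"
    using nonconst unfolding constant_on_def by (metis inverse_inverse_eq)
  fix \<beta> :: real and z assume z: "inverse (f z) \<noteq> 0 \<and> deriv (\<lambda>z. inverse (f z)) z \<noteq> 0"
  then have "f z \<noteq> 0" by auto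
  then have "f analytic_on {z}" using nice_analytic[OF nice nonconst] nice_pole_zero[OF nice nonconst] by blast
  then have "(f has_field_derivative deriv f z) (at z)"
    using analytic_on_imp_differentiable_at DERIV_deriv_iff_field_differentiable by blast
  then have D: "deriv (\<lambda>z. inverse (f z)) z = - (inverse (f z) * deriv f z * inverse (f z))"
    using \<open>f z \<noteq> 0\<close> by (intro DERIV_imp_deriv DERIV_inverse')
  then have "deriv f z \<noteq> 0" using z by auto
  define X where "X = norm (f z)"
  define d where "d = norm (deriv f z)"
  define E :: real where "E = exp (2 * \<beta>)"
  have "X > 0" "E > 0" using \<open>f z \<noteq> 0\<close> by (auto simp: X_def E_def)
  have "u (- \<beta>) z = ln (8 * (1 / E) * d\<^sup>2 / (1 + (1 / E) * X\<^sup>2)\<^sup>2)"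
    using assms \<open>f z \<noteq> 0\<close> \<open>deriv f z \<noteq> 0\<close>
    unfolding developing_def X_def d_def E_def by (simp add: exp_minus inverse_eq_divide)
  also have "8 * (1 / E) * d\<^sup>2 / (1 + (1 / E) * X\<^sup>2)\<^sup>2 = 8 * E * (d / X\<^sup>2)\<^sup>2 / (1 + E * (1 / X)\<^sup>2)\<^sup>2"
  proof -
    have "1 + (1 / E) * X\<^sup>2 = (E + X\<^sup>2) / E" "1 + E * (1 / X)\<^sup>2 = (E + X\<^sup>2) / X\<^sup>2"
      using \<open>X > 0\<close> \<open>E > 0\<close> by (simp_all add: field_simps)
    moreover have "8 * (1 / E) * d\<^sup>2 / (Y / E)\<^sup>2 = 8 * E * (d / X\<^sup>2)\<^sup>2 / (Y / X\<^sup>2)\<^sup>2" if "Y > 0" for Y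
      using that \<open>X > 0\<close> \<open>E > 0\<close> by (simp add: field_simps power2_eq_square)
    moreover have "E + X\<^sup>2 > 0" using \<open>E > 0\<close> by (simp add: add_pos_nonneg)
    ultimately show ?thesis by presburger
  qed
  also have "d / X\<^sup>2 = norm (deriv (\<lambda>z. inverse (f z)) z)"
    unfolding D by (simp add: X_def d_def norm_mult norm_inverse power2_eq_square divide_inverse)
  also have "1 / X = norm (inverse (f z))" by (simp add: X_def norm_inverse divide_inverse)
  finally show "u (- \<beta>) z = ln (8 * exp (2 * \<beta>) * (norm (deriv (\<lambda>z. inverse (f z)) z))\<^sup>2 /
      (1 + exp (2 * \<beta>) * (norm (inverse (f z)))\<^sup>2)\<^sup>2)"
    by (simp add: E_def)
qed

context
  fixes f :: "complex \<Rightarrow> complex" and u :: "real \<Rightarrow> complex \<Rightarrow> real"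
  assumes dev: "developing f u"
begin

lemma developing_nice: "f nicely_meromorphic_on UNIV" "\<not> f constant_on UNIV"
  using dev by (auto simp: developing_def)

lemma developing_formula:
  "f z \<noteq> 0 \<Longrightarrow> deriv f z \<noteq> 0 \<Longrightarrow>
    u \<beta> z = ln (8 * exp (2 * \<beta>) * (norm (deriv f z))\<^sup>2 / (1 + exp (2 * \<beta>) * (norm (f z))\<^sup>2)\<^sup>2)"
  using dev by (auto simp: developing_def)

lemma developing_deriv_factor:
  assumes "\<not> is_pole f p"
  obtains r q m where "r > 0" "f holomorphic_on ball p r" "q holomorphic_on ball p r"
    "zorder (deriv f) p = int m"
    "\<And>z. z \<in> ball p r \<Longrightarrow> q z \<noteq> 0 \<and> deriv f z = q z * (z - p) ^ m"
proof -
  obtain r0 where r0: "r0 > 0" "f holomorphic_on ball p r0"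
    using nice_analytic[OF developing_nice assms] by (auto simp: analytic_on_def)
  have hol: "deriv f holomorphic_on ball p r0" using r0 by (intro holomorphic_deriv) auto
  have "\<exists>w\<in>ball p r0. deriv f w \<noteq> 0"
  proof (rule ccontr)
    assume "\<not> (\<exists>w\<in>ball p r0. deriv f w \<noteq> 0)"
    then have "(f has_field_derivative 0) (at w)" if "w \<in> ball p r0" for w
      using that r0(2) by (metis holomorphic_derivI open_ball)
    then have "f constant_on ball p r0"
      by (intro has_field_derivative_0_imp_constant_on) auto
    then obtain c where "\<And>w. w \<in> ball p r0 \<Longrightarrow> f w = c" by (auto simp: constant_on_def)
    then have "eventually (\<lambda>w. f w = c) (at p)"
      using r0(1) by (auto simp: eventually_at dist_commute intro!: exI[of _ r0])
    moreover have "eventually (\<lambda>w. f w \<noteq> c) (at p)" by (rule nice_eventually_neq[OF developing_nice])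
    ultimately have "eventually (\<lambda>w. False) (at p)" by eventually_elim auto
    then show False by simp
  qed
  note factor = zorder_exist_zero[OF hol open_ball connected_ball centre_in_ball[THEN iffD2, OF r0(1)] this]
  have "zorder (deriv f) p \<ge> 0"
    using factor[THEN conjunct1] by (cases "deriv f p = 0") simp_all
  obtain r where r: "r > 0" "cball p r \<subseteq> ball p r0"
    "zor_poly (deriv f) p holomorphic_on cball p r"
    "\<forall>w\<in>cball p r. deriv f w = zor_poly (deriv f) p w * (w - p) ^ nat (zorder (deriv f) p) \<and> zor_poly (deriv f) p w \<noteq> 0"
    using factor[THEN conjunct2] by (elim exE conjE)
  have "ball p r \<subseteq> ball p r0" using r(2) ball_subset_cball by blast
  then have "f holomorphic_on ball p r" by (rule holomorphic_on_subset[OF r0(2)])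
  show ?thesis
    by (rule that[of r "zor_poly (deriv f) p" "nat (zorder (deriv f) p)"])
       (use r \<open>zorder (deriv f) p \<ge> 0\<close> \<open>f holomorphic_on ball p r\<close> in
         \<open>auto intro: holomorphic_on_subset[OF r(3)]\<close>)
qed

lemma deriv_eventually_nonzero:
  "eventually (\<lambda>z. deriv f z \<noteq> 0) (at p)"
proof (cases "is_pole f p")
  case True
  then have "is_pole (deriv f) p"
    using is_pole_deriv_iff[OF nice_meromorphic[OF developing_nice]] by blast
  then show ?thesis by (rule non_zero_neighbour_pole)
next
  case False
  then obtain r q m where "r > 0" "\<And>z. z \<in> ball p r \<Longrightarrow> q z \<noteq> 0 \<and> deriv f z = q z * (z - p) ^ m"
    using developing_deriv_factor by metis
  then show ?thesis by (auto simp: eventually_at dist_commute intro!: exI[of _ r])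
qed

text \<open>If \<open>f'\<close> vanishes to order \<open>m\<close> at \<open>p\<close>, then \<open>u\<close> is \<open>2m ln |z - p|\<close> plus a continuous function, so
  the equation dictates \<open>m\<close>.\<close>

lemma zorder_deriv_eq_singular_weight:
  assumes \<tau>: "Im \<tau> > 0" and u: "\<And>\<beta>. solution \<tau> a (u \<beta>)"
    and a: "a \<notin> lattice \<tau>" "2 * a \<notin> lattice \<tau>" and "\<not> is_pole f p"
  shows "zorder (deriv f) p = int (singular_weight \<tau> a p)"
proof -
  obtain r q m where r: "r > 0" "f holomorphic_on ball p r" "q holomorphic_on ball p r"
    and m: "zorder (deriv f) p = int m"
    and fac: "\<And>z. z \<in> ball p r \<Longrightarrow> q z \<noteq> 0 \<and> deriv f z = q z * (z - p) ^ m"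
    using developing_deriv_factor[OF \<open>\<not> is_pole f p\<close>] by metis
  define v where "v z = ln (8 * (norm (q z))\<^sup>2 / (1 + (norm (f z))\<^sup>2)\<^sup>2)" for z
  have pos: "1 + (norm (f z))\<^sup>2 \<noteq> 0" for z
    by (metis add_pos_nonneg less_numeral_extra(3) zero_le_power2 zero_less_one)
  have "isCont q p" "isCont f p"
    using holomorphic_on_imp_continuous_on[OF r(3)] holomorphic_on_imp_continuous_on[OF r(2)] r(1)
    by (simp_all add: continuous_on_eq_continuous_at)
  then have "isCont v p"
    unfolding v_def[abs_def] using fac[of p] r(1) pos[of p] by (intro continuous_intros) auto
  then have lim: "(v \<longlongrightarrow> v p) (at p)" by (simp add: isCont_def)
  have "eventually (\<lambda>z. z \<in> ball p r - {p}) (at p)" using r(1) by (intro eventually_at_in_open) auto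
  moreover have "eventually (\<lambda>z. f z \<noteq> 0) (at p)" by (rule nice_eventually_neq[OF developing_nice])
  ultimately have "eventually (\<lambda>z. u 0 z = 2 * real m * ln (dist p z) + v z) (at p)"
  proof eventually_elim
    case (elim z)
    then have z: "z \<noteq> p" "q z \<noteq> 0" "deriv f z = q z * (z - p) ^ m" using fac by auto
    then have dist: "dist p z > 0" "norm (z - p) = dist p z" by (auto simp: dist_norm norm_minus_commute)
    have "u 0 z = ln (8 * (norm (deriv f z))\<^sup>2 / (1 + (norm (f z))\<^sup>2)\<^sup>2)"
      using developing_formula[of z 0] elim z by simp
    also have "8 * (norm (deriv f z))\<^sup>2 / (1 + (norm (f z))\<^sup>2)\<^sup>2 =
        (dist p z) ^ (2 * m) * (8 * (norm (q z))\<^sup>2 / (1 + (norm (f z))\<^sup>2)\<^sup>2)"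
      by (simp add: z(3) norm_mult norm_power dist(2) power_mult_distrib power_mult mult.commute[of 2 m] flip: power_mult)
    also have "ln \<dots> = ln ((dist p z) ^ (2 * m)) + v z"
      unfolding v_def using dist(1) z(2) pos[of z] by (subst ln_mult) auto
    also have "ln ((dist p z) ^ (2 * m)) = 2 * real m * ln (dist p z)"
      using dist(1) by (simp add: ln_realpow)
    finally show ?case .
  qed
  then have "m = singular_weight \<tau> a p"
    by (rule solution_local_order[OF \<tau> u a lim])
  then show ?thesis using m by simp
qed

lemma zero_or_pole_zorder:
  assumes "f p = 0"
  shows "is_pole f p \<or> isolated_zero f p" "zorder f p \<noteq> 0"
proof -
  show *: "is_pole f p \<or> isolated_zero f p"
    using zero_or_pole[OF developing_nice(1) _ assms nice_eventually_neq[OF developing_nice]] by auto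
  have mero: "f meromorphic_on {p}" by (rule nice_meromorphic[OF developing_nice])
  then show "zorder f p \<noteq> 0"
    using * zorder_isolated_zero_pos'[of f p] isolated_pole_imp_neg_zorder[of f p]
    by (auto simp: meromorphic_at_iff)
qed

lemma zorder_logderiv:
  shows "f p = 0 \<Longrightarrow> zorder (\<lambda>z. deriv f z / f z) p = - 1"
    and "f p \<noteq> 0 \<Longrightarrow> zorder (\<lambda>z. deriv f z / f z) p = zorder (deriv f) p"
    and "f p = 0 \<Longrightarrow> zorder (deriv f) p = zorder f p - 1"
proof -
  have mero: "f meromorphic_on {p}" "deriv f meromorphic_on {p}"
    using nice_meromorphic[OF developing_nice] by (auto intro: meromorphic_intros)
  have freq: "\<exists>\<^sub>F z in at p. f z \<noteq> 0" "\<exists>\<^sub>F z in at p. deriv f z \<noteq> 0"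
    using nice_eventually_neq[OF developing_nice] deriv_eventually_nonzero by (auto intro: eventually_frequently)
  have div: "zorder (\<lambda>z. deriv f z / f z) p = zorder (deriv f) p - zorder f p"
    by (rule zorder_divide[OF mero(2) freq(2) mero(1) freq(1)])
  show 3: "zorder (deriv f) p = zorder f p - 1" if "f p = 0"
    using zorder_deriv_minus_1[of f p] mero(1) freq(1) zero_or_pole_zorder(2)[OF that]
    by (auto simp: meromorphic_at_iff)
  show "zorder (\<lambda>z. deriv f z / f z) p = - 1" if "f p = 0"
    using div 3[OF that] by simp
  show "zorder (\<lambda>z. deriv f z / f z) p = zorder (deriv f) p" if "f p \<noteq> 0"
  proof -
    have "f analytic_on {p}" using that nice_analytic[OF developing_nice] nice_pole_zero[OF developing_nice] by blast
    then have "zorder f p = 0" using that zorder_eq_0_iff freq(1) by blast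
    then show ?thesis using div by simp
  qed
qed

end

lemma singular_weight_self: "a \<notin> lattice \<tau> \<Longrightarrow> Im \<tau> > 0 \<Longrightarrow> singular_weight \<tau> a a = 1"
  by (simp add: singular_weight_def lattice_closed(1))

text \<open>Suppose that \<open>f\<close> does not vanish at \<open>a\<close>, so that \<open>h = 1/f\<close> is holomorphic there. Then \<open>exp u\<close> is
  at most \<open>8 e\<^sup>-\<^sup>2\<^sup>\<beta> |h'|\<^sup>2\<close>, and \<open>h'\<close> has a simple zero at \<open>a\<close>. The logarithm of \<open>|h'|\<^sup>2\<close> cancels
  the singularity of \<open>4\<pi> G(z - a)\<close> exactly, and for \<open>\<beta> \<ge> 0\<close> the sum stays bounded
  near \<open>a\<close>, against the blow-up.\<close>

lemma blow_up_imp_zero: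
  assumes \<tau>: "Im \<tau> > 0" and G: "green_function \<tau> G" and dev: "developing f u"
    and u: "\<And>\<beta>. solution \<tau> a (u \<beta>)" and a: "a \<notin> lattice \<tau>" "2 * a \<notin> lattice \<tau>"
    and blow: "blows_up_at (\<lambda>\<beta> z. u \<beta> z + 4 * pi * G (z - a)) a at_top"
  shows "f a = 0 \<and> \<not> is_pole f a"
proof (rule ccontr)
  assume neg: "\<not> (f a = 0 \<and> \<not> is_pole f a)"
  define h where "h z = inverse (f z)" for z
  define v where "v \<beta> = u (- \<beta>)" for \<beta>
  have devh: "developing h v" using developing_inverse[OF dev] by (simp add: h_def[abs_def] v_def[abs_def])
  have "\<not> is_pole h a"
  proof
    assume "is_pole h a"
    then have zero: "isolated_zero f a" by (simp add: h_def[abs_def] is_pole_inverse_iff)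
    then have "f a = 0"
      using zero_isolated_zero_nicely_meromorphic developing_nice(1)[OF dev] nicely_meromorphic_on_subset by blast
    moreover have "\<not> is_pole f a" using zero pole_is_not_zero by blast
    ultimately show False using neg by simp
  qed
  have "zorder (deriv h) a = 1"
    using zorder_deriv_eq_singular_weight[OF devh \<tau> _ a \<open>\<not> is_pole h a\<close>] u singular_weight_self[OF a(1) \<tau>]
    by (simp add: v_def)
  then obtain r q where r: "r > 0" "q holomorphic_on ball a r"
    and fac: "\<And>z. z \<in> ball a r \<Longrightarrow> q z \<noteq> 0 \<and> deriv h z = q z * (z - a)"
    using developing_deriv_factor[OF devh \<open>\<not> is_pole h a\<close>]
    by (metis of_nat_1_eq_iff power_one_right)
  obtain C \<rho> where "\<rho> > 0" and C: "\<And>z. 0 < norm z \<Longrightarrow> norm z < \<rho> \<Longrightarrow> 2 * pi * G z \<le> C - ln (norm z)"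
    using green_function_upper_bound[OF \<tau> G] by blast
  have "isCont q a"
    using holomorphic_on_imp_continuous_on[OF r(2)] r(1) by (simp add: continuous_on_eq_continuous_at)
  then have "eventually (\<lambda>z. norm (q z) < norm (q a) + 1) (nhds a)"
    by (intro order_tendstoD(2)[of _ "norm (q a)"] tendsto_norm) (auto simp: isCont_def tendsto_at_iff_tendsto_nhds)
  moreover have "eventually (\<lambda>z. z = a \<or> h z \<noteq> 0) (nhds a)"
    using nice_eventually_neq[OF developing_nice[OF devh], of 0 a] by (simp add: eventually_at_filter disj_commute imp_conv_disj)
  ultimately have "eventually (\<lambda>z. norm (q z) < norm (q a) + 1 \<and> (z = a \<or> h z \<noteq> 0)) (nhds a)"
    by eventually_elim auto
  then obtain \<delta> where "\<delta> > 0" and \<delta>: "\<And>z. dist z a < \<delta> \<Longrightarrow> norm (q z) < norm (q a) + 1 \<and> (z = a \<or> h z \<noteq> 0)"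
    by (auto simp: eventually_nhds_metric)
  define U where "U = ball a (Min {r, \<rho>, \<delta>})"
  have U: "open U" "a \<in> U" using \<open>r > 0\<close> \<open>\<rho> > 0\<close> \<open>\<delta> > 0\<close> by (auto simp: U_def)
  define K where "K = ln 8 + 2 * ln (norm (q a) + 1) + 2 * C"
  have bound: "u \<beta> z + 4 * pi * G (z - a) \<le> K" if z: "z \<in> U - {a}" and "\<beta> \<ge> 0" for z \<beta>
  proof -
    have d: "z \<in> ball a r" "norm (z - a) < \<rho>" "dist z a < \<delta>" "z \<noteq> a"
      using z by (auto simp: U_def dist_norm norm_minus_commute)
    have qz: "0 < norm (q z)" "norm (q z) < norm (q a) + 1" "h z \<noteq> 0" "deriv h z = q z * (z - a)" "deriv h z \<noteq> 0"
      using fac[OF d(1)] \<delta>[OF d(3)] d(4) by auto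
    define X where "X = 1 + exp (- 2 * \<beta>) * (norm (h z))\<^sup>2"
    have "X \<ge> 1" by (simp add: X_def)
    then have "X\<^sup>2 \<ge> 1" by (simp add: one_le_power)
    have "u \<beta> z = ln (8 * exp (- 2 * \<beta>) * (norm (deriv h z))\<^sup>2 / X\<^sup>2)"
      using developing_formula[OF devh qz(3,5), of "- \<beta>"] by (simp add: v_def X_def)
    also have "\<dots> \<le> ln (8 * (norm (deriv h z))\<^sup>2)"
    proof (rule ln_mono)
      have "8 * exp (- 2 * \<beta>) * (norm (deriv h z))\<^sup>2 / X\<^sup>2 \<le> 8 * exp (- 2 * \<beta>) * (norm (deriv h z))\<^sup>2 / 1"
        using \<open>X\<^sup>2 \<ge> 1\<close> by (intro divide_left_mono) auto
      also have "\<dots> \<le> 8 * 1 * (norm (deriv h z))\<^sup>2 / 1"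
        using \<open>\<beta> \<ge> 0\<close> by (intro divide_right_mono mult_right_mono mult_left_mono) auto
      finally show "8 * exp (- 2 * \<beta>) * (norm (deriv h z))\<^sup>2 / X\<^sup>2 \<le> 8 * (norm (deriv h z))\<^sup>2" by simp
      show "0 < 8 * exp (- 2 * \<beta>) * (norm (deriv h z))\<^sup>2 / X\<^sup>2"
        using \<open>X \<ge> 1\<close> qz(5) by simp
    qed
    also have "8 * (norm (deriv h z))\<^sup>2 = 8 * ((norm (q z))\<^sup>2 * (norm (z - a))\<^sup>2)"
      by (simp add: qz(4) norm_mult power_mult_distrib)
    also have "ln \<dots> = ln 8 + (2 * ln (norm (q z)) + 2 * ln (norm (z - a)))"
      using qz(1) d(4) by (simp add: ln_mult ln_realpow)
    also have "ln (norm (q z)) \<le> ln (norm (q a) + 1)"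
      using qz by (intro ln_mono) auto
    finally have "u \<beta> z \<le> ln 8 + 2 * ln (norm (q a) + 1) + 2 * ln (norm (z - a))" by simp
    moreover have "2 * pi * G (z - a) \<le> C - ln (norm (z - a))"
      using d by (intro C) auto
    ultimately show ?thesis by (simp add: K_def)
  qed
  have "((\<lambda>\<beta>. SUP z\<in>U - {a}. ereal (u \<beta> z + 4 * pi * G (z - a))) \<longlongrightarrow> \<infinity>) at_top"
    using blow U by (simp add: blows_up_at_def)
  then have "eventually (\<lambda>\<beta>. ereal K < (SUP z\<in>U - {a}. ereal (u \<beta> z + 4 * pi * G (z - a)))) at_top"
    by (rule order_tendstoD(1)) simp
  moreover have "eventually (\<lambda>\<beta>::real. \<beta> \<ge> 0) at_top" by (rule eventually_ge_at_top)
  ultimately have "eventually (\<lambda>\<beta>::real. False) at_top"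
  proof eventually_elim
    case (elim \<beta>)
    have "(SUP z\<in>U - {a}. ereal (u \<beta> z + 4 * pi * G (z - a))) \<le> ereal K"
      using bound elim(2) by (intro SUP_least) auto
    then show ?case using elim(1) by simp
  qed
  then show False by simp
qed

section \<open>Abel's relation and the monodromy\<close>

lemma quasi_period_lattice:
  assumes per1: "\<And>z. f (z + 1) = exp A * f z" and per\<tau>: "\<And>z. f (z + \<tau>) = exp B * f z"
    and "w \<in> lattice \<tau>"
  shows "\<exists>c. c \<noteq> 0 \<and> (\<forall>z. f (z + w) = c * (f z :: complex))"
proof -
  have step: "f (z + of_int m * \<omega>) = exp (of_int m * A) * f z"
    if "\<And>z. f (z + \<omega>) = exp A * f z" for \<omega> A z and m :: int
  proof (induction m arbitrary: z rule: int_induct[where k = 0])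
    case base then show ?case by simp
  next
    case (step1 i)
    have "f (z + of_int (i + 1) * \<omega>) = f ((z + of_int i * \<omega>) + \<omega>)" by (simp add: algebra_simps)
    also have "\<dots> = exp A * (exp (of_int i * A) * f z)" by (simp only: that step1)
    also have "\<dots> = exp (of_int (i + 1) * A) * f z" by (simp add: distrib_right exp_add)
    finally show ?case .
  next
    case (step2 i)
    have "exp A * f (z + of_int (i - 1) * \<omega>) = f (z + of_int i * \<omega>)"
      using that[of "z + of_int (i - 1) * \<omega>"] by (simp add: algebra_simps)
    then have "exp A * f (z + of_int (i - 1) * \<omega>) = exp (of_int i * A) * f z"
      by (simp only: step2)
    also have "\<dots> = exp A * (exp (of_int (i - 1) * A) * f z)"
      by (simp add: left_diff_distrib flip: exp_add mult.assoc)
    finally show ?case by simp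
  qed
  obtain m n :: int where "w = of_int m + of_int n * \<tau>" using \<open>w \<in> lattice \<tau>\<close> by (auto simp: lattice_def)
  then have "f (z + w) = exp (of_int n * B) * (exp (of_int m * A) * f z)" for z
    using step[OF per\<tau>, of "z + of_int m" n] step[OF per1, of z m] by (simp add: add.assoc)
  then show ?thesis by (intro exI[of _ "exp (of_int n * B) * exp (of_int m * A)"]) simp
qed

lemma zorder_quasi_period:
  assumes "\<And>z. f (z + w) = c * f z" "c \<noteq> (0 :: complex)"
  shows "zorder f (p + w) = zorder f p"
proof -
  have "zorder f (p + w) = zorder (\<lambda>u. f (u + (p + w))) 0" by (rule zorder_shift)
  also have "(\<lambda>u. f (u + (p + w))) = (\<lambda>u. c * f (u + p))"
    using assms(1)[of "_ + p"] by (simp add: add.assoc)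
  also have "zorder \<dots> 0 = zorder (\<lambda>u. f (u + p)) 0" by (rule zorder_cmult[OF assms(2)])
  also have "\<dots> = zorder f p" by (rule zorder_shift[symmetric])
  finally show ?thesis .
qed

text \<open>The period has to be proved off the zeros and poles and extended to them: at a pole the value
  of \<open>deriv f\<close> is arbitrary.\<close>

lemma remove_sings_logderiv_period:
  assumes nice: "f nicely_meromorphic_on UNIV" "\<not> f constant_on UNIV"
    and per: "\<And>z. f (z + w) = c * f z" and "c \<noteq> 0"
  defines "g \<equiv> remove_sings (\<lambda>z. deriv f z / f z)"
  shows "g (z + w) = g z"
proof -
  let ?g = "\<lambda>z. deriv f z / f z"
  have "eventually (\<lambda>x. f (x + z) \<noteq> 0) (at 0)"
    using nice_eventually_neq[OF nice, of 0 z] by (subst (asm) eventually_at_to_0)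
  then have "eventually (\<lambda>x. ?g (z + w + x) = ?g (z + x)) (at 0)"
  proof eventually_elim
    case (elim x)
    then have "f analytic_on {x + z}" using nice_analytic[OF nice] nice_pole_zero[OF nice] by blast
    from deriv_multiplicative_period[OF per this] show ?case
      using per[of "x + z"] \<open>c \<noteq> 0\<close> by (simp add: add_ac)
  qed
  then have "remove_sings (\<lambda>x. ?g (z + w + x)) 0 = remove_sings (\<lambda>x. ?g (z + x)) 0"
    by (rule remove_sings_cong) simp
  then show ?thesis
    unfolding g_def remove_sings_shift_0[of ?g "z + w"] remove_sings_shift_0[of ?g z] .
qed

lemma open_cell_representative:
  assumes \<tau>: "Im \<tau> > 0" and gen: "\<And>w. w \<in> lattice \<tau> \<Longrightarrow> coord_x \<tau> (p + w - z0) \<notin> \<int> \<and> coord_y \<tau> (p + w - z0) \<notin> \<int>"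
  shows "\<exists>w\<in>lattice \<tau>. p + w \<in> open_cell \<tau> z0"
proof -
  obtain w where w: "w \<in> lattice \<tau>" "p - z0 - w \<in> fund_domain \<tau>"
    using fund_domain_translate[OF \<tau>, of "p - z0"] by auto
  have w': "- w \<in> lattice \<tau>" using lattice_closed(4)[OF \<tau> w(1)] .
  have "coord_x \<tau> (p + - w - z0) \<in> {0..<1}" "coord_y \<tau> (p + - w - z0) \<in> {0..<1}"
    using w(2) by (simp_all add: fund_domain_iff_coord[OF \<tau>] algebra_simps)
  moreover have "coord_x \<tau> (p + - w - z0) \<noteq> 0" "coord_y \<tau> (p + - w - z0) \<noteq> 0"
    using gen[OF w'] by (metis Ints_0)+
  ultimately have "p + - w \<in> open_cell \<tau> z0" by (auto simp: open_cell_def)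
  then show ?thesis using w' by blast
qed

lemma open_cell_inj:
  assumes \<tau>: "Im \<tau> > 0" and "p \<in> open_cell \<tau> z0" "q \<in> open_cell \<tau> z0" "p - q \<in> lattice \<tau>"
  shows "p = q"
proof -
  have "coord_x \<tau> (p - q) \<in> \<int>" "coord_y \<tau> (p - q) \<in> \<int>"
    using assms(4) by (simp_all add: lattice_iff_coord[OF \<tau>])
  moreover have "\<bar>coord_x \<tau> (p - q)\<bar> < 1" "\<bar>coord_y \<tau> (p - q)\<bar> < 1"
    using assms(2,3) by (auto simp: open_cell_def coord_diff)
  ultimately have "coord_x \<tau> (p - q) = 0" "coord_y \<tau> (p - q) = 0"
    using Ints_nonzero_abs_less1 by blast+
  then show ?thesis using coord_decomposition[OF \<tau>, of "p - q"] by simp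
qed

lemma solution_minus: "solution \<tau> (- a) u \<longleftrightarrow> solution \<tau> a u"
proof -
  have "singular_set \<tau> (- a) = singular_set \<tau> a" by (auto simp: singular_set_def)
  then show ?thesis by (simp add: solution_def add.commute)
qed

text \<open>The elliptic function \<open>g = f'/f\<close> has a simple pole at every zero and pole of \<open>f\<close>; elsewhere its
  order is the singular weight. The points \<open>\<plusminus>a\<close> are poles of \<open>g\<close>, so its zeros are lattice points of
  order at most 2. A cell contains at most one lattice point, hence at most two poles of \<open>g\<close>, and these
  are the representatives of \<open>\<plusminus>a\<close>. So \<open>f\<close> has a double zero at \<open>a\<close>, a double pole at \<open>-a\<close>
  and no other zeros and poles modulo the lattice, and Abel's relation for \<open>f\<close> has the
  right-hand side \<open>2a - 2(-a)\<close> up to twice a lattice vector.\<close>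

lemma developing_divisor:
  assumes \<tau>: "Im \<tau> > 0" and dev: "developing f u"
    and u: "\<And>\<beta>. solution \<tau> a (u \<beta>)" and a: "a \<notin> lattice \<tau>" "2 * a \<notin> lattice \<tau>"
    and zero: "f a = 0" "\<not> is_pole f a" and pole: "is_pole f (- a)"
    and per1: "\<And>z. f (z + 1) = exp A * f z" and per\<tau>: "\<And>z. f (z + \<tau>) = exp B * f z"
  obtains I J w where "exp I = exp A" "exp J = exp B" "w \<in> lattice \<tau>" "J - \<tau> * I = 2 * pi * \<i> * (4 * a + 2 * w)"
proof -
  note nice = developing_nice[OF dev]
  define g0 where "g0 z = deriv f z / f z" for z
  define g where "g = remove_sings g0"
  have mero_g0: "g0 meromorphic_on A" for A
    unfolding g0_def[abs_def] using nice_meromorphic[OF nice] by (intro meromorphic_intros)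
  have nice_g: "g nicely_meromorphic_on UNIV"
    unfolding g_def by (rule remove_sings_nicely_meromorphic[OF mero_g0])
  have iso: "isolated_singularity_at g0 p" for p
    using mero_g0[of "{p}"] by (simp add: meromorphic_at_iff)
  have zorder_g: "zorder g p = zorder g0 p" and pole_g: "is_pole g p \<longleftrightarrow> is_pole g0 p" for p
    unfolding g_def using iso by simp_all
  have g_at_zero: "zorder g p = - 1" "g p = 0" "is_pole g p" if "f p = 0" for p
  proof -
    show z: "zorder g p = - 1" using zorder_logderiv(1)[OF dev that] by (simp add: zorder_g g0_def[abs_def])
    have "eventually (\<lambda>z. g0 z \<noteq> 0) (at p)"
      using deriv_eventually_nonzero[OF dev, of p] nice_eventually_neq[OF nice, of 0 p]
      by eventually_elim (simp add: g0_def)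
    then have "is_pole g0 p" using z zorder_neg_imp_is_pole[OF mero_g0] by (simp add: zorder_g)
    then show "is_pole g p" by (simp add: pole_g)
    then show "g p = 0" using is_pole_zero_at_nicely_mero[OF nice_g] by simp
  qed
  have nonconst_g: "\<not> g constant_on UNIV"
  proof
    assume "g constant_on UNIV"
    then obtain c where "g = (\<lambda>_. c)" by (auto simp: constant_on_def fun_eq_iff)
    then show False using g_at_zero(3)[OF zero(1)] by simp
  qed
  have g_at_nonzero: "zorder g p = int (singular_weight \<tau> a p)" if "f p \<noteq> 0" for p
  proof -
    have "\<not> is_pole f p" using that nice_pole_zero[OF nice] by blast
    then show ?thesis
      using zorder_logderiv(2)[OF dev that] zorder_deriv_eq_singular_weight[OF dev \<tau> u a]
      by (simp add: zorder_g g0_def[abs_def])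
  qed
  have quasi: "\<exists>c. c \<noteq> 0 \<and> (\<forall>z. f (z + w) = c * f z)" if "w \<in> lattice \<tau>" for w
    by (rule quasi_period_lattice[OF per1 per\<tau> that])
  have zero_translate: "f (p + w) = 0" if "f p = 0" "w \<in> lattice \<tau>" for p w
    using quasi[OF that(2)] that(1) by auto
  have fma: "f (- a) = 0" using nice_pole_zero[OF nice pole] .
  (* A cell that suits f and g at the same time. *)
  obtain z0 where z0: "\<And>z. f z = 0 \<or> g z = 0 \<Longrightarrow> coord_x \<tau> (z - z0) \<notin> \<int> \<and> coord_y \<tau> (z - z0) \<notin> \<int>"
    using generic_base_point[OF \<tau>, of "{z. f z = 0} \<union> {z. g z = 0}"]
      nice_zeros_countable[OF nice] nice_zeros_countable[OF nice_g nonconst_g] by auto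
  define Zf where "Zf = {p. f p = 0} \<inter> open_cell \<tau> z0"
  define Zg where "Zg = {p. g p = 0} \<inter> open_cell \<tau> z0"
  have g_per: "g (z + 1) = 1 * g z" "g (z + \<tau>) = 1 * g z" for z
    using remove_sings_logderiv_period[OF nice, of 1 "exp A" z] per1
      remove_sings_logderiv_period[OF nice, of \<tau> "exp B" z] per\<tau>
    by (simp_all add: g_def g0_def[abs_def])
  have z0_g: "coord_x \<tau> (z - z0) \<notin> \<int> \<and> coord_y \<tau> (z - z0) \<notin> \<int>" if "g z = 0" for z
    using z0 that by blast
  have z0_f: "coord_x \<tau> (z - z0) \<notin> \<int> \<and> coord_y \<tau> (z - z0) \<notin> \<int>" if "f z = 0" for z
    using z0 that by blast
  obtain I' J' where fin_g: "finite Zg" and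
    sum_g: "\<And>c d. d * J' - d * \<tau> * I' = 2 * pi * \<i> * (\<Sum>p\<in>Zg. (c + d * p) * zorder g p)"
    by (rule argument_principle_parallelogram[OF \<tau> nice_g nonconst_g g_per z0_g, folded Zg_def]) (assumption, rule that)
  obtain I J where fin_f: "finite Zf" and IJ: "exp I = exp A" "exp J = exp B" and
    sum_f: "\<And>c d. d * J - d * \<tau> * I = 2 * pi * \<i> * (\<Sum>p\<in>Zf. (c + d * p) * zorder f p)"
    by (rule argument_principle_parallelogram[OF \<tau> nice per1 per\<tau> z0_f, folded Zf_def]) (assumption, rule that)
  have "Zf \<subseteq> Zg" using g_at_zero(2) by (auto simp: Zf_def Zg_def)
  have "(\<Sum>p\<in>Zg. of_int (zorder g p)) = (0 :: complex)"
    using sum_g[where c = 1 and d = 0] by simp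
  then have "of_int (\<Sum>p\<in>Zg. zorder g p) = (0 :: complex)" by simp
  then have "(\<Sum>p\<in>Zg. zorder g p) = 0" by (simp only: of_int_eq_0_iff)
  also have "(\<Sum>p\<in>Zg. zorder g p) = (\<Sum>p\<in>Zf. zorder g p) + (\<Sum>p\<in>Zg - Zf. zorder g p)"
    using fin_g \<open>Zf \<subseteq> Zg\<close> by (simp add: sum.subset_diff)
  also have "(\<Sum>p\<in>Zf. zorder g p) = - int (card Zf)"
    using g_at_zero(1) by (simp add: Zf_def)
  finally have card_eq: "int (card Zf) = (\<Sum>p\<in>Zg - Zf. zorder g p)" by simp
  also have "\<dots> \<le> (\<Sum>p\<in>Zg - Zf. if p \<in> lattice \<tau> then 2 else 0)"
  proof (rule sum_mono)
    fix p assume "p \<in> Zg - Zf"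
    then have "f p \<noteq> 0" by (auto simp: Zf_def Zg_def)
    then have "p - a \<notin> lattice \<tau>" "p + a \<notin> lattice \<tau>"
      using zero_translate[OF zero(1), of "p - a"] zero_translate[OF fma, of "p + a"] by auto
    then show "zorder g p \<le> (if p \<in> lattice \<tau> then 2 else 0)"
      using g_at_nonzero[OF \<open>f p \<noteq> 0\<close>] by (simp add: singular_weight_def)
  qed
  also have "\<dots> = 2 * int (card ((Zg - Zf) \<inter> lattice \<tau>))"
    using fin_g by (simp add: sum.If_cases)
  finally have "int (card Zf) \<le> 2 * int (card ((Zg - Zf) \<inter> lattice \<tau>))" .
  moreover have "card ((Zg - Zf) \<inter> lattice \<tau>) \<le> Suc 0"
  proof (subst card_le_Suc0_iff_eq)
    show "finite ((Zg - Zf) \<inter> lattice \<tau>)" using fin_g by simp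
    show "\<forall>p\<in>(Zg - Zf) \<inter> lattice \<tau>. \<forall>q\<in>(Zg - Zf) \<inter> lattice \<tau>. p = q"
      using open_cell_inj[OF \<tau>] lattice_closed(3)[OF \<tau>] unfolding Zg_def by blast
  qed
  ultimately have "card Zf \<le> 2" by linarith
  obtain w1 where w1: "w1 \<in> lattice \<tau>" "a + w1 \<in> open_cell \<tau> z0"
    using open_cell_representative[OF \<tau>, of a z0] z0_f zero_translate[OF zero(1)] by blast
  obtain w2 where w2: "w2 \<in> lattice \<tau>" "- a + w2 \<in> open_cell \<tau> z0"
    using open_cell_representative[OF \<tau>, of "- a" z0] z0_f zero_translate[OF fma] by blast
  have neq: "a + w1 \<noteq> - a + w2"
  proof
    assume "a + w1 = - a + w2"
    then have "2 * a = w2 - w1" by (simp add: algebra_simps)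
    then show False using a(2) lattice_closed(3)[OF \<tau> w2(1) w1(1)] by simp
  qed
  have "{a + w1, - a + w2} \<subseteq> Zf"
    using w1 w2 zero_translate[OF zero(1)] zero_translate[OF fma] by (auto simp: Zf_def)
  moreover have "card {a + w1, - a + w2} = 2" using neq by simp
  ultimately have Zf: "Zf = {a + w1, - a + w2}"
    using card_seteq[OF fin_f, of "{a + w1, - a + w2}"] \<open>card Zf \<le> 2\<close> by simp
  have weights: "singular_weight \<tau> a a = 1" "singular_weight \<tau> a (- a) = 1"
    using a(1) lattice_closed(1,4)[OF \<tau>] by (auto simp: singular_weight_def dest: lattice_closed(4)[OF \<tau>])
  have "zorder (deriv f) a = 1"
    using zorder_deriv_eq_singular_weight[OF dev \<tau> u a zero(2)] weights by simp
  then have za: "zorder f a = 2" using zorder_logderiv(3)[OF dev zero(1)] by simp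
  have zma: "zorder f (- a) = - 2"
  proof -
    let ?h = "\<lambda>z. inverse (f z)"
    note devh = developing_inverse[OF dev]
    have np: "\<not> is_pole ?h (- a)"
    proof
      assume "is_pole ?h (- a)"
      then have "isolated_zero f (- a)" by (simp add: is_pole_inverse_iff)
      then show False using pole pole_is_not_zero by blast
    qed
    have "zorder (deriv ?h) (- a) = 1"
      using zorder_deriv_eq_singular_weight[OF devh \<tau> u a np] weights by simp
    then have "zorder ?h (- a) = 2" using zorder_logderiv(3)[OF devh, of "- a"] fma by simp
    moreover have "zorder ?h (- a) = - zorder f (- a)"
      using nice_meromorphic[OF nice, of "{- a}"] nice_eventually_neq[OF nice, of 0 "- a"]
      by (intro zorder_inverse) (auto simp: meromorphic_at_iff intro: eventually_frequently)
    ultimately show ?thesis by simp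
  qed
  have z1: "zorder f (a + w1) = 2"
    using quasi[OF w1(1)] zorder_quasi_period za by metis
  have z2: "zorder f (- a + w2) = - 2"
    using quasi[OF w2(1)] zorder_quasi_period zma by metis
  have "J - \<tau> * I = 2 * pi * \<i> * (\<Sum>p\<in>Zf. p * zorder f p)"
    using sum_f[where c = 0 and d = 1] by simp
  also have "(\<Sum>p\<in>Zf. p * of_int (zorder f p)) = 4 * a + 2 * (w1 - w2)"
    unfolding Zf using neq z1 z2 by (simp add: algebra_simps)
  finally show ?thesis
    using that[OF IJ lattice_closed(3)[OF \<tau> w1(1) w2(1)]] by blast
qed

theorem theorem1p3:
  fixes \<tau> a :: complex and r s :: real
    and G :: "complex \<Rightarrow> real"
    and f :: "complex \<Rightarrow> complex"
    and u :: "real \<Rightarrow> complex \<Rightarrow> real"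
  assumes "Im \<tau> > 0"
    and "green_function \<tau> G"
    and "r \<in> {0..1/2}" and "s \<in> {0..1}" and "\<not> (2 * r \<in> \<int> \<and> 2 * s \<in> \<int>)"
    and "a = of_real r + of_real s * \<tau>"
    and "nontrivial_critical_point \<tau> G a" and "nontrivial_critical_point \<tau> G (- a)"
    and "solution_family \<tau> a f u"
    and "even_family \<tau> a u"
    and "blows_up_at (\<lambda>\<beta> z. u \<beta> z + 4 * pi * G (z - a)) a at_top"
    and "blows_up_at (\<lambda>\<beta> z. u \<beta> z + 4 * pi * G (z + a)) (- a) at_bot"
  shows "\<forall>r' s'. r' - 2 * r \<in> \<int> \<and> s' - 2 * s \<in> \<int> \<longrightarrow> has_monodromy_data \<tau> f r' s'"
proof -
  note \<tau> = assms(1)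
  have coord_a: "coord_x \<tau> a = r" "coord_y \<tau> a = s"
    unfolding assms(6) using coord_combination[OF \<tau>] by auto
  have a2: "2 * a \<notin> lattice \<tau>"
  proof -
    have "coord_x \<tau> (2 * a) = 2 * r" "coord_y \<tau> (2 * a) = 2 * s"
      using coord_add[of \<tau> a a] coord_a by (simp_all flip: mult_2)
    then show ?thesis using assms(5) by (simp add: lattice_iff_coord[OF \<tau>])
  qed
  have a1: "a \<notin> lattice \<tau>"
    using a2 lattice_closed(2)[OF \<tau>, of a a] by (auto simp flip: mult_2)
  have sol: "solution \<tau> a (u \<beta>)" for \<beta> using assms(9) by (simp add: solution_family_def)
  have dev: "developing f u" using solution_family_developing[OF assms(9)] .
  note nice = developing_nice[OF dev]
  have zero: "f a = 0" "\<not> is_pole f a"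
    using blow_up_imp_zero[OF \<tau> assms(2) dev sol a1 a2 assms(11)] by auto
  have pole: "is_pole f (- a)"
  proof -
    note devh = developing_inverse[OF dev]
    have "blows_up_at (\<lambda>\<beta> z. u (- \<beta>) z + 4 * pi * G (z - - a)) (- a) at_top"
      using assms(12) unfolding blows_up_at_def at_bot_mirror filterlim_filtermap by simp
    moreover have "- a \<notin> lattice \<tau>" "2 * - a \<notin> lattice \<tau>"
      using a1 a2 lattice_closed(4)[OF \<tau>, of "- a"] lattice_closed(4)[OF \<tau>, of "- (2 * a)"] by auto
    ultimately have h: "inverse (f (- a)) = 0" "\<not> is_pole (\<lambda>z. inverse (f z)) (- a)"
      using blow_up_imp_zero[OF \<tau> assms(2) devh, of "- a"] sol solution_minus by auto
    then have "\<not> isolated_zero f (- a)" by (simp add: is_pole_inverse_iff)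
    then show ?thesis using zero_or_pole_zorder(1)[OF dev, of "- a"] h(1) by auto
  qed
  obtain r1 s1 where data: "has_monodromy_data \<tau> f r1 s1"
    using assms(9) by (auto simp: solution_family_def type_II_def)
  define A where "A = - 4 * of_real pi * \<i> * of_real s1"
  define B where "B = 4 * of_real pi * \<i> * of_real r1"
  have per: "f (z + 1) = exp A * f z" "f (z + \<tau>) = exp B * f z" for z
    using data by (simp_all add: has_monodromy_data_def A_def B_def)
  obtain I J w where IJ: "exp I = exp A" "exp J = exp B" and w: "w \<in> lattice \<tau>"
    and abel: "J - \<tau> * I = 2 * pi * \<i> * (4 * a + 2 * w)"
    using developing_divisor[OF \<tau> dev sol a1 a2 zero pole per] .
  obtain k l :: int where kl: "I = A + of_int (2 * k) * of_real pi * \<i>" "J = B + of_int (2 * l) * of_real pi * \<i>"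
    using IJ by (auto simp: exp_eq)
  have "(2 * pi * \<i>) * (of_real (2 * r1 + l) + of_real (2 * s1 - k) * \<tau>) = (2 * pi * \<i>) * (4 * a + 2 * w)"
    using abel unfolding kl A_def B_def by (simp add: algebra_simps)
  then have eq: "of_real (2 * r1 + l) + of_real (2 * s1 - k) * \<tau> = 4 * a + 2 * w"
    by (simp only: mult_cancel_left) simp
  have four: "4 * a + 2 * w = a + a + a + a + w + w" by simp
  (* The monodromy data are real, so the complex relation splits into its two lattice coordinates. *)
  have x: "2 * r1 + l = 4 * r + 2 * coord_x \<tau> w" and y: "2 * s1 - k = 4 * s + 2 * coord_y \<tau> w"
    using coord_combination[OF \<tau>, of "2 * r1 + l" "2 * s1 - k"] unfolding eq four coord_add coord_a by simp_all
  have "coord_x \<tau> w \<in> \<int>" "coord_y \<tau> w \<in> \<int>" using w by (simp_all add: lattice_iff_coord[OF \<tau>])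
  then obtain i j :: int where ij: "coord_x \<tau> w = of_int i" "coord_y \<tau> w = of_int j" by (auto elim!: Ints_cases)
  show ?thesis
  proof (intro allI impI)
    fix r' s' :: real assume rs: "r' - 2 * r \<in> \<int> \<and> s' - 2 * s \<in> \<int>"
    then obtain m n :: int where mn: "r' = 2 * r + of_int m" "s' = 2 * s + of_int n"
      by (metis Ints_cases add_diff_cancel_left' diff_add_cancel add.commute)
    have r': "2 * r' = 2 * r1 + of_int (l - 2 * i + 2 * m)" using x ij mn by simp
    have s': "2 * s' = 2 * s1 + of_int (- k - 2 * j + 2 * n)" using y ij mn by simp
    have "4 * of_real pi * \<i> * of_real r' = B + of_real (of_int (2 * (l - 2 * i + 2 * m)) * pi) * \<i>"
    proof -
      have "4 * of_real pi * \<i> * of_real r' = 2 * of_real pi * \<i> * of_real (2 * r')" by simp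
      also have "\<dots> = B + of_real (of_int (2 * (l - 2 * i + 2 * m)) * pi) * \<i>"
        unfolding r' B_def by (simp add: algebra_simps)
      finally show ?thesis .
    qed
    then have "exp (4 * of_real pi * \<i> * of_real r') = exp B" unfolding exp_eq by blast
    moreover
    have "- 4 * of_real pi * \<i> * of_real s' = A + of_real (of_int (2 * - (- k - 2 * j + 2 * n)) * pi) * \<i>"
    proof -
      have "- 4 * of_real pi * \<i> * of_real s' = - 2 * of_real pi * \<i> * of_real (2 * s')" by simp
      also have "\<dots> = A + of_real (of_int (2 * - (- k - 2 * j + 2 * n)) * pi) * \<i>"
        unfolding s' A_def by (simp add: algebra_simps)
      finally show ?thesis .
    qed
    then have "exp (- 4 * of_real pi * \<i> * of_real s') = exp A" unfolding exp_eq by blast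
    ultimately show "has_monodromy_data \<tau> f r' s'"
      using per by (simp add: has_monodromy_data_def)
  qed
qed

end
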